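(* Let $d\nu$ be a nonnegative Borel measure on $\mathbb{R}_+=(0,\infty)$, singular with respect to Lebesgue measure, with $d\nu((0,c))<\infty$ for all $c>0$, and let $q$ be real-valued with $q\in L^1(0,c)$ for all $c>0$. Assume that the closed topological support $\Sigma$ of $d\nu$ is unbounded and has Lebesgue measure zero, write $\mathbb{R}_+\setminus\Sigma=\bigcup_{k=1}^\infty\Delta_k$ with $\Delta_k$ the component intervals, $d_k=|\Delta_k|$, and assume $$\sup_k d_k<\infty,\qquad \sup_{k\in\mathbb{N}}\frac{1}{d_k}\int_{\Delta_k}q_-(x)\,dx<\infty,\qquad q_-:=(|q|-q)/2.$$ Then the two conditions $$\lim_{x\to\infty}\int_x^{x+\varepsilon}q(t)\,dt=+\infty\ \text{ for every }\varepsilon>0\qquad\text{and}\qquad\lim_{k\to\infty}\frac{1}{d_k}\int_{\Delta_k}q(x)\,dx=+\infty$$ are sufficient for the Hamiltonian $\mathrm{H}_{\nu,q}$ $(=\mathrm{H}_{\nu,q}^* )$ to be lower semibounded and to have discrete spectrum.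
   Context: Put $dP=dx+d\nu$. A function $f$ is locally absolutely continuous with respect to $dP$ if it is locally of bounded variation and its Borel measure satisfies $df=f^{[1]}\,dP$ for some $f^{[1]}\in L^1_{\mathrm{loc}}(\mathbb{R}_+;dP)$ (the quasi-derivative; left-continuous representatives of $f$ are used). $\mathrm{H}_{\nu,q}$ is the operator $f\mapsto-(f^{[1]})'+qf$ in $L^2(\mathbb{R}_+)$ on all $f\in L^2(\mathbb{R}_+)$ which are locally absolutely continuous with respect to $dP$, with $f^{[1]}\in AC_{\mathrm{loc}}(\mathbb{R}_+)$, $-(f^{[1]})'+qf\in L^2(\mathbb{R}_+)$ and Neumann condition $f^{[1]}(0)=0$; it corresponds to the closure of the quadratic form $\int_{\mathbb{R}_+}|f^{[1]}|^2dP+\int_{\mathbb{R}_+}q|f|^2dx$ on the functions $f\in L^2(\mathbb{R}_+)$ with bounded support in $[0,\infty)$, locally absolutely continuous with respect to $dP$, with $f^{[1]}\in L^2(\mathbb{R}_+;dP)$. Discrete spectrum means that the spectrum consists of isolated eigenvalues of finite multiplicity. *)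

theory Defs
  imports "HOL-Analysis.Analysis"
begin

section \<open>Measures on the half-line\<close>

text \<open>All measures live on the subspace \<open>(0,\<infinity>)\<close>, i.e. on the Borel sets of \<open>{0<..}\<close>.\<close>

definition lborel_pos :: "real measure" where
  "lborel_pos = restrict_space lborel {0<..}"

definition sum_measure :: "'a measure \<Rightarrow> 'a measure \<Rightarrow> 'a measure" where
  "sum_measure M N = measure_of (space M) (sets M) (\<lambda>A. emeasure M A + emeasure N A)"

definition mutually_singular :: "'a measure \<Rightarrow> 'a measure \<Rightarrow> bool" where
  "mutually_singular M N \<longleftrightarrow> sets M = sets N \<and>
     (\<exists>A\<in>sets M. emeasure M A = 0 \<and> emeasure N (space N - A) = 0)"

definition measure_support :: "'a::topological_space measure \<Rightarrow> 'a set" where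
  "measure_support M = {x \<in> space M. \<forall>U. open U \<longrightarrow> x \<in> U \<longrightarrow> emeasure M (U \<inter> space M) > 0}"

lemma space_lborel_pos [simp]: "space lborel_pos = {0<..}"
  by (simp add: lborel_pos_def space_restrict_space)

lemma sets_lborel_pos: "sets lborel_pos = sets (restrict_space borel {0<..})"
  by (simp add: lborel_pos_def sets_restrict_space)

lemma space_sum_measure [simp]: "space (sum_measure M N) = space M"
  by (simp add: sum_measure_def)

lemma sets_sum_measure [simp]: "sets (sum_measure M N) = sets M"
  by (simp add: sum_measure_def)

lemma emeasure_sum_measure:
  assumes eq: "sets M = sets N" and A: "A \<in> sets M"
  shows "emeasure (sum_measure M N) A = emeasure M A + emeasure N A"
proof (rule emeasure_measure_of [OF sum_measure_def])
  show "sets M \<subseteq> Pow (space M)"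
    by (rule sets.space_closed)
  show "positive (sets (sum_measure M N)) (\<lambda>A. emeasure M A + emeasure N A)"
    by (simp add: positive_def)
  show "countably_additive (sets (sum_measure M N)) (\<lambda>A. emeasure M A + emeasure N A)"
    unfolding countably_additive_def
    by (auto simp: eq suminf_add [symmetric] suminf_emeasure)
  show "A \<in> sets (sum_measure M N)"
    using A by simp
qed

section \<open>Local absolute continuity with respect to a measure\<close>

definition locally_bv :: "(real \<Rightarrow> 'a::real_normed_vector) \<Rightarrow> bool" where
  "locally_bv f \<longleftrightarrow> (\<forall>c>0. \<exists>V. \<forall>n. \<forall>x :: nat \<Rightarrow> real.
     mono_on {..n} x \<longrightarrow> x ` {..n} \<subseteq> {0..c} \<longrightarrow>
     (\<Sum>i<n. norm (f (x (Suc i)) - f (x i))) \<le> V)"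

text \<open>
  \<open>df = g dM\<close>.  For a left-continuous \<open>f\<close> of locally bounded variation, \<open>df\<close> is the
  Borel measure with \<open>df([a,b)) = f(b) - f(a)\<close>.  Since \<open>M\<close> does not charge \<open>0\<close>, the case
  \<open>a = 0\<close> says that \<open>f(0)\<close> is the right limit of \<open>f\<close> at \<open>0\<close>.  Local integrability is
  integrability on every \<open>(0,c)\<close>.  For \<open>M = lborel_pos\<close> the condition says that
  \<open>f\<close> is in \<open>AC_loc\<close> with \<open>f' = g\<close> almost everywhere.
\<close>

definition has_loc_density ::
    "real measure \<Rightarrow> (real \<Rightarrow> complex) \<Rightarrow> (real \<Rightarrow> complex) \<Rightarrow> bool" where
  "has_loc_density M f g \<longleftrightarrow>
     locally_bv f \<and>
     (\<forall>x>0. continuous (at_left x) f) \<and>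
     (\<forall>c>0. set_integrable M {0<..<c} g) \<and>
     (\<forall>a b. 0 \<le> a \<longrightarrow> a \<le> b \<longrightarrow> f b - f a = (LINT x:{a..<b}|M. g x))"

section \<open>Unbounded operators in an \<open>L\<^sup>2\<close> space\<close>

text \<open>
  Elements of \<open>L\<^sup>2\<close> are handled through their representatives: an operator is its graph, a set
  of pairs of square integrable functions that is closed under almost everywhere equality.
\<close>

definition L2 :: "'a measure \<Rightarrow> ('a \<Rightarrow> complex) set" where
  "L2 M = {f \<in> borel_measurable M. integrable M (\<lambda>x. (cmod (f x))\<^sup>2)}"

definition L2_inner :: "'a measure \<Rightarrow> ('a \<Rightarrow> complex) \<Rightarrow> ('a \<Rightarrow> complex) \<Rightarrow> complex" where
  "L2_inner M f g = (LINT x|M. f x * cnj (g x))"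

definition L2_norm :: "'a measure \<Rightarrow> ('a \<Rightarrow> complex) \<Rightarrow> real" where
  "L2_norm M f = sqrt (LINT x|M. (cmod (f x))\<^sup>2)"

type_synonym 'a graph = "(('a \<Rightarrow> complex) \<times> ('a \<Rightarrow> complex)) set"

definition densely_defined :: "'a measure \<Rightarrow> 'a graph \<Rightarrow> bool" where
  "densely_defined M A \<longleftrightarrow>
     (\<forall>g\<in>L2 M. \<forall>e>0. \<exists>(f, h)\<in>A. L2_norm M (\<lambda>x. g x - f x) < e)"

definition adjoint_graph :: "'a measure \<Rightarrow> 'a graph \<Rightarrow> 'a graph" where
  "adjoint_graph M A = {(g, k). g \<in> L2 M \<and> k \<in> L2 M \<and>
     (\<forall>(f, h)\<in>A. L2_inner M h g = L2_inner M f k)}"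

definition self_adjoint :: "'a measure \<Rightarrow> 'a graph \<Rightarrow> bool" where
  "self_adjoint M A \<longleftrightarrow> densely_defined M A \<and> A = adjoint_graph M A"

text \<open>The real part is redundant for symmetric operators.\<close>

definition lower_semibounded :: "'a measure \<Rightarrow> 'a graph \<Rightarrow> bool" where
  "lower_semibounded M A \<longleftrightarrow>
     (\<exists>\<gamma>::real. \<forall>(f, h)\<in>A. Re (L2_inner M h f) \<ge> \<gamma> * (L2_norm M f)\<^sup>2)"

text \<open>
  \<open>z\<close> is in the resolvent set iff \<open>A - z\<close> is onto and bounded below, that is, bijective with
  bounded inverse.
\<close>

definition resolvent_set :: "'a measure \<Rightarrow> 'a graph \<Rightarrow> complex set" where
  "resolvent_set M A = {z.
     (\<forall>k\<in>L2 M. \<exists>(f, h)\<in>A. AE x in M. h x - z * f x = k x) \<and>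
     (\<exists>C. \<forall>(f, h)\<in>A. L2_norm M f \<le> C * L2_norm M (\<lambda>x. h x - z * f x))}"

definition spectrum :: "'a measure \<Rightarrow> 'a graph \<Rightarrow> complex set" where
  "spectrum M A = - resolvent_set M A"

definition eigenspace :: "'a measure \<Rightarrow> 'a graph \<Rightarrow> complex \<Rightarrow> ('a \<Rightarrow> complex) set" where
  "eigenspace M A z = {f. (f, \<lambda>x. z * f x) \<in> A}"

definition eigenvalue :: "'a measure \<Rightarrow> 'a graph \<Rightarrow> complex \<Rightarrow> bool" where
  "eigenvalue M A z \<longleftrightarrow> (\<exists>f\<in>eigenspace M A z. \<not> (AE x in M. f x = 0))"

definition finite_multiplicity :: "'a measure \<Rightarrow> 'a graph \<Rightarrow> complex \<Rightarrow> bool" where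
  "finite_multiplicity M A z \<longleftrightarrow>
     (\<exists>B. finite B \<and> B \<subseteq> eigenspace M A z \<and>
        (\<forall>f\<in>eigenspace M A z. \<exists>c. AE x in M. f x = (\<Sum>b\<in>B. c b * b x)))"

definition discrete_spectrum :: "'a measure \<Rightarrow> 'a graph \<Rightarrow> bool" where
  "discrete_spectrum M A \<longleftrightarrow> (\<forall>z\<in>spectrum M A.
     z isolated_in spectrum M A \<and> eigenvalue M A z \<and> finite_multiplicity M A z)"

section \<open>The Hamiltonian\<close>

text \<open>
  \<open>u\<close> is the left-continuous representative of \<open>f\<close>, \<open>g\<close> its quasi-derivative with respect to
  \<open>dP = dx + d\<nu>\<close>, and \<open>k\<close> the derivative of \<open>g\<close>; \<open>f\<close> and \<open>h\<close> themselves only matter up to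
  null sets.
\<close>

definition hamiltonian :: "real measure \<Rightarrow> (real \<Rightarrow> real) \<Rightarrow> real graph" where
  "hamiltonian \<nu> q = {(f, h). f \<in> L2 lborel_pos \<and> h \<in> L2 lborel_pos \<and>
     (\<exists>u g k. (AE x in lborel_pos. f x = u x) \<and>
        has_loc_density (sum_measure lborel_pos \<nu>) u g \<and>
        has_loc_density lborel_pos g k \<and>
        g 0 = 0 \<and>
        (AE x in lborel_pos. h x = - k x + complex_of_real (q x) * u x))}"

end

theory Submission
  imports Defs
begin

text \<open>
  On a gap of the support of \<open>d\<nu>\<close> a function of the form domain is absolutely continuous, so on
  every subinterval \<open>J\<close> its oscillation is controlled by \<open>|J|\<close> times its energy there. The bound on
  the means of \<open>q\<^sub>-\<close> makes \<open>q\<^sub>-\<close> form bounded with small relative bound, uniformly in the gaps. Far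
  out, long gaps are cut into short pieces on which the window condition makes the mean of \<open>q\<^sub>+\<close>
  large, and on short gaps the mean of \<open>q\<close> itself is large. As the support is a Lebesgue null set,
  summing over the gaps shows that the form on \<open>(0,c)\<close>, with \<open>c\<close> in the support, is bounded below
  and dominates any multiple of the mass beyond a suitable \<open>N\<close>, without boundary condition at \<open>c\<close>.

  Everything else is one-dimensional. Let \<open>\<phi>\<^sub>z\<close> be the solution of \<open>\<tau>\<phi> = z\<phi>\<close> with the Neumann
  condition at \<open>0\<close> and \<open>\<phi>\<^sub>z(0) = 1\<close>. Solutions of \<open>(\<tau> - z)u = k\<close> on \<open>(0,c)\<close> differ by multiples of
  \<open>\<phi>\<^sub>z\<close>, so the tail bound yields compactness by looking at a single coefficient: if \<open>\<phi>\<^sub>z\<close> is not in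
  \<open>L\<^sup>2\<close>, the solutions with Neumann conditions at \<open>0\<close> and \<open>c\<close> are bounded by \<open>k\<close> uniformly in \<open>c\<close> and
  converge as \<open>c \<rightarrow> \<infinity>\<close>, and \<open>z\<close> is in the resolvent set. A cutoff argument shows that \<open>\<phi>\<^sub>\<lambda>\<close> is not in
  \<open>L\<^sup>2\<close> for \<open>\<lambda>\<close> below the form bound; passing to the limit in Green's identity gives symmetry and
  semiboundedness, and surjectivity of \<open>H - \<lambda>\<close> then gives self-adjointness. Hence the spectrum is the
  set of \<open>z\<close> with \<open>\<phi>\<^sub>z\<close> in \<open>L\<^sup>2\<close>; such eigenvalues cannot accumulate because the \<open>\<phi>\<^sub>z\<close> are orthogonal,
  have uniformly small tails and depend continuously on \<open>z\<close> on compact sets.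
\<close>

section \<open>Locally finite measures on the half-line\<close>

text \<open>Truncation happens only at points \<open>c\<close> of the support. A gap is connected
  and avoids the support, so it lies on one side of \<open>c\<close>: no gap is ever cut, and the
  estimates on gaps, whose constants come from means over whole gaps, add up to the form on
  \<open>(0,c)\<close>. Across the support a function may jump. Jumps only add nonnegative energy,
  so it suffices to keep the Lebesgue part of the energy, and nothing has to be compared between
  neighbouring gaps.

  The constant \<open>C\<close> in \<open>coercive\<close> is fixed before \<open>M\<close>. Thus
  \<open>lam = - (C + 1)\<close> is chosen once while \<open>M\<close> stays free, and arbitrarily
  large \<open>M\<close> is the smallness of tails that stands in for a compact embedding.

  Limits \<open>c \<rightarrow> \<infinity>\<close> are taken only weakly, at the price of a factor
  2 in norm bounds; of the surplus 1 in \<open>lam\<close> the margin 1/2 survives in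
  \<open>ham_semibounded\<close>. This strict margin also gives the dense domain: instead of
  building domain elements with prescribed jumps, a vector orthogonal to the domain is written as
  \<open>(H - lam) f\<close>, the margin forces \<open>f = 0\<close>, and single-valuedness of the
  graph makes the vector vanish.\<close>

notation lborel_pos ("\<L>")

text \<open>Serves both \<open>\<L>\<close> and \<open>P\<close>, the sum of \<open>\<L>\<close> and
  \<open>\<nu>\<close>; integration by parts pairs a primitive for \<open>M\<close> with one for
  \<open>\<L>\<close>.\<close>

locale loc_finite =
  fixes M :: "real measure"
  assumes sets_M: "sets M = sets \<L>"
    and finite_M: "\<And>c. emeasure M {0<..<c} < \<infinity>"
begin

lemma space_M: "space M = {0<..}"
  using sets_eq_imp_space_eq[OF sets_M] by simp

lemma sets_M_iff: "A \<in> sets M \<longleftrightarrow> A \<subseteq> {0<..} \<and> A \<in> sets borel"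
  unfolding sets_M sets_lborel_pos by (subst sets_restrict_space_iff) auto

lemma Ioo_sets [measurable, simp]: "{0<..<c} \<in> sets M"
  by (auto simp: sets_M_iff)

lemma Ioo_sets': "0 \<le> a \<Longrightarrow> {a<..<c} \<in> sets M"
  by (auto simp: sets_M_iff)

lemma Ico_sets: "0 < a \<Longrightarrow> {a..<c} \<in> sets M"
  by (auto simp: sets_M_iff)

lemma measurable_M: "borel_measurable M = borel_measurable \<L>"
  by (rule measurable_cong_sets) (simp_all add: sets_M)

lemma borel_imp_M: "f \<in> borel_measurable borel \<Longrightarrow> f \<in> borel_measurable M"
  unfolding measurable_M lborel_pos_def by (rule measurable_restrict_space1) simp

lemma ident_M [measurable]: "(\<lambda>x. x) \<in> borel_measurable M"
  by (rule borel_imp_M) simp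

lemma emeasure_Ioo: "emeasure M {0<..<c} \<noteq> \<infinity>"
  using finite_M[of c] by simp

sublocale sigma_finite_measure M
proof
  show "\<exists>A. countable A \<and> A \<subseteq> sets M \<and> \<Union> A = space M \<and> (\<forall>a\<in>A. emeasure M a \<noteq> \<infinity>)"
  proof (intro exI[of _ "range (\<lambda>n::nat. {0<..<real n})"] conjI)
    show "\<Union> (range (\<lambda>n::nat. {0<..<real n})) = space M"
      unfolding space_M using reals_Archimedean2 by auto
  qed (use emeasure_Ioo in auto)
qed

lemma integrable_const_Ioo: "set_integrable M {0<..<c} (\<lambda>x. a::'b::{banach,second_countable_topology})"
  unfolding set_integrable_def
  by (rule integrable_scaleR_left, rule integrable_real_indicator) (use finite_M in auto)

lemma set_integrable_bounded:
  fixes f :: "real \<Rightarrow> 'b::{banach,second_countable_topology}"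
  assumes "f \<in> borel_measurable M" "\<And>x. 0 < x \<Longrightarrow> x < c \<Longrightarrow> norm (f x) \<le> B"
  shows "set_integrable M {0<..<c} f"
  unfolding set_integrable_def
proof (rule Bochner_Integration.integrable_bound)
  show "integrable M (\<lambda>x. indicator {0<..<c} x *\<^sub>R B)"
    using integrable_const_Ioo[of c B] unfolding set_integrable_def .
  show "(\<lambda>x. indicator {0<..<c} x *\<^sub>R f x) \<in> borel_measurable M"
    using assms(1) by measurable
  show "AE x in M. norm (indicator {0<..<c} x *\<^sub>R f x) \<le> norm (indicator {0<..<c} x *\<^sub>R B)"
  proof (rule AE_I2)
    fix x
    show "norm (indicator {0<..<c} x *\<^sub>R f x) \<le> norm (indicator {0<..<c} x *\<^sub>R B)"
      using assms(2)[of x] by (cases "0 < x \<and> x < c") auto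
  qed
qed

lemma measurable_if_loc_integrable:
  fixes g :: "real \<Rightarrow> 'b::{banach,second_countable_topology}"
  assumes "\<And>c. set_integrable M {0<..<c} g"
  shows "g \<in> borel_measurable M"
proof (rule borel_measurable_LIMSEQ_metric)
  show "(\<lambda>x. indicator {0<..<real n} x *\<^sub>R g x) \<in> borel_measurable M" for n
    using assms[of "real n"] unfolding set_integrable_def by (rule borel_measurable_integrable)
  show "(\<lambda>n. indicator {0<..<real n} x *\<^sub>R g x) \<longlonglongrightarrow> g x" if "x \<in> space M" for x
  proof (rule tendsto_eventually)
    from that have "x > 0" by (simp add: space_M)
    obtain N where "x < real N" using reals_Archimedean2 by blast
    then show "\<forall>\<^sub>F n in sequentially. indicator {0<..<real n} x *\<^sub>R g x = g x"
      using \<open>x > 0\<close> by (intro eventually_sequentiallyI[of N]) auto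
  qed
qed

lemma set_integrable_Ioo_subset:
  fixes g :: "real \<Rightarrow> 'b::{banach,second_countable_topology}"
  assumes "set_integrable M {0<..<c} g" "A \<in> sets M" "A \<subseteq> {0<..<c}"
  shows "set_integrable M A g"
  using set_integrable_subset[OF assms(1)] assms by simp

lemma Ioo_split:
  fixes g :: "real \<Rightarrow> 'b::{banach,second_countable_topology}"
  assumes "set_integrable M {0<..<y} g" "0 < x" "x \<le> y"
  shows "(LINT t:{0<..<y}|M. g t) = (LINT t:{0<..<x}|M. g t) + (LINT t:{x..<y}|M. g t)"
proof -
  have "{0<..<y} = {0<..<x} \<union> {x..<y}" using assms by auto
  moreover have "set_integrable M {0<..<x} g" "set_integrable M {x..<y} g"
    using assms by (intro set_integrable_Ioo_subset[OF assms(1)] Ico_sets Ioo_sets; force)+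
  moreover have "{0<..<x} \<inter> {x..<y} = {}" by auto
  ultimately show ?thesis
    using set_integral_Un[of "{0<..<x}" "{x..<y}" M g] by simp
qed

end

section \<open>Lebesgue measure on the half-line as an instance\<close>

lemma Leb_emeasure: "A \<in> sets \<L> \<Longrightarrow> emeasure \<L> A = emeasure lborel A"
  unfolding lborel_pos_def by (subst emeasure_restrict_space) (auto simp: sets_restrict_space)

interpretation Leb: loc_finite \<L>
proof
  show "emeasure \<L> {0<..<c} < \<infinity>" for c
  proof (cases "c \<le> 0")
    case False
    have "{0<..<c} \<in> sets \<L>"
      unfolding sets_lborel_pos by (subst sets_restrict_space_iff) auto
    then show ?thesis using False by (simp add: Leb_emeasure)
  qed simp
qed simp

lemma Leb_AE_neq: "AE x in \<L>. x \<noteq> a"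
proof -
  have "AE x in lborel. x \<in> {0<..} \<longrightarrow> x \<noteq> a"
    using AE_lborel_singleton[of a] by eventually_elim simp
  then show ?thesis
    unfolding lborel_pos_def by (subst AE_restrict_space_iff) auto
qed

lemma Leb_set_integral:
  fixes f :: "real \<Rightarrow> 'b::{banach,second_countable_topology}"
  assumes "A \<subseteq> {0<..}"
  shows "(LINT t:A|\<L>. f t) = (LINT t:A|lborel. f t)"
proof -
  have "(LINT t:A|\<L>. f t) = (LINT t:{0<..}|lborel. indicator A t *\<^sub>R f t)"
    unfolding lborel_pos_def set_lebesgue_integral_def
    by (subst integral_restrict_space) auto
  also have "\<dots> = (LINT t:A|lborel. f t)"
    unfolding set_lebesgue_integral_def
    by (rule Bochner_Integration.integral_cong) (use assms in \<open>auto simp: indicator_def\<close>)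
  finally show ?thesis .
qed

lemma Leb_set_integrable:
  fixes f :: "real \<Rightarrow> 'b::{banach,second_countable_topology}"
  assumes "A \<subseteq> {0<..}"
  shows "set_integrable \<L> A f \<longleftrightarrow> set_integrable lborel A f"
proof -
  have "set_integrable \<L> A f \<longleftrightarrow> set_integrable lborel {0<..} (\<lambda>t. indicator A t *\<^sub>R f t)"
    unfolding lborel_pos_def set_integrable_def
    by (subst integrable_restrict_space) auto
  also have "(\<lambda>t. indicator {0<..} t *\<^sub>R indicator A t *\<^sub>R f t) = (\<lambda>t. indicator A t *\<^sub>R f t)"
    using assms by (auto simp: indicator_def fun_eq_iff)
  then have "set_integrable lborel {0<..} (\<lambda>t. indicator A t *\<^sub>R f t) \<longleftrightarrow> set_integrable lborel A f"
    unfolding set_integrable_def by simp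
  finally show ?thesis .
qed

lemma Leb_integral_Ico:
  fixes f :: "real \<Rightarrow> 'b::{banach,second_countable_topology}"
  assumes "0 < a" "f \<in> borel_measurable \<L>"
  shows "(LINT t:{a..<b}|\<L>. f t) = (LINT t:{a<..<b}|\<L>. f t)"
proof -
  have [measurable]: "{a..<b} \<in> sets \<L>" "{a<..<b} \<in> sets \<L>"
    using assms by (auto intro: Leb.Ico_sets Leb.Ioo_sets')
  note [measurable] = assms(2)
  show ?thesis
    unfolding set_lebesgue_integral_def
  proof (rule integral_cong_AE)
    show "AE x in \<L>. indicator {a..<b} x *\<^sub>R f x = indicator {a<..<b} x *\<^sub>R f x"
      using Leb_AE_neq[of a] by eventually_elim (auto simp: indicator_def)
  qed measurable
qed

section \<open>Distribution functions\<close>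

text \<open>The primitive form of \<open>has_loc_density\<close>: bounded variation and left
  continuity are consequences. The interval \<open>{0<..<x}\<close> leaves out \<open>x\<close>, so
  an atom of \<open>M\<close> at \<open>x\<close> makes \<open>u\<close> jump only to the right of
  \<open>x\<close>.\<close>

definition loc_ac :: "real measure \<Rightarrow> (real \<Rightarrow> 'a) \<Rightarrow> (real \<Rightarrow> 'a::{banach,second_countable_topology}) \<Rightarrow> bool" where
  "loc_ac M u g \<longleftrightarrow> (\<forall>c. set_integrable M {0<..<c} g) \<and>
     (\<forall>x\<ge>0. u x = u 0 + (LINT t:{0<..<x}|M. g t))"

lemma loc_ac_integrable: "loc_ac M u g \<Longrightarrow> set_integrable M {0<..<c} g"
  unfolding loc_ac_def by blast

lemma loc_ac_eq: "loc_ac M u g \<Longrightarrow> 0 \<le> x \<Longrightarrow> u x = u 0 + (LINT t:{0<..<x}|M. g t)"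
  unfolding loc_ac_def by blast

context loc_finite
begin

lemma loc_ac_measurable_density: "loc_ac M u g \<Longrightarrow> g \<in> borel_measurable M"
  by (rule measurable_if_loc_integrable) (rule loc_ac_integrable)

lemma loc_ac_diff:
  assumes "loc_ac M u g" "0 < x" "x \<le> y"
  shows "u y - u x = (LINT t:{x..<y}|M. g t)"
  using loc_ac_eq[OF assms(1), of x] loc_ac_eq[OF assms(1), of y] assms
    Ioo_split[OF loc_ac_integrable[OF assms(1)], of x y] by simp

text \<open>The primitive is a parameter integral of a jointly measurable function, and
  \<open>M\<close> is sigma-finite.\<close>

lemma measurable_primitive:
  fixes g :: "real \<Rightarrow> 'b::{banach,second_countable_topology}"
  assumes [measurable]: "g \<in> borel_measurable M"
  shows "(\<lambda>x. LINT t:{0<..<x}|M. g t) \<in> borel_measurable \<L>"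
proof -
  have "(\<lambda>x. LINT t|M. (if t < x then g t else 0)) \<in> borel_measurable \<L>"
    by measurable
  moreover have "(LINT t|M. (if t < x then g t else 0)) = (LINT t:{0<..<x}|M. g t)" for x
    unfolding set_lebesgue_integral_def
    by (rule Bochner_Integration.integral_cong) (auto simp: space_M indicator_def)
  ultimately show ?thesis by simp
qed

lemma loc_ac_measurable:
  assumes "loc_ac M u g"
  shows "u \<in> borel_measurable \<L>"
proof -
  have "(\<lambda>x. u 0 + (LINT t:{0<..<x}|M. g t)) \<in> borel_measurable \<L>"
    using measurable_primitive[OF loc_ac_measurable_density[OF assms]] by simp
  then show ?thesis
    by (rule measurable_cong[THEN iffD1, rotated]) (rule loc_ac_eq[OF assms, symmetric], simp)
qed

lemma loc_ac_bounded:
  assumes "loc_ac M u g" "0 \<le> x" "x \<le> c"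
  shows "norm (u x) \<le> norm (u 0) + (LINT t:{0<..<c}|M. norm (g t))"
proof -
  have i: "set_integrable M {0<..<c} g" by (rule loc_ac_integrable[OF assms(1)])
  have "norm (LINT t:{0<..<x}|M. g t) \<le> (LINT t:{0<..<x}|M. norm (g t))"
    by (rule set_integral_norm_bound) (rule loc_ac_integrable[OF assms(1)])
  also have "\<dots> \<le> (LINT t:{0<..<c}|M. norm (g t))"
    unfolding set_lebesgue_integral_def
  proof (rule integral_mono)
    show "integrable M (\<lambda>t. indicat_real {0<..<x} t *\<^sub>R norm (g t))"
      using set_integrable_norm[OF loc_ac_integrable[OF assms(1), of x]] unfolding set_integrable_def .
    show "integrable M (\<lambda>t. indicat_real {0<..<c} t *\<^sub>R norm (g t))"
      using set_integrable_norm[OF loc_ac_integrable[OF assms(1), of c]] unfolding set_integrable_def .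
  qed (use assms in \<open>auto simp: indicator_def\<close>)
  finally show ?thesis
    using loc_ac_eq[OF assms(1,2)] norm_triangle_ineq[of "u 0" "LINT t:{0<..<x}|M. g t"] by simp
qed

lemma loc_ac_mult_integrable:
  fixes u v :: "real \<Rightarrow> 'b::{real_normed_field,banach,second_countable_topology}"
  assumes "set_integrable M {0<..<c} v" "u \<in> borel_measurable M"
    and b: "\<And>x. 0 < x \<Longrightarrow> x < c \<Longrightarrow> norm (u x) \<le> B"
  shows "set_integrable M {0<..<c} (\<lambda>t. u t * v t)"
  unfolding set_integrable_def
proof (rule Bochner_Integration.integrable_bound)
  show "integrable M (\<lambda>x. B * norm (indicator {0<..<c} x *\<^sub>R v x))"
    using assms(1) unfolding set_integrable_def by (intro integrable_mult_right integrable_norm)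
  have [measurable]: "(\<lambda>x. indicator {0<..<c} x *\<^sub>R v x) \<in> borel_measurable M"
    using assms(1) unfolding set_integrable_def by (rule borel_measurable_integrable)
  note [measurable] = assms(2)
  have "(\<lambda>x. u x * (indicator {0<..<c} x *\<^sub>R v x)) \<in> borel_measurable M" by measurable
  then show "(\<lambda>x. indicator {0<..<c} x *\<^sub>R (u x * v x)) \<in> borel_measurable M" by simp
  show "AE x in M. norm (indicator {0<..<c} x *\<^sub>R (u x * v x)) \<le> norm (B * norm (indicator {0<..<c} x *\<^sub>R v x))"
  proof (rule AE_I2)
    fix x
    show "norm (indicator {0<..<c} x *\<^sub>R (u x * v x)) \<le> norm (B * norm (indicator {0<..<c} x *\<^sub>R v x))"
    proof (cases "0 < x \<and> x < c")
      case True
      then have "norm (u x) * norm (v x) \<le> \<bar>B\<bar> * norm (v x)"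
        using b[of x] by (intro mult_right_mono) auto
      then show ?thesis using True by (simp add: norm_mult abs_mult)
    qed (auto simp: indicator_def)
  qed
qed

end

text \<open>Fubini: the triangle \<open>y < x\<close> is integrated in both orders.\<close>

lemma (in loc_finite) integration_by_parts:
  fixes u :: "real \<Rightarrow> 'b::{real_normed_field,banach,second_countable_topology}"
  assumes u: "loc_ac M u g" and G: "loc_ac \<L> G k" and c: "0 \<le> c"
  shows "u c * G c - u 0 * G 0 =
    (LINT t:{0<..<c}|M. g t * G t) + (LINT t:{0<..<c}|\<L>. u t * k t)"
proof -
  interpret LM: pair_sigma_finite \<L> M ..
  define A where "A = (\<lambda>y. indicator {0<..<c} y *\<^sub>R g y)"
  define B where "B = (\<lambda>x. indicator {0<..<c} x *\<^sub>R k x)"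
  have iA: "integrable M A" and iB: "integrable \<L> B"
    using loc_ac_integrable[OF u, of c] loc_ac_integrable[OF G, of c]
    by (simp_all add: A_def B_def set_integrable_def)
  have [measurable]: "A \<in> borel_measurable M" "B \<in> borel_measurable \<L>"
    using iA iB by auto
  have i0: "integrable (\<L> \<Otimes>\<^sub>M M) (\<lambda>(x, y). B x * A y)"
  proof (rule LM.Fubini_integrable)
    have "(LINT y|M. norm (B x * A y)) = norm (B x) * (LINT y|M. norm (A y))" for x
      by (simp add: norm_mult)
    then show "integrable \<L> (\<lambda>x. LINT y|M. norm (case (x, y) of (x, y) \<Rightarrow> B x * A y))"
      using iB by simp
  qed (use iA in auto)
  define F where "F = (\<lambda>x y. if y < x then B x * A y else 0)"
  have iF: "integrable (\<L> \<Otimes>\<^sub>M M) (case_prod F)"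
  proof (rule Bochner_Integration.integrable_bound[OF i0])
    show "case_prod F \<in> borel_measurable (\<L> \<Otimes>\<^sub>M M)"
      unfolding F_def by measurable
  qed (auto simp: F_def)
  have "(LINT y|M. LINT x|\<L>. F x y) = (LINT x|\<L>. LINT y|M. F x y)"
    by (rule LM.Fubini_integral[OF iF])
  moreover have "(LINT x|\<L>. LINT y|M. F x y) = (LINT x:{0<..<c}|\<L>. (u x - u 0) * k x)"
    unfolding set_lebesgue_integral_def
  proof (rule Bochner_Integration.integral_cong[OF refl])
    fix x
    show "(LINT y|M. F x y) = indicator {0<..<c} x *\<^sub>R ((u x - u 0) * k x)"
    proof (cases "0 < x \<and> x < c")
      case True
      have "(LINT y|M. F x y) = (LINT y|M. k x * (indicator {0<..<x} y *\<^sub>R g y))"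
        by (rule Bochner_Integration.integral_cong)
          (use True in \<open>auto simp: F_def A_def B_def space_M indicator_def\<close>)
      also have "\<dots> = k x * (u x - u 0)"
        using loc_ac_eq[OF u, of x] True by (simp add: set_lebesgue_integral_def del: mult_scaleR_right)
      finally show ?thesis using True by (simp add: mult.commute)
    next
      case False
      then have "F x = (\<lambda>y. 0)" by (auto simp: F_def B_def fun_eq_iff)
      then show ?thesis using False by simp
    qed
  qed
  moreover have "(LINT y|M. LINT x|\<L>. F x y) = (LINT y:{0<..<c}|M. g y * (G c - G y))"
    unfolding set_lebesgue_integral_def
  proof (rule Bochner_Integration.integral_cong[OF refl])
    fix y
    show "(LINT x|\<L>. F x y) = indicator {0<..<c} y *\<^sub>R (g y * (G c - G y))"
    proof (cases "0 < y \<and> y < c")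
      case True
      have "(LINT x|\<L>. F x y) = (LINT x|\<L>. g y * (indicator {y<..<c} x *\<^sub>R k x))"
        by (rule Bochner_Integration.integral_cong)
          (use True in \<open>auto simp: F_def A_def B_def space_M indicator_def\<close>)
      \<comment> \<open>Here Lebesgue measure having no atoms matters: \<open>G\<close> does not
        distinguish \<open>{y..<c}\<close> from \<open>{y<..<c}\<close>, so no correction appears at
        the jumps of \<open>u\<close>.\<close>
      also have "\<dots> = g y * (G c - G y)"
        using Leb.loc_ac_diff[OF G, of y c] Leb_integral_Ico[OF _ Leb.loc_ac_measurable_density[OF G], of y c] True
        by (simp add: set_lebesgue_integral_def del: mult_scaleR_right)
      finally show ?thesis using True by simp
    next
      case False
      then have "(\<lambda>x. F x y) = (\<lambda>y. 0)" by (auto simp: F_def A_def fun_eq_iff)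
      then show ?thesis using False by simp
    qed
  qed
  ultimately have eq: "(LINT y:{0<..<c}|M. g y * (G c - G y)) = (LINT x:{0<..<c}|\<L>. (u x - u 0) * k x)"
    by simp
  have mu: "u \<in> borel_measurable \<L>" by (rule loc_ac_measurable[OF u])
  have mG: "G \<in> borel_measurable M" using Leb.loc_ac_measurable[OF G] by (simp add: measurable_M)
  have ig: "set_integrable M {0<..<c} g" by (rule loc_ac_integrable[OF u])
  have ik: "set_integrable \<L> {0<..<c} k" by (rule loc_ac_integrable[OF G])
  have iuk: "set_integrable \<L> {0<..<c} (\<lambda>t. u t * k t)"
    by (rule Leb.loc_ac_mult_integrable[OF ik mu]) (rule loc_ac_bounded[OF u, of _ c], auto)
  have "set_integrable M {0<..<c} (\<lambda>t. G t * g t)"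
    by (rule loc_ac_mult_integrable[OF ig mG]) (rule Leb.loc_ac_bounded[OF G, of _ c], auto)
  then have igG: "set_integrable M {0<..<c} (\<lambda>t. g t * G t)" by (simp add: mult.commute)
  have "(LINT y:{0<..<c}|M. g y * (G c - G y)) = (u c - u 0) * G c - (LINT t:{0<..<c}|M. g t * G t)"
    using loc_ac_eq[OF u c] igG ig by (simp add: right_diff_distrib set_integral_diff)
  moreover have "(LINT x:{0<..<c}|\<L>. (u x - u 0) * k x) = (LINT t:{0<..<c}|\<L>. u t * k t) - u 0 * (G c - G 0)"
    using loc_ac_eq[OF G c] iuk ik by (simp add: left_diff_distrib set_integral_diff)
  ultimately have "(u c - u 0) * G c - (LINT t:{0<..<c}|M. g t * G t)
      = (LINT t:{0<..<c}|\<L>. u t * k t) - u 0 * (G c - G 0)"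
    using eq by (simp only:)
  then show ?thesis by (simp add: algebra_simps)
qed

section \<open>Variation and left continuity of primitives\<close>

context loc_finite
begin

lemma set_integral_empty [simp]: "(LINT t:{}|M. f t) = 0"
  by (simp add: set_lebesgue_integral_def)

lemma set_integral_Ico0:
  fixes g :: "real \<Rightarrow> 'b::{banach,second_countable_topology}"
  shows "(LINT t:{0..<b}|M. g t) = (LINT t:{0<..<b}|M. g t)"
  unfolding set_lebesgue_integral_def
  by (rule Bochner_Integration.integral_cong) (auto simp: space_M indicator_def)

lemma Ioo_integral_mono:
  fixes f g :: "real \<Rightarrow> real"
  assumes "set_integrable M {0<..<c} f" "set_integrable M {0<..<c} g"
    and "\<And>x. 0 < x \<Longrightarrow> x < c \<Longrightarrow> f x \<le> g x"
  shows "(LINT t:{0<..<c}|M. f t) \<le> (LINT t:{0<..<c}|M. g t)"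
  by (rule set_integral_mono) (use assms in auto)

lemma Ioo_integral_mono_set:
  fixes f :: "real \<Rightarrow> real"
  assumes "set_integrable M {0<..<c} f" "b \<le> c" "\<And>x. 0 < x \<Longrightarrow> x < c \<Longrightarrow> 0 \<le> f x"
  shows "(LINT t:{0<..<b}|M. f t) \<le> (LINT t:{0<..<c}|M. f t)"
  unfolding set_lebesgue_integral_def
proof (rule integral_mono)
  show "integrable M (\<lambda>x. indicat_real {0<..<b} x *\<^sub>R f x)"
    using set_integrable_Ioo_subset[OF assms(1) Ioo_sets, of b] assms(2)
    unfolding set_integrable_def by (simp add: subset_eq)
  show "integrable M (\<lambda>x. indicat_real {0<..<c} x *\<^sub>R f x)"
    using assms(1) unfolding set_integrable_def .
qed (use assms in \<open>auto simp: indicator_def\<close>)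

lemma loc_ac_norm_diff:
  assumes u: "loc_ac M u g" and "0 \<le> x" "x \<le> y"
  shows "norm (u y - u x) \<le> (LINT t:{0<..<y}|M. norm (g t)) - (LINT t:{0<..<x}|M. norm (g t))"
proof (cases "x = 0")
  case True
  then show ?thesis
    using loc_ac_eq[OF u, of y] set_integral_norm_bound[OF loc_ac_integrable[OF u], of y] assms by simp
next
  case False
  then have "0 < x" using assms by simp
  have i: "set_integrable M {0<..<y} (\<lambda>t. norm (g t))"
    by (rule set_integrable_norm[OF loc_ac_integrable[OF u]])
  have "set_integrable M {x..<y} g"
    using \<open>0 < x\<close> by (intro set_integrable_Ioo_subset[OF loc_ac_integrable[OF u, of y]] Ico_sets) auto
  then have "norm (u y - u x) \<le> (LINT t:{x..<y}|M. norm (g t))"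
    unfolding loc_ac_diff[OF u \<open>0 < x\<close> \<open>x \<le> y\<close>] by (rule set_integral_norm_bound)
  then show ?thesis
    using Ioo_split[OF i \<open>0 < x\<close> \<open>x \<le> y\<close>] by simp
qed

lemma loc_ac_left_limit:
  assumes u: "loc_ac M u g" and "0 < x"
  shows "(u \<longlongrightarrow> u x) (at_left x)"
proof (rule tendsto_at_left_sequentially[OF \<open>0 < x\<close>])
  fix S :: "nat \<Rightarrow> real"
  assume S: "\<And>n. S n < x" "\<And>n. 0 < S n" "S \<longlonglongrightarrow> x"
  have "(\<lambda>n. LINT t:{0<..<S n}|M. g t) \<longlonglongrightarrow> (LINT t:{0<..<x}|M. g t)"
    unfolding set_lebesgue_integral_def
  proof (rule integral_dominated_convergence[where w="\<lambda>t. norm (indicat_real {0<..<x} t *\<^sub>R g t)"])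
    show "(\<lambda>t. indicat_real {0<..<x} t *\<^sub>R g t) \<in> borel_measurable M"
      "(\<lambda>t. indicat_real {0<..<S n} t *\<^sub>R g t) \<in> borel_measurable M" for n
      using loc_ac_measurable_density[OF u] by simp_all
    show "integrable M (\<lambda>t. norm (indicat_real {0<..<x} t *\<^sub>R g t))"
      using loc_ac_integrable[OF u, of x] unfolding set_integrable_def by (rule integrable_norm)
    show "AE t in M. (\<lambda>n. indicat_real {0<..<S n} t *\<^sub>R g t) \<longlonglongrightarrow> indicat_real {0<..<x} t *\<^sub>R g t"
    proof (rule AE_I2, rule tendsto_eventually)
      fix t
      show "\<forall>\<^sub>F n in sequentially. indicat_real {0<..<S n} t *\<^sub>R g t = indicat_real {0<..<x} t *\<^sub>R g t"
      proof (cases "t < x")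
        case True
        show ?thesis
          using order_tendstoD(1)[OF S(3) True] by eventually_elim (use True in \<open>auto simp: indicator_def\<close>)
      next
        case False
        then have "\<not> t < S n" for n using S(1)[of n] by simp
        then show ?thesis using False by (simp add: indicator_def)
      qed
    qed
    show "AE t in M. norm (indicat_real {0<..<S n} t *\<^sub>R g t) \<le> norm (indicat_real {0<..<x} t *\<^sub>R g t)" for n
      using less_trans[OF _ S(1)[of n]] by (intro AE_I2) (auto simp: indicator_def)
  qed
  then have "(\<lambda>n. u 0 + (LINT t:{0<..<S n}|M. g t)) \<longlonglongrightarrow> u 0 + (LINT t:{0<..<x}|M. g t)"
    by (intro tendsto_intros)
  moreover have "u 0 + (LINT t:{0<..<S n}|M. g t) = u (S n)" for n
    using loc_ac_eq[OF u, of "S n"] S(2)[of n] by simp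
  ultimately show "(\<lambda>n. u (S n)) \<longlonglongrightarrow> u x"
    using loc_ac_eq[OF u, of x] \<open>0 < x\<close> by simp
qed

text \<open>The primitive \<open>V\<close> of \<open>norm (g t)\<close> is increasing and dominates
  the increments of \<open>u\<close>; its own increments telescope.\<close>

lemma locally_bv_if_loc_ac:
  assumes u: "loc_ac M u g"
  shows "locally_bv u"
  unfolding locally_bv_def
proof (intro allI impI)
  fix c :: real assume "0 < c"
  define V where "V x = (LINT t:{0<..<x}|M. norm (g t))" for x
  show "\<exists>V. \<forall>n x. mono_on {..n} x \<longrightarrow> x ` {..n} \<subseteq> {0..c} \<longrightarrow>
      (\<Sum>i<n. norm (u (x (Suc i)) - u (x i))) \<le> V"
  proof (intro exI[of _ "V c"] allI impI)
    fix n and x :: "nat \<Rightarrow> real"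
    assume m: "mono_on {..n} x" and r: "x ` {..n} \<subseteq> {0..c}"
    have "(\<Sum>i<n. norm (u (x (Suc i)) - u (x i))) \<le> (\<Sum>i<n. V (x (Suc i)) - V (x i))"
      unfolding V_def
    proof (intro sum_mono loc_ac_norm_diff[OF u])
      fix i assume "i \<in> {..<n}"
      then show "0 \<le> x i" "x i \<le> x (Suc i)"
        using r mono_onD[OF m, of i "Suc i"] by (auto simp: image_subset_iff)
    qed
    also have "\<dots> = V (x n) - V (x 0)"
      by (rule sum_lessThan_telescope)
    also have "0 \<le> V (x 0)"
      unfolding V_def set_lebesgue_integral_def by (rule integral_nonneg_AE) simp
    then have "V (x n) - V (x 0) \<le> V (x n)" by simp
    also have "V (x n) \<le> V c"
      unfolding V_def
      using r by (intro Ioo_integral_mono_set set_integrable_norm[OF loc_ac_integrable[OF u]]) auto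
    finally show "(\<Sum>i<n. norm (u (x (Suc i)) - u (x i))) \<le> V c" .
  qed
qed

text \<open>Reduces the operator's definition to integrals from \<open>0\<close>. The interval
  \<open>{0..<b}\<close> may be replaced by \<open>{0<..<b}\<close> because \<open>0\<close> is
  outside the space of \<open>M\<close>.\<close>

lemma has_loc_density_iff: "has_loc_density M u g \<longleftrightarrow> loc_ac M u g"
proof
  assume d: "has_loc_density M u g"
  show "loc_ac M u g"
    unfolding loc_ac_def
  proof (intro conjI allI impI)
    show "set_integrable M {0<..<c} g" for c
      using d unfolding has_loc_density_def by (cases "c > 0") auto
    fix x :: real assume "0 \<le> x"
    then have "u x - u 0 = (LINT t:{0..<x}|M. g t)"
      using d unfolding has_loc_density_def by blast
    then show "u x = u 0 + (LINT t:{0<..<x}|M. g t)"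
      unfolding set_integral_Ico0 by (simp add: algebra_simps)
  qed
next
  assume u: "loc_ac M u g"
  have "u b - u a = (LINT x:{a..<b}|M. g x)" if "0 \<le> a" "a \<le> b" for a b
  proof (cases "a = 0")
    case True
    then show ?thesis using loc_ac_eq[OF u, of b] that by (simp add: set_integral_Ico0)
  qed (use loc_ac_diff[OF u, of a b] that in simp)
  then show "has_loc_density M u g"
    unfolding has_loc_density_def
    using locally_bv_if_loc_ac[OF u] loc_ac_left_limit[OF u] loc_ac_integrable[OF u]
    by (auto simp: continuous_within)
qed

end

section \<open>Algebra of primitives, and Gronwall's inequality\<close>

lemma loc_ac_add:
  assumes "loc_ac M u g" "loc_ac M v h"
  shows "loc_ac M (\<lambda>x. u x + v x) (\<lambda>x. g x + h x)"
  unfolding loc_ac_def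
proof (intro conjI allI impI)
  note i = loc_ac_integrable[OF assms(1)] loc_ac_integrable[OF assms(2)]
  show "set_integrable M {0<..<c} (\<lambda>x. g x + h x)" for c
    by (rule set_integral_add(1)[OF i])
  fix x :: real assume "0 \<le> x"
  then show "u x + v x = u 0 + v 0 + (LINT t:{0<..<x}|M. g t + h t)"
    using loc_ac_eq[OF assms(1), of x] loc_ac_eq[OF assms(2), of x] set_integral_add(2)[OF i] by simp
qed

lemma loc_ac_cmult:
  fixes u :: "real \<Rightarrow> 'b::{real_normed_field,banach,second_countable_topology}"
  assumes "loc_ac M u g"
  shows "loc_ac M (\<lambda>x. a * u x) (\<lambda>x. a * g x)"
  unfolding loc_ac_def
proof (intro conjI allI impI)
  show "set_integrable M {0<..<c} (\<lambda>x. a * g x)" for c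
    using loc_ac_integrable[OF assms] by simp
  fix x :: real assume "0 \<le> x"
  have "a * u x = a * (u 0 + (LINT t:{0<..<x}|M. g t))"
    by (rule arg_cong[OF loc_ac_eq[OF assms \<open>0 \<le> x\<close>]])
  then show "a * u x = a * u 0 + (LINT t:{0<..<x}|M. a * g t)"
    by (simp add: distrib_left)
qed

lemma loc_ac_const: "loc_ac M (\<lambda>x. a) (\<lambda>x. 0)"
  by (simp add: loc_ac_def set_integrable_def)

text \<open>Integration by parts with a variable right endpoint.\<close>

lemma loc_ac_mult:
  fixes u G :: "real \<Rightarrow> 'b::{real_normed_field,banach,second_countable_topology}"
  assumes u: "loc_ac \<L> u g" and G: "loc_ac \<L> G k"
  shows "loc_ac \<L> (\<lambda>x. u x * G x) (\<lambda>x. g x * G x + u x * k x)"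
  unfolding loc_ac_def
proof (intro conjI allI impI)
  have "set_integrable \<L> {0<..<c} (\<lambda>t. G t * g t)" for c
    by (rule Leb.loc_ac_mult_integrable[OF loc_ac_integrable[OF u] Leb.loc_ac_measurable[OF G]])
      (rule Leb.loc_ac_bounded[OF G, of _ c], auto)
  then have 1: "set_integrable \<L> {0<..<c} (\<lambda>t. g t * G t)" for c
    by (simp add: mult.commute)
  have 2: "set_integrable \<L> {0<..<c} (\<lambda>t. u t * k t)" for c
    by (rule Leb.loc_ac_mult_integrable[OF loc_ac_integrable[OF G] Leb.loc_ac_measurable[OF u]])
      (rule Leb.loc_ac_bounded[OF u, of _ c], auto)
  show "set_integrable \<L> {0<..<c} (\<lambda>x. g x * G x + u x * k x)" for c
    by (rule set_integral_add(1)[OF 1 2])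
  fix x :: real assume "0 \<le> x"
  then show "u x * G x = u 0 * G 0 + (LINT t:{0<..<x}|\<L>. g t * G t + u t * k t)"
    unfolding set_integral_add(2)[OF 1 2]
    using Leb.integration_by_parts[OF u G, of x] by (simp add: algebra_simps)
qed

text \<open>Integration against \<open>r\<close> turns \<open>R^n / n!\<close> into
  \<open>R^(n+1) / (n+1)!\<close>. This drives both Gronwall's inequality and the Picard iteration,
  so that a chain rule for \<open>exp\<close> is avoided.\<close>

lemma loc_ac_power:
  fixes R :: "real \<Rightarrow> real"
  assumes "loc_ac \<L> R r"
  shows "loc_ac \<L> (\<lambda>x. R x ^ Suc n / fact (Suc n)) (\<lambda>x. R x ^ n / fact n * r x)"
proof -
  have *: "loc_ac \<L> (\<lambda>x. R x ^ Suc n) (\<lambda>x. real (Suc n) * (R x ^ n * r x))" for n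
  proof (induction n)
    case 0
    show ?case using assms by simp
  next
    case (Suc n)
    have "(\<lambda>x. real (Suc n) * (R x ^ n * r x) * R x + R x ^ Suc n * r x) =
        (\<lambda>x. real (Suc (Suc n)) * (R x ^ Suc n * r x))"
      by (rule ext) (simp add: algebra_simps)
    then show ?case
      using loc_ac_mult[OF Suc assms] by (simp add: mult.commute)
  qed
  have "(\<lambda>x. 1 / fact (Suc n) * (real (Suc n) * (R x ^ n * r x))) = (\<lambda>x. R x ^ n / fact n * r x)"
    by (rule ext) (simp add: fact_Suc del: of_nat_Suc)
  then show ?thesis
    using loc_ac_cmult[OF *[of n], of "1 / fact (Suc n)"] by simp
qed

lemma loc_ac_exp_partial:
  fixes R :: "real \<Rightarrow> real"
  assumes "loc_ac \<L> R r"
  shows "loc_ac \<L> (\<lambda>x. \<Sum>j<Suc n. R x ^ j / fact j) (\<lambda>x. (\<Sum>j<n. R x ^ j / fact j) * r x)"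
proof (induction n)
  case 0
  show ?case by (simp add: loc_ac_const)
next
  case (Suc n)
  have "loc_ac \<L> (\<lambda>x. (\<Sum>j<Suc n. R x ^ j / fact j) + R x ^ Suc n / fact (Suc n))
     (\<lambda>x. (\<Sum>j<n. R x ^ j / fact j) * r x + R x ^ n / fact n * r x)"
    by (rule loc_ac_add[OF Suc loc_ac_power[OF assms]])
  then show ?case by (simp add: distrib_right)
qed

lemma loc_ac_nonneg:
  fixes R :: "real \<Rightarrow> real"
  assumes "loc_ac \<L> R r" "R 0 = 0" "\<And>x. 0 \<le> r x" "0 \<le> x"
  shows "0 \<le> R x"
  using loc_ac_eq[OF assms(1,4)] assms(2,3)
  by (simp add: set_lebesgue_integral_def integral_nonneg_AE)

text \<open>The induction step shared by Gronwall and Picard: a majorant \<open>p\<close> of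
  \<open>m\<close> is integrated once against \<open>r\<close> and yields the next majorant
  \<open>p'\<close>.\<close>

lemma volterra_step:
  fixes p r :: "real \<Rightarrow> real"
  assumes p: "loc_ac \<L> p' (\<lambda>x. p x * r x)" "p' 0 = a"
    and r: "\<And>x. 0 \<le> r x" "set_integrable \<L> {0<..<c} r"
    and m: "m \<in> borel_measurable \<L>" "\<And>x. 0 < x \<Longrightarrow> x < c \<Longrightarrow> norm (m x) \<le> B"
    and le: "\<And>x. 0 < x \<Longrightarrow> x < c \<Longrightarrow> m x \<le> p x" and x: "0 \<le> x" "x \<le> c"
  shows "a + (LINT t:{0<..<x}|\<L>. m t * r t) \<le> p' x"
proof -
  have "set_integrable \<L> {0<..<x} r"
    by (rule Leb.set_integrable_Ioo_subset[OF r(2)]) (use x in auto)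
  then have "set_integrable \<L> {0<..<x} (\<lambda>t. m t * r t)"
    by (rule Leb.loc_ac_mult_integrable[OF _ m(1), where B=B]) (use m(2) x in auto)
  then have "(LINT t:{0<..<x}|\<L>. m t * r t) \<le> (LINT t:{0<..<x}|\<L>. p t * r t)"
    using loc_ac_integrable[OF p(1)] le r(1) x
    by (intro Leb.Ioo_integral_mono mult_right_mono) auto
  then show ?thesis using loc_ac_eq[OF p(1) x(1)] p(2) by simp
qed

text \<open>Inserting the inequality into itself \<open>n\<close> times produces the Taylor
  polynomial \<open>S n\<close> of \<open>exp R\<close> and a remainder \<open>B * R^n / n!\<close>,
  which vanishes as \<open>n\<close> grows because \<open>m\<close> is bounded on
  \<open>[0,c]\<close>.\<close>

lemma gronwall:
  fixes R :: "real \<Rightarrow> real"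
  assumes R: "loc_ac \<L> R r" "R 0 = 0" and r: "\<And>x. 0 \<le> r x"
    and m: "m \<in> borel_measurable \<L>" "\<And>x. 0 \<le> x \<Longrightarrow> x \<le> c \<Longrightarrow> norm (m x) \<le> B"
    and a: "0 \<le> a"
    and le: "\<And>x. 0 \<le> x \<Longrightarrow> x \<le> c \<Longrightarrow> m x \<le> a + (LINT t:{0<..<x}|\<L>. m t * r t)"
    and x: "0 \<le> x" "x \<le> c"
  shows "m x \<le> a * exp (R x)"
proof -
  define S where "S n x = (\<Sum>j<n. R x ^ j / fact j)" for n x
  have bound: "m x \<le> a * S n x + B * (R x ^ n / fact n)" if "0 \<le> x" "x \<le> c" for n x
    using that
  proof (induction n arbitrary: x)
    case 0
    then show ?case using m(2)[of x] by (simp add: S_def)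
  next
    case (Suc n)
    have ac: "loc_ac \<L> (\<lambda>x. a * S (Suc n) x + B * (R x ^ Suc n / fact (Suc n)))
        (\<lambda>x. a * (S n x * r x) + B * (R x ^ n / fact n * r x))"
      unfolding S_def by (intro loc_ac_add loc_ac_cmult loc_ac_exp_partial loc_ac_power R(1))
    have "(\<lambda>x. a * (S n x * r x) + B * (R x ^ n / fact n * r x))
        = (\<lambda>x. (a * S n x + B * (R x ^ n / fact n)) * r x)"
      by (rule ext) (simp add: algebra_simps)
    note ac = ac[unfolded this]
    have "S (Suc n) 0 = 1"
      unfolding S_def R(2) by (subst sum.lessThan_Suc_shift) simp
    then have "a + (LINT t:{0<..<x}|\<L>. m t * r t) \<le> a * S (Suc n) x + B * (R x ^ Suc n / fact (Suc n))"
      using R(2) m(2) Suc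
      by (intro volterra_step[OF ac _ r loc_ac_integrable[OF R(1)] m(1), where B=B]) auto
    then show ?case using le[OF Suc.prems] by simp
  qed
  have "(\<lambda>n. R x ^ n / fact n) sums exp (R x)"
    using exp_converges[of "R x"] by (simp add: divide_inverse mult.commute)
  then have "(\<lambda>n. S n x) \<longlonglongrightarrow> exp (R x)" "(\<lambda>n. R x ^ n / fact n) \<longlonglongrightarrow> 0"
    unfolding S_def sums_def by (auto dest: summable_LIMSEQ_zero sums_summable simp: sums_def[symmetric])
  then have "(\<lambda>n. a * S n x + B * (R x ^ n / fact n)) \<longlonglongrightarrow> a * exp (R x) + B * 0"
    by (intro tendsto_intros)
  then show ?thesis
    using bound[OF x] by (intro LIMSEQ_le_const[where X="\<lambda>n. a * S n x + B * (R x ^ n / fact n)"]) auto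
qed

section \<open>The initial value problem\<close>

locale sturm_liouville =
  fixes \<nu> :: "real measure" and q :: "real \<Rightarrow> real"
  assumes sets_nu: "sets \<nu> = sets \<L>"
    and finite_nu: "\<And>c. emeasure \<nu> {0<..<c} < \<infinity>"
    and q_loc: "\<And>c. set_integrable \<L> {0<..<c} q"
begin

abbreviation P :: "real measure" where "P \<equiv> sum_measure \<L> \<nu>"

lemma emeasure_P: "A \<in> sets \<L> \<Longrightarrow> emeasure P A = emeasure \<L> A + emeasure \<nu> A"
  by (rule emeasure_sum_measure) (simp_all add: sets_nu)

sublocale P: loc_finite P
proof
  show "emeasure P {0<..<c} < \<infinity>" for c
    using Leb.finite_M[of c] finite_nu[of c] by (simp add: emeasure_P)
qed simp

lemma measurable_P: "borel_measurable P = borel_measurable \<L>"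
  by (rule P.measurable_M)

definition Pm :: "real \<Rightarrow> real" where "Pm c = measure P {0<..<c}"

lemma Pm_nonneg: "0 \<le> Pm c" by (simp add: Pm_def)

lemma P_const: "(LINT t:{0<..<c}|P. a) = Pm c * (a::real)"
  using P.emeasure_Ioo[of c] unfolding Pm_def
  by (subst set_integral_const) auto

text \<open>Says that \<open>u\<close>, with quasi-derivative \<open>g\<close>, solves
  \<open>(\<tau> - z) u = k\<close> under the Neumann condition at \<open>0\<close>. The value
  \<open>u 0\<close> is free and nothing is required at infinity, so \<open>u\<close> need not be
  square integrable.\<close>

definition sol :: "complex \<Rightarrow> (real \<Rightarrow> complex) \<Rightarrow> (real \<Rightarrow> complex) \<Rightarrow> (real \<Rightarrow> complex) \<Rightarrow> bool" where
  "sol z k u g \<longleftrightarrow> loc_ac P u g \<and> loc_ac \<L> g (\<lambda>x. (of_real (q x) - z) * u x - k x) \<and> g 0 = 0"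

lemma coef_loc: "set_integrable \<L> {0<..<c} (\<lambda>x. of_real (q x) - (z::complex))"
proof -
  have "set_integrable \<L> {0<..<c} (\<lambda>x. complex_of_real (q x))"
    using integrable_of_real[OF q_loc[of c, unfolded set_integrable_def], where 'a=complex]
    unfolding set_integrable_def by (simp add: scaleR_conv_of_real)
  then show ?thesis
    by (intro set_integral_diff(1) Leb.integrable_const_Ioo)
qed

lemma q_measurable: "q \<in> borel_measurable \<L>"
  by (rule Leb.measurable_if_loc_integrable[OF q_loc])

lemma coef_mult_loc:
  fixes u :: "real \<Rightarrow> complex"
  assumes "u \<in> borel_measurable \<L>" "\<And>x. 0 < x \<Longrightarrow> x < c \<Longrightarrow> norm (u x) \<le> B"
  shows "set_integrable \<L> {0<..<c} (\<lambda>x. (of_real (q x) - z) * u x)"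
  using Leb.loc_ac_mult_integrable[OF coef_loc assms(1), of c B] assms(2) by (simp add: mult.commute)

text \<open>Collapses the two nested integrations, first in \<open>\<L>\<close> and then in
  \<open>P\<close>, to one. The inner integral is increasing, hence at most its value at
  \<open>x\<close>, and the outer one contributes the factor \<open>Pm c\<close>. What remains is a
  Volterra inequality for Lebesgue measure alone, so atoms of \<open>\<nu>\<close> never enter
  Gronwall's inequality.\<close>

lemma volterra_bound:
  assumes v: "loc_ac P v h" and h: "\<And>s. 0 < s \<Longrightarrow> s < c \<Longrightarrow> norm (h s) \<le> b + (LINT t:{0<..<s}|\<L>. \<rho> t)"
    and rho: "set_integrable \<L> {0<..<c} \<rho>" "\<And>t. 0 < t \<Longrightarrow> t < c \<Longrightarrow> 0 \<le> \<rho> t" and b: "0 \<le> b"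
    and x: "0 \<le> x" "x \<le> c"
  shows "norm (v x) \<le> norm (v 0) + Pm c * b + (LINT t:{0<..<x}|\<L>. Pm c * \<rho> t)"
proof -
  have rx: "set_integrable \<L> {0<..<x} \<rho>"
    by (rule Leb.set_integrable_Ioo_subset[OF rho(1)]) (use x in auto)
  define I where "I = b + (LINT t:{0<..<x}|\<L>. \<rho> t)"
  have "0 \<le> (LINT t:{0<..<x}|\<L>. \<rho> t)"
    using Leb.Ioo_integral_mono_set[OF rx, of 0] rho(2) x by simp
  then have I0: "0 \<le> I" using b by (simp add: I_def)
  have "norm (LINT t:{0<..<x}|P. h t) \<le> (LINT t:{0<..<x}|P. norm (h t))"
    by (rule set_integral_norm_bound[OF loc_ac_integrable[OF v]])
  also have "\<dots> \<le> (LINT t:{0<..<x}|P. I)"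
  proof (rule P.Ioo_integral_mono)
    show "set_integrable P {0<..<x} (\<lambda>t. norm (h t))"
      by (rule set_integrable_norm[OF loc_ac_integrable[OF v]])
    fix s assume s: "0 < s" "s < x"
    have "(LINT t:{0<..<s}|\<L>. \<rho> t) \<le> (LINT t:{0<..<x}|\<L>. \<rho> t)"
      by (rule Leb.Ioo_integral_mono_set[OF rx]) (use s rho(2) x in auto)
    then show "norm (h s) \<le> I" using h[of s] s x by (simp add: I_def)
  qed (rule P.integrable_const_Ioo)
  also have "\<dots> = Pm x * I" by (rule P_const)
  also have "\<dots> \<le> Pm c * I"
  proof (rule mult_right_mono[OF _ I0])
    show "Pm x \<le> Pm c"
      unfolding Pm_def using x P.emeasure_Ioo[of c]
      by (intro measure_mono_fmeasurable fmeasurableI) (auto simp: less_top)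
  qed
  also have "\<dots> = Pm c * b + (LINT t:{0<..<x}|\<L>. Pm c * \<rho> t)"
    by (simp add: I_def distrib_left)
  finally show ?thesis
    using loc_ac_eq[OF v x(1)] norm_triangle_ineq[of "v 0" "LINT t:{0<..<x}|P. h t"] by simp
qed

text \<open>The Lebesgue kernel left over when the integration in \<open>P\<close> is absorbed in
  \<open>Pm c\<close>; \<open>Z\<close> stands for a bound on \<open>norm z\<close>.\<close>

definition rate :: "real \<Rightarrow> real \<Rightarrow> real \<Rightarrow> real" where
  "rate c Z t = Pm c * (\<bar>q t\<bar> + Z)"

lemma rate_nonneg: "0 \<le> Z \<Longrightarrow> 0 \<le> rate c Z t"
  by (simp add: rate_def Pm_nonneg)

lemma loc_ac_rate: "loc_ac \<L> (\<lambda>x. LINT t:{0<..<x}|\<L>. rate c Z t) (rate c Z)"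
proof -
  have "set_integrable \<L> {0<..<x} (rate c Z)" for x
    unfolding rate_def
    by (intro set_integrable_mult_right set_integral_add(1) set_integrable_abs q_loc Leb.integrable_const_Ioo)
  then show ?thesis by (simp add: loc_ac_def)
qed

lemma norm_coef_le: "norm (of_real (q t) - (z::complex)) \<le> \<bar>q t\<bar> + norm z"
  using norm_triangle_ineq4[of "of_real (q t)" z] by simp

lemma sol_loc_ac: "sol z k u g \<Longrightarrow> loc_ac P u g" and sol_loc_ac': "sol z k u g \<Longrightarrow> loc_ac \<L> g (\<lambda>x. (of_real (q x) - z) * u x - k x)"
  and sol_0: "sol z k u g \<Longrightarrow> g 0 = 0"
  by (simp_all add: sol_def)

lemma sol_measurable: "sol z k u g \<Longrightarrow> u \<in> borel_measurable \<L>"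
  by (rule P.loc_ac_measurable) (rule sol_loc_ac)

lemma sol_g_measurable: "sol z k u g \<Longrightarrow> g \<in> borel_measurable \<L>"
  by (rule Leb.loc_ac_measurable) (rule sol_loc_ac')

lemma sol_loc_bounded: "sol z k u g \<Longrightarrow> \<exists>B. \<forall>x. 0 \<le> x \<longrightarrow> x \<le> c \<longrightarrow> norm (u x) \<le> B"
  using P.loc_ac_bounded[OF sol_loc_ac] by blast

lemma sol_g_loc_bounded: "sol z k u g \<Longrightarrow> \<exists>B. \<forall>x. 0 \<le> x \<longrightarrow> x \<le> c \<longrightarrow> norm (g x) \<le> B"
  using Leb.loc_ac_bounded[OF sol_loc_ac'] by blast

lemma sol_coef_loc:
  assumes "sol z k u g"
  shows "set_integrable \<L> {0<..<c} (\<lambda>x. (of_real (q x) - w) * u x)"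
proof -
  obtain B where "\<forall>x. 0 \<le> x \<longrightarrow> x \<le> c \<longrightarrow> norm (u x) \<le> B"
    using sol_loc_bounded[OF assms] by blast
  then show ?thesis
    by (intro coef_mult_loc[OF sol_measurable[OF assms], of c B]) auto
qed

lemma sol_k_loc:
  assumes "sol z k u g"
  shows "set_integrable \<L> {0<..<c} k"
proof -
  have "set_integrable \<L> {0<..<c} (\<lambda>x. (of_real (q x) - z) * u x - ((of_real (q x) - z) * u x - k x))"
    by (rule set_integral_diff(1)[OF sol_coef_loc[OF assms] loc_ac_integrable[OF sol_loc_ac'[OF assms]]])
  then show ?thesis by simp
qed

lemma sol_lincomb:
  assumes "sol z k u g" "sol z l v h"
  shows "sol z (\<lambda>x. k x + a * l x) (\<lambda>x. u x + a * v x) (\<lambda>x. g x + a * h x)"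
proof -
  have "loc_ac \<L> (\<lambda>x. g x + a * h x)
     (\<lambda>x. (of_real (q x) - z) * u x - k x + a * ((of_real (q x) - z) * v x - l x))"
    by (intro loc_ac_add loc_ac_cmult sol_loc_ac'[OF assms(1)] sol_loc_ac'[OF assms(2)])
  moreover have "(\<lambda>x. (of_real (q x) - z) * u x - k x + a * ((of_real (q x) - z) * v x - l x)) =
     (\<lambda>x. (of_real (q x) - z) * (u x + a * v x) - (k x + a * l x))"
    by (rule ext) (simp add: algebra_simps)
  ultimately show ?thesis
    unfolding sol_def using sol_0[OF assms(1)] sol_0[OF assms(2)]
    by (simp add: loc_ac_add loc_ac_cmult sol_loc_ac[OF assms(1)] sol_loc_ac[OF assms(2)])
qed

text \<open>Moves the difference of spectral parameters to the right-hand side, so that estimates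
  available only at \<open>lam\<close> can be used for every \<open>z\<close>.\<close>

lemma sol_shift: "sol z k u g \<longleftrightarrow> sol w (\<lambda>x. k x + (z - w) * u x) u g"
proof -
  have "(\<lambda>x. (of_real (q x) - z) * u x - k x) = (\<lambda>x. (of_real (q x) - w) * u x - (k x + (z - w) * u x))"
    by (rule ext) (simp add: algebra_simps)
  then show ?thesis by (simp add: sol_def)
qed

text \<open>The equation controls \<open>g\<close> by the mass of \<open>k\<close> plus an integral
  of \<open>u\<close>; \<open>volterra_bound\<close> makes this a scalar inequality for
  \<open>norm (u x)\<close>, to which \<open>gronwall\<close> applies.\<close>

lemma sol_bound:
  assumes u: "sol z k u g" and z: "norm z \<le> Z" and x: "0 \<le> x" "x \<le> c"
  shows "norm (u x) \<le> (norm (u 0) + Pm c * (LINT t:{0<..<c}|\<L>. norm (k t))) *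
    exp (LINT t:{0<..<c}|\<L>. rate c Z t)"
proof -
  define K where "K = (LINT t:{0<..<c}|\<L>. norm (k t))"
  obtain B where B: "\<And>x. 0 \<le> x \<Longrightarrow> x \<le> c \<Longrightarrow> norm (u x) \<le> B"
    using sol_loc_bounded[OF u] by blast
  have Z: "0 \<le> Z" using z norm_ge_zero[of z] by linarith
  have ik: "set_integrable \<L> {0<..<s} (\<lambda>t. norm (k t))" for s
    by (rule set_integrable_norm[OF sol_k_loc[OF u]])
  have K0: "0 \<le> K" unfolding K_def
    by (simp add: set_lebesgue_integral_def)
  have iqu: "set_integrable \<L> {0<..<s} (\<lambda>t. norm ((of_real (q t) - z) * u t))" for s
    by (rule set_integrable_norm[OF sol_coef_loc[OF u]])
  have gb: "norm (g s) \<le> K + (LINT t:{0<..<s}|\<L>. norm ((of_real (q t) - z) * u t))" if "0 < s" "s < c" for s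
  proof -
    have "norm (g s) \<le> (LINT t:{0<..<s}|\<L>. norm ((of_real (q t) - z) * u t - k t))"
      using loc_ac_eq[OF sol_loc_ac'[OF u], of s] sol_0[OF u] that
        set_integral_norm_bound[OF loc_ac_integrable[OF sol_loc_ac'[OF u]], of s] by simp
    also have "\<dots> \<le> (LINT t:{0<..<s}|\<L>. norm (k t) + norm ((of_real (q t) - z) * u t))"
      by (intro Leb.Ioo_integral_mono set_integral_add(1) ik iqu
          set_integrable_norm[OF loc_ac_integrable[OF sol_loc_ac'[OF u]]])
        (metis add.commute norm_triangle_ineq4)
    also have "\<dots> = (LINT t:{0<..<s}|\<L>. norm (k t)) + (LINT t:{0<..<s}|\<L>. norm ((of_real (q t) - z) * u t))"
      by (rule set_integral_add(2)[OF ik iqu])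
    also have "(LINT t:{0<..<s}|\<L>. norm (k t)) \<le> K"
      unfolding K_def by (rule Leb.Ioo_integral_mono_set[OF ik]) (use that in auto)
    finally show ?thesis by simp
  qed
  have Vb: "norm (u x) \<le> (norm (u 0) + Pm c * K) + (LINT t:{0<..<x}|\<L>. norm (u t) * rate c Z t)"
    if x: "0 \<le> x" "x \<le> c" for x
  proof -
    have "norm (u x) \<le> norm (u 0) + Pm c * K + (LINT t:{0<..<x}|\<L>. Pm c * norm ((of_real (q t) - z) * u t))"
      by (rule volterra_bound[OF sol_loc_ac[OF u] gb iqu _ K0 x]) auto
    also have "(LINT t:{0<..<x}|\<L>. Pm c * norm ((of_real (q t) - z) * u t))
      \<le> (LINT t:{0<..<x}|\<L>. norm (u t) * rate c Z t)"
    proof (rule Leb.Ioo_integral_mono)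
      show "set_integrable \<L> {0<..<x} (\<lambda>t. Pm c * norm ((of_real (q t) - z) * u t))"
        by (rule set_integrable_mult_right) (rule iqu)
      show "set_integrable \<L> {0<..<x} (\<lambda>t. norm (u t) * rate c Z t)"
        by (rule Leb.loc_ac_mult_integrable[OF loc_ac_integrable[OF loc_ac_rate], where B=B])
          (use sol_measurable[OF u] B x in auto)
      show "Pm c * norm ((of_real (q t) - z) * u t) \<le> norm (u t) * rate c Z t" for t
        using mult_left_mono[OF order_trans[OF norm_coef_le[of t z] add_left_mono[OF z]], of "Pm c * norm (u t)"]
        by (simp add: rate_def norm_mult Pm_nonneg mult_ac)
    qed
    finally show ?thesis by simp
  qed
  have "norm (u x) \<le> (norm (u 0) + Pm c * K) * exp (LINT t:{0<..<x}|\<L>. rate c Z t)"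
    by (rule gronwall[OF loc_ac_rate _ rate_nonneg[OF Z], where m="\<lambda>x. norm (u x)" and c=c and B=B])
      (use sol_measurable[OF u] B K0 Pm_nonneg[of c] Vb x in auto)
  also have "\<dots> \<le> (norm (u 0) + Pm c * K) * exp (LINT t:{0<..<c}|\<L>. rate c Z t)"
  proof (rule mult_left_mono)
    show "exp (LINT t:{0<..<x}|\<L>. rate c Z t) \<le> exp (LINT t:{0<..<c}|\<L>. rate c Z t)"
      using Leb.Ioo_integral_mono_set[OF loc_ac_integrable[OF loc_ac_rate] x(2)] rate_nonneg[OF Z] by simp
  qed (use K0 Pm_nonneg in simp)
  finally show ?thesis by (simp add: K_def)
qed

text \<open>Picard iteration for the integrated equation. The factorial decay of the increments
  makes it converge on every \<open>(0,c)\<close> without any smallness.\<close>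

lemma sol_exists:
  fixes u0 :: complex
  assumes k: "\<And>c. set_integrable \<L> {0<..<c} k"
  shows "\<exists>u g. sol z k u g \<and> u 0 = u0"
proof -
  \<comment> \<open>The class preserved by the iteration; local boundedness is what makes the
    product with \<open>q\<close> locally integrable.\<close>
  define good where "good w \<longleftrightarrow> w \<in> borel_measurable \<L> \<and> (\<forall>c. \<exists>B. \<forall>x. 0 \<le> x \<longrightarrow> x \<le> c \<longrightarrow> norm (w x) \<le> B)"
    for w :: "real \<Rightarrow> complex"
  define h where "h w s = (LINT t:{0<..<s}|\<L>. (of_real (q t) - z) * w t - k t)" for w s
  define T where "T w x = u0 + (LINT s:{0<..<x}|P. h w s)" for w x
  have iqw: "set_integrable \<L> {0<..<c} (\<lambda>t. (of_real (q t) - z) * w t)" if gw: "good w" for w c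
  proof -
    obtain B where "\<And>x. 0 \<le> x \<Longrightarrow> x \<le> c \<Longrightarrow> norm (w x) \<le> B"
      using gw unfolding good_def by blast
    then show ?thesis
      by (intro coef_mult_loc[of w c B]) (use gw in \<open>auto simp: good_def\<close>)
  qed
  have ah: "loc_ac \<L> (h w) (\<lambda>t. (of_real (q t) - z) * w t - k t)" if "good w" for w
    using set_integral_diff(1)[OF iqw[OF that] k] by (simp add: loc_ac_def h_def)
  have aT: "loc_ac P (T w) (h w)" if "good w" for w
  proof -
    have "set_integrable P {0<..<c} (h w)" for c
      by (rule P.set_integrable_bounded[OF _ Leb.loc_ac_bounded[OF ah[OF that], of _ c]])
        (use Leb.loc_ac_measurable[OF ah[OF that]] measurable_P in auto)
    then show ?thesis by (simp add: loc_ac_def T_def)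
  qed
  have gT: "good (T w)" if "good w" for w
    unfolding good_def using P.loc_ac_measurable[OF aT[OF that]] P.loc_ac_bounded[OF aT[OF that]] by blast
  define U where "U n = (T ^^ n) (\<lambda>_. u0)" for n
  have U0: "U 0 = (\<lambda>_. u0)" and US: "U (Suc n) = T (U n)" for n by (simp_all add: U_def)
  have gU: "good (U n)" for n
  proof (induction n)
    case 0
    show ?case unfolding U0 good_def by auto
  qed (simp add: US gT)
  have step: "norm (T w x - T w' x) \<le> (LINT t:{0<..<x}|\<L>. norm (w t - w' t) * rate c (norm z) t)"
    if w: "good w" and w': "good w'" and x: "0 \<le> x" "x \<le> c" for w w' x c
  proof -
    have gd: "good (\<lambda>t. w t - w' t)"
      unfolding good_def
    proof (intro conjI allI)
      show "(\<lambda>t. w t - w' t) \<in> borel_measurable \<L>" using w w' by (auto simp: good_def)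
      fix c
      obtain B B' where "\<forall>x. 0 \<le> x \<longrightarrow> x \<le> c \<longrightarrow> norm (w x) \<le> B" "\<forall>x. 0 \<le> x \<longrightarrow> x \<le> c \<longrightarrow> norm (w' x) \<le> B'"
        using w w' unfolding good_def by blast
      then show "\<exists>B. \<forall>x. 0 \<le> x \<longrightarrow> x \<le> c \<longrightarrow> norm (w x - w' x) \<le> B"
        by (intro exI[of _ "B + B'"]) (meson add_mono norm_triangle_ineq4 order_trans)
    qed
    obtain B where B: "\<And>x. 0 \<le> x \<Longrightarrow> x \<le> c \<Longrightarrow> norm (w x - w' x) \<le> B"
      using gd unfolding good_def by blast
    have ad: "loc_ac P (\<lambda>x. T w x + (-1) * T w' x) (\<lambda>x. h w x + (-1) * h w' x)"
      by (intro loc_ac_add loc_ac_cmult aT w w')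
    have iqd: "set_integrable \<L> {0<..<s} (\<lambda>t. norm ((of_real (q t) - z) * (w t - w' t)))" for s
      by (rule set_integrable_norm[OF iqw[OF gd]])
    have hb: "norm (h w s + (-1) * h w' s) \<le> 0 + (LINT t:{0<..<s}|\<L>. norm ((of_real (q t) - z) * (w t - w' t)))" for s
    proof -
      have "h w s - h w' s = (LINT t:{0<..<s}|\<L>. ((of_real (q t) - z) * w t - k t) - ((of_real (q t) - z) * w' t - k t))"
        unfolding h_def
        by (rule set_integral_diff(2)[symmetric]) (rule loc_ac_integrable[OF ah[OF w]] loc_ac_integrable[OF ah[OF w']])+
      also have "\<dots> = (LINT t:{0<..<s}|\<L>. (of_real (q t) - z) * (w t - w' t))"
        by (simp add: algebra_simps)
      finally show ?thesis
        using set_integral_norm_bound[OF iqw[OF gd], of s] by simp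
    qed
    have "norm (T w x + (-1) * T w' x) \<le> norm (T w 0 + (-1) * T w' 0) + Pm c * 0 +
      (LINT t:{0<..<x}|\<L>. Pm c * norm ((of_real (q t) - z) * (w t - w' t)))"
      by (rule volterra_bound[OF ad hb iqd _ order.refl x]) auto
    also have "\<dots> = (LINT t:{0<..<x}|\<L>. Pm c * norm ((of_real (q t) - z) * (w t - w' t)))"
      by (simp add: T_def)
    also have "\<dots> \<le> (LINT t:{0<..<x}|\<L>. norm (w t - w' t) * rate c (norm z) t)"
    proof (rule Leb.Ioo_integral_mono)
      show "set_integrable \<L> {0<..<x} (\<lambda>t. Pm c * norm ((of_real (q t) - z) * (w t - w' t)))"
        by (rule set_integrable_mult_right) (rule iqd)
      show "set_integrable \<L> {0<..<x} (\<lambda>t. norm (w t - w' t) * rate c (norm z) t)"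
        by (rule Leb.loc_ac_mult_integrable[OF loc_ac_integrable[OF loc_ac_rate], where B=B])
          (use gd B x in \<open>auto simp: good_def\<close>)
      show "Pm c * norm ((of_real (q t) - z) * (w t - w' t)) \<le> norm (w t - w' t) * rate c (norm z) t" for t
        using mult_left_mono[OF norm_coef_le[of t z], of "Pm c * norm (w t - w' t)"]
        by (simp add: rate_def norm_mult Pm_nonneg mult_ac)
    qed
    finally show ?thesis by simp
  qed
  define R where "R c x = (LINT t:{0<..<x}|\<L>. rate c (norm z) t)" for c x
  have aR: "loc_ac \<L> (R c) (rate c (norm z))" for c
    unfolding R_def by (rule loc_ac_rate)
  have R0: "R c 0 = 0" for c by (simp add: R_def)
  have Rnn: "0 \<le> R c x" if "0 \<le> x" for c x
    by (rule loc_ac_nonneg[OF aR R0 rate_nonneg that]) simp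
  \<comment> \<open>The kernel \<open>rate c\<close> contains \<open>Pm c\<close> and so depends on
    \<open>c\<close>; the increments are therefore estimated on each \<open>[0,c]\<close>
    separately.\<close>
  have dU: "\<exists>A\<ge>0. \<forall>n x. 0 \<le> x \<longrightarrow> x \<le> c \<longrightarrow> norm (U (Suc n) x - U n x) \<le> A * (R c x ^ n / fact n)" for c
  proof -
    obtain A where A: "\<And>x. 0 \<le> x \<Longrightarrow> x \<le> c \<Longrightarrow> norm (U 1 x) \<le> A"
      using gU[of 1] unfolding good_def by blast
    have "norm (U (Suc n) x - U n x) \<le> (\<bar>A\<bar> + norm u0) * (R c x ^ n / fact n)" if "0 \<le> x" "x \<le> c" for n x
      using that
    proof (induction n arbitrary: x)
      case 0
      then show ?case
        using A[of x] norm_triangle_ineq4[of "U 1 x" u0] by (simp add: U0)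
    next
      case (Suc n)
      obtain B where B: "\<And>x. 0 \<le> x \<Longrightarrow> x \<le> c \<Longrightarrow> norm (U (Suc n) x) \<le> B"
        using gU[of "Suc n"] unfolding good_def by blast
      obtain B' where B': "\<And>x. 0 \<le> x \<Longrightarrow> x \<le> c \<Longrightarrow> norm (U n x) \<le> B'"
        using gU[of n] unfolding good_def by blast
      have "norm (U (Suc (Suc n)) x - U (Suc n) x) \<le>
          (LINT t:{0<..<x}|\<L>. norm (U (Suc n) t - U n t) * rate c (norm z) t)"
        unfolding US[of "Suc n"] US[of n] by (rule step) (use Suc.prems gU gT in auto)
      also have "\<dots> = 0 + (LINT t:{0<..<x}|\<L>. norm (U (Suc n) t - U n t) * rate c (norm z) t)"
        by simp
      also have "\<dots> \<le> (\<bar>A\<bar> + norm u0) * (R c x ^ Suc n / fact (Suc n))"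
      proof (rule volterra_step[where c=c and B="B + B'"])
        show "loc_ac \<L> (\<lambda>x. (\<bar>A\<bar> + norm u0) * (R c x ^ Suc n / fact (Suc n)))
          (\<lambda>x. (\<bar>A\<bar> + norm u0) * (R c x ^ n / fact n) * rate c (norm z) x)"
          using loc_ac_cmult[OF loc_ac_power[OF aR, of c n], of "\<bar>A\<bar> + norm u0"] by (simp add: mult.assoc)
        show "(\<lambda>t. norm (U (Suc n) t - U n t)) \<in> borel_measurable \<L>"
          using gU[of "Suc n"] gU[of n] by (auto simp: good_def)
        show "norm (norm (U (Suc n) t - U n t)) \<le> B + B'" if "0 < t" "t < c" for t
          using norm_triangle_le_diff[of "U (Suc n) t" "U n t"] B[of t] B'[of t] that by simp
      qed (use Suc R0 rate_nonneg loc_ac_integrable[OF aR] in auto)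
      finally show ?case .
    qed
    then show ?thesis by (intro exI[of _ "\<bar>A\<bar> + norm u0"]) auto
  qed
  have exp_sums: "(\<lambda>n. A * (r ^ n / fact n)) sums (A * exp r)" for A r :: real
    using sums_mult[OF exp_converges[of r], of A] by (simp add: divide_inverse mult.commute)
  have U_sum: "U n x = u0 + (\<Sum>i<n. U (Suc i) x - U i x)" for n x
    using sum_lessThan_telescope[of "\<lambda>i. U i x" n] by (simp add: U0)
  define L where "L x = lim (\<lambda>n. U n x)" for x
  have UL: "(\<lambda>n. U n x) \<longlonglongrightarrow> L x" if "0 \<le> x" for x
  proof -
    obtain A where A: "\<forall>n y. 0 \<le> y \<longrightarrow> y \<le> x \<longrightarrow> norm (U (Suc n) y - U n y) \<le> A * (R x y ^ n / fact n)"
      using dU by blast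
    have "summable (\<lambda>n. U (Suc n) x - U n x)"
      by (rule summable_comparison_test'[OF sums_summable[OF exp_sums[of A "R x x"]], of 0])
        (use A that in auto)
    then have "convergent (\<lambda>n. u0 + (\<Sum>i<n. U (Suc i) x - U i x))"
      by (intro convergent_add convergent_const) (simp add: summable_iff_convergent)
    then show ?thesis
      unfolding L_def U_sum[symmetric] by (simp add: convergent_LIMSEQ_iff)
  qed
  have Ub: "\<exists>B. \<forall>n x. 0 \<le> x \<longrightarrow> x \<le> c \<longrightarrow> norm (U n x) \<le> B" for c
  proof -
    obtain A where "0 \<le> A" and A: "\<forall>n y. 0 \<le> y \<longrightarrow> y \<le> c \<longrightarrow> norm (U (Suc n) y - U n y) \<le> A * (R c y ^ n / fact n)"
      using dU by blast
    have "norm (U n x) \<le> norm u0 + A * exp (R c c)" if x: "0 \<le> x" "x \<le> c" for n x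
    proof -
      have "norm (\<Sum>i<n. U (Suc i) x - U i x) \<le> (\<Sum>i<n. A * (R c x ^ i / fact i))"
        by (rule sum_norm_le) (use A x in auto)
      also have "\<dots> \<le> A * exp (R c x)"
        using sum_le_suminf[OF sums_summable[OF exp_sums[of A "R c x"]], of "{..<n}"]
          sums_unique[OF exp_sums[of A "R c x"]] \<open>0 \<le> A\<close> Rnn[OF x(1), of c] by auto
      also have "\<dots> \<le> A * exp (R c c)"
        using \<open>0 \<le> A\<close> Leb.Ioo_integral_mono_set[OF loc_ac_integrable[OF aR] x(2)] rate_nonneg[of "norm z"]
        by (intro mult_left_mono) (auto simp: R_def)
      finally show ?thesis
        using norm_triangle_ineq[of u0 "\<Sum>i<n. U (Suc i) x - U i x"] U_sum[of n x] by simp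
    qed
    then show ?thesis by blast
  qed
  have gL: "good L"
    unfolding good_def
  proof (intro conjI allI)
    show "L \<in> borel_measurable \<L>"
      by (rule borel_measurable_LIMSEQ_metric[where f=U]) (use gU UL in \<open>auto simp: good_def\<close>)
    fix c
    obtain B where "\<forall>n x. 0 \<le> x \<longrightarrow> x \<le> c \<longrightarrow> norm (U n x) \<le> B" using Ub by blast
    then show "\<exists>B. \<forall>x. 0 \<le> x \<longrightarrow> x \<le> c \<longrightarrow> norm (L x) \<le> B"
      by (intro exI[of _ B] allI impI LIMSEQ_le_const2[OF tendsto_norm[OF UL]]) auto
  qed
  \<comment> \<open>By \<open>step\<close> and dominated convergence \<open>T (U n) x\<close> tends
    to \<open>T L x\<close>; being the shifted sequence, it also tends to
    \<open>L x\<close>.\<close>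
  have T_step: "T L x = L x" if x: "0 \<le> x" for x
  proof -
    obtain B where B: "\<forall>n y. 0 \<le> y \<longrightarrow> y \<le> x \<longrightarrow> norm (U n y) \<le> B" using Ub by blast
    obtain C where C: "\<And>y. 0 \<le> y \<Longrightarrow> y \<le> x \<Longrightarrow> norm (L y) \<le> C"
      using gL unfolding good_def by blast
    have "(\<lambda>n. LINT t:{0<..<x}|\<L>. norm (U n t - L t) * rate x (norm z) t) \<longlonglongrightarrow>
        (LINT t|\<L>. 0)"
      unfolding set_lebesgue_integral_def
    proof (rule integral_dominated_convergence)
      show "integrable \<L> (\<lambda>t. (B + C) * (indicator {0<..<x} t *\<^sub>R rate x (norm z) t))"
        using loc_ac_integrable[OF aR, of x x] unfolding set_integrable_def by (rule integrable_mult_right)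
      show "(\<lambda>t. indicator {0<..<x} t *\<^sub>R (norm (U n t - L t) * rate x (norm z) t)) \<in> borel_measurable \<L>" for n
        using gU[of n] gL Leb.loc_ac_measurable_density[OF aR[of x]] by (auto simp: good_def)
      show "AE t in \<L>. (\<lambda>n. indicator {0<..<x} t *\<^sub>R (norm (U n t - L t) * rate x (norm z) t)) \<longlonglongrightarrow> 0"
      proof (rule AE_I2)
        fix t assume "t \<in> space \<L>"
        then have "(\<lambda>n. indicator {0<..<x} t *\<^sub>R (norm (U n t - L t) * rate x (norm z) t)) \<longlonglongrightarrow>
           indicator {0<..<x} t *\<^sub>R (norm (L t - L t) * rate x (norm z) t)"
          by (intro tendsto_intros UL) simp
        then show "(\<lambda>n. indicator {0<..<x} t *\<^sub>R (norm (U n t - L t) * rate x (norm z) t)) \<longlonglongrightarrow> 0" by simp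
      qed
      show "AE t in \<L>. norm (indicator {0<..<x} t *\<^sub>R (norm (U n t - L t) * rate x (norm z) t))
          \<le> (B + C) * (indicator {0<..<x} t *\<^sub>R rate x (norm z) t)" for n
      proof (rule AE_I2)
        fix t
        have r: "0 \<le> rate x (norm z) t" by (rule rate_nonneg) simp
        show "norm (indicator {0<..<x} t *\<^sub>R (norm (U n t - L t) * rate x (norm z) t))
          \<le> (B + C) * (indicator {0<..<x} t *\<^sub>R rate x (norm z) t)"
        proof (cases "0 < t \<and> t < x")
          case True
          then have "norm (U n t - L t) \<le> B + C"
            using B C[of t] norm_triangle_le_diff[of "U n t" "L t" "B + C"] by (simp add: add_mono)
          from mult_right_mono[OF this r] show ?thesis using True r by (simp add: abs_mult)
        qed (auto simp: indicator_def)
      qed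
    qed auto
    then have "(\<lambda>n. LINT t:{0<..<x}|\<L>. norm (U n t - L t) * rate x (norm z) t) \<longlonglongrightarrow> 0"
      (is "?I \<longlonglongrightarrow> 0") by simp
    moreover have "\<forall>\<^sub>F n in sequentially. norm (T (U n) x - T L x) \<le> (LINT t:{0<..<x}|\<L>. norm (U n t - L t) * rate x (norm z) t)"
      by (rule always_eventually) (rule allI, rule step[OF gU gL x order.refl])
    ultimately have "(\<lambda>n. T (U n) x - T L x) \<longlonglongrightarrow> 0"
      by (rule Lim_null_comparison[rotated])
    then have "(\<lambda>n. U (Suc n) x) \<longlonglongrightarrow> T L x"
      unfolding US by (rule LIM_zero_cancel)
    moreover have "(\<lambda>n. U (Suc n) x) \<longlonglongrightarrow> L x"
      using UL[OF x] by (rule LIMSEQ_Suc)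
    ultimately show ?thesis by (rule LIMSEQ_unique)
  qed
  have "L 0 = u0" using T_step[of 0] by (simp add: T_def)
  moreover have "loc_ac P L (h L)"
    unfolding loc_ac_def
  proof (intro conjI allI impI)
    show "set_integrable P {0<..<c} (h L)" for c by (rule loc_ac_integrable[OF aT[OF gL]])
    fix x :: real assume "0 \<le> x"
    from T_step[OF this] show "L x = L 0 + (LINT t:{0<..<x}|P. h L t)"
      by (simp add: T_def \<open>L 0 = u0\<close>)
  qed
  ultimately show ?thesis
    using ah[OF gL] unfolding sol_def by (intro exI[of _ L] exI[of _ "h L"]) (simp add: h_def)
qed

end

section \<open>Lebesgue integrals over subintervals\<close>

lemma Leb_measure_Ioo: "0 \<le> a \<Longrightarrow> a \<le> b \<Longrightarrow> measure \<L> {a<..<b} = b - a"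
  using Leb_emeasure[OF Leb.Ioo_sets', of a b] by (simp add: measure_def)

lemma Leb_Ioo_finite: "0 \<le> a \<Longrightarrow> emeasure \<L> {a<..<b} \<noteq> \<infinity>"
  using Leb_emeasure[OF Leb.Ioo_sets', of a b] by (cases "a \<le> b") auto

lemma Leb_const:
  fixes r :: real
  assumes "0 \<le> a" "a \<le> b"
  shows "set_integrable \<L> {a<..<b} (\<lambda>x. r)" "(LINT x:{a<..<b}|\<L>. r) = (b - a) * r"
proof -
  have "emeasure \<L> {a<..<b} < \<infinity>" using Leb_Ioo_finite[OF assms(1)] by (simp add: less_top)
  then have "set_integrable \<L> {a<..<b} (\<lambda>x. 1::real)"
    using Leb.Ioo_sets'[OF assms(1)] unfolding set_integrable_def by simp
  then show "set_integrable \<L> {a<..<b} (\<lambda>x. r)"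
    using set_integrable_mult_right[of r \<L> "{a<..<b}" "\<lambda>x. 1"] by simp
  show "(LINT x:{a<..<b}|\<L>. r) = (b - a) * r"
    using Leb_Ioo_finite[OF assms(1)] Leb.Ioo_sets'[OF assms(1)] Leb_measure_Ioo[OF assms]
    by (subst set_integral_const) auto
qed

lemma Leb_integrable_bounded:
  fixes f :: "real \<Rightarrow> 'b::{banach,second_countable_topology}"
  assumes "0 \<le> a" and f: "f \<in> borel_measurable \<L>" and B: "\<And>x. a < x \<Longrightarrow> x < b \<Longrightarrow> norm (f x) \<le> B"
  shows "set_integrable \<L> {a<..<b} f"
proof (cases "a < b")
  case True
  note [measurable] = f Leb.Ioo_sets'[OF assms(1)]
  have "0 \<le> B" using order_trans[OF norm_ge_zero B[of "(a + b) / 2"]] True by simp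
  have "set_integrable \<L> {0<..<b} (\<lambda>x. indicator {a<..<b} x *\<^sub>R f x)"
    by (rule Leb.set_integrable_bounded[where B=B])
      (use B \<open>0 \<le> B\<close> in \<open>auto simp: indicator_def\<close>)
  moreover have "(\<lambda>x. indicat_real {0<..<b} x *\<^sub>R indicat_real {a<..<b} x *\<^sub>R f x) = (\<lambda>x. indicat_real {a<..<b} x *\<^sub>R f x)"
    using assms(1) by (auto simp: fun_eq_iff indicator_def)
  ultimately show ?thesis by (simp add: set_integrable_def)
qed simp

lemma Leb_Ioo_split:
  fixes f :: "real \<Rightarrow> 'b::{banach,second_countable_topology}"
  assumes "set_integrable \<L> {a<..<b} f" "0 \<le> a" "a < m" "m < b" "f \<in> borel_measurable \<L>"
  shows "(LINT t:{a<..<b}|\<L>. f t) = (LINT t:{a<..<m}|\<L>. f t) + (LINT t:{m<..<b}|\<L>. f t)"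
proof -
  have "{a<..<b} = {a<..<m} \<union> {m..<b}" "{a<..<m} \<inter> {m..<b} = {}" using assms by auto
  moreover have "set_integrable \<L> {a<..<m} f" "set_integrable \<L> {m..<b} f"
    using assms by (auto intro!: set_integrable_subset[OF assms(1)] Leb.Ioo_sets' Leb.Ico_sets)
  ultimately show ?thesis
    using set_integral_Un[of "{a<..<m}" "{m..<b}" \<L> f] Leb_integral_Ico[of m f b] assms by simp
qed

lemma Leb_Ioo_mono_set:
  fixes f :: "real \<Rightarrow> real"
  assumes "set_integrable \<L> {a<..<b} f" "\<And>x. a < x \<Longrightarrow> x < b \<Longrightarrow> 0 \<le> f x"
    "A \<subseteq> {a<..<b}" "A \<in> sets \<L>"
  shows "(LINT t:A|\<L>. f t) \<le> (LINT t:{a<..<b}|\<L>. f t)"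
  unfolding set_lebesgue_integral_def
proof (rule integral_mono)
  show "integrable \<L> (\<lambda>x. indicat_real A x *\<^sub>R f x)"
    using set_integrable_subset[OF assms(1,4,3)] unfolding set_integrable_def .
  show "integrable \<L> (\<lambda>x. indicat_real {a<..<b} x *\<^sub>R f x)"
    using assms(1) unfolding set_integrable_def .
qed (use assms(2,3) in \<open>auto simp: indicator_def\<close>)

text \<open>Cauchy-Schwarz against the constant 1, by expanding the nonnegative integral of
  \<open>(l * f x - m)\<^sup>2\<close>. A null set \<open>A\<close> is treated apart because the
  expansion is divided by \<open>l\<close>.\<close>

lemma sqr_integral_le:
  fixes f :: "real \<Rightarrow> real"
  assumes A: "A \<in> sets M" "emeasure M A \<noteq> \<infinity>" and f: "set_integrable M A f" "set_integrable M A (\<lambda>x. (f x)\<^sup>2)"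
  shows "(LINT x:A|M. f x)\<^sup>2 \<le> measure M A * (LINT x:A|M. (f x)\<^sup>2)"
proof -
  define m where "m = (LINT x:A|M. f x)"
  define l where "l = measure M A"
  define S where "S = (LINT x:A|M. (f x)\<^sup>2)"
  have ci: "set_integrable M A (\<lambda>x. r)" for r :: real
    using A unfolding set_integrable_def by (auto intro!: integrable_mult_left simp: less_top)
  have c: "(LINT x:A|M. r) = l * r" for r :: real
    using set_integral_const[OF A, of r] by (simp add: l_def)
  have "0 \<le> (LINT x:A|M. (l * f x - m)\<^sup>2)"
    by (simp add: set_lebesgue_integral_def)
  also have "\<dots> = (LINT x:A|M. l\<^sup>2 * (f x)\<^sup>2 + (m\<^sup>2 - 2 * l * m * f x))"
    by (simp add: power2_eq_square algebra_simps)
  also have "\<dots> = l\<^sup>2 * S + (l * m\<^sup>2 - 2 * l * m * m)"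
    using f ci by (simp add: c S_def m_def)
  finally have *: "l * m\<^sup>2 \<le> l * (l * S)" by (simp add: power2_eq_square algebra_simps)
  show ?thesis
  proof (cases "l = 0")
    case True
    then have "A \<in> null_sets M" using A by (auto simp: l_def measure_def enn2real_eq_0_iff)
    then have "m = 0" unfolding m_def set_lebesgue_integral_def
      by (intro integral_eq_zero_AE) (auto dest: AE_not_in simp: indicator_def)
    then show ?thesis using True by (simp add: m_def[symmetric] l_def[symmetric])
  next
    case False
    then have "0 < l" by (simp add: l_def zero_less_measure_iff measure_le_0_iff)
    then show ?thesis using * by (simp add: l_def[symmetric] m_def[symmetric] S_def[symmetric])
  qed
qed

section \<open>Estimates on one interval\<close>

text \<open>What the estimates need to know about a function on a gap. Nothing is said about the
  endpoints, where \<open>u\<close> may jump.\<close>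

definition seg :: "real \<Rightarrow> real \<Rightarrow> (real \<Rightarrow> complex) \<Rightarrow> (real \<Rightarrow> complex) \<Rightarrow> bool" where
  "seg a b u g \<longleftrightarrow> 0 \<le> a \<and> a < b \<and> u \<in> borel_measurable \<L> \<and> g \<in> borel_measurable \<L> \<and>
     set_integrable \<L> {a<..<b} (\<lambda>x. (norm (g x))\<^sup>2) \<and>
     (\<exists>B. \<forall>x. a < x \<longrightarrow> x < b \<longrightarrow> norm (u x) \<le> B) \<and>
     (\<forall>x y. a < x \<longrightarrow> x \<le> y \<longrightarrow> y < b \<longrightarrow> u y - u x = (LINT t:{x..<y}|\<L>. g t))"

definition energy :: "real \<Rightarrow> real \<Rightarrow> (real \<Rightarrow> complex) \<Rightarrow> real" where
  "energy a b g = (LINT x:{a<..<b}|\<L>. (norm (g x))\<^sup>2)"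

lemma energy_nonneg: "0 \<le> energy a b g"
  by (simp add: energy_def set_lebesgue_integral_def)

lemma seg_sub: "seg a b u g \<Longrightarrow> a \<le> a' \<Longrightarrow> a' < b' \<Longrightarrow> b' \<le> b \<Longrightarrow> seg a' b' u g"
  unfolding seg_def
  by (auto intro!: set_integrable_subset[of \<L> "{a<..<b}"] Leb.Ioo_sets' intro: exI
      dest: order.strict_trans1 order.strict_trans2 simp: subset_eq) (metis order.strict_trans1 order.strict_trans2)

lemma seg_sq_integrable:
  assumes "seg a b u g"
  shows "set_integrable \<L> {a<..<b} (\<lambda>x. (norm (u x))\<^sup>2)"
proof -
  obtain B where B: "\<forall>x. a < x \<longrightarrow> x < b \<longrightarrow> norm (u x) \<le> B" using assms by (auto simp: seg_def)
  show ?thesis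
  proof (rule Leb_integrable_bounded)
    show "norm ((norm (u x))\<^sup>2) \<le> B\<^sup>2" if "a < x" "x < b" for x
      using B that by (simp add: power_mono)
  qed (use assms in \<open>auto simp: seg_def\<close>)
qed

lemma seg_weight_integrable:
  assumes "seg a b u g" "set_integrable \<L> {a<..<b} p"
  shows "set_integrable \<L> {a<..<b} (\<lambda>x. p x * (norm (u x))\<^sup>2)"
proof -
  obtain B where B: "\<forall>x. a < x \<longrightarrow> x < b \<longrightarrow> norm (u x) \<le> B" using assms by (auto simp: seg_def)
  have [measurable]: "u \<in> borel_measurable \<L>" using assms by (auto simp: seg_def)
  have [measurable]: "(\<lambda>x. indicator {a<..<b} x *\<^sub>R p x) \<in> borel_measurable \<L>"
    using assms(2) unfolding set_integrable_def by (rule borel_measurable_integrable)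
  show ?thesis
    unfolding set_integrable_def
  proof (rule Bochner_Integration.integrable_bound)
    show "integrable \<L> (\<lambda>x. B\<^sup>2 * norm (indicator {a<..<b} x *\<^sub>R p x))"
      using assms(2) unfolding set_integrable_def by (intro integrable_mult_right integrable_norm)
    have "(\<lambda>x. (norm (u x))\<^sup>2 * (indicator {a<..<b} x *\<^sub>R p x)) \<in> borel_measurable \<L>" by measurable
    then show "(\<lambda>x. indicator {a<..<b} x *\<^sub>R (p x * (norm (u x))\<^sup>2)) \<in> borel_measurable \<L>"
      by (simp add: mult_ac)
    show "AE x in \<L>. norm (indicator {a<..<b} x *\<^sub>R (p x * (norm (u x))\<^sup>2)) \<le> norm (B\<^sup>2 * norm (indicator {a<..<b} x *\<^sub>R p x))"
    proof (rule AE_I2)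
      fix x
      show "norm (indicator {a<..<b} x *\<^sub>R (p x * (norm (u x))\<^sup>2)) \<le> norm (B\<^sup>2 * norm (indicator {a<..<b} x *\<^sub>R p x))"
      proof (cases "a < x \<and> x < b")
        case True
        then have "(norm (u x))\<^sup>2 \<le> B\<^sup>2" using B by (intro power_mono) auto
        then have "\<bar>p x\<bar> * (norm (u x))\<^sup>2 \<le> \<bar>p x\<bar> * B\<^sup>2" by (intro mult_left_mono) auto
        then show ?thesis using True by (simp add: abs_mult mult.commute)
      qed auto
    qed
  qed
qed

lemma le_one_plus_square: "(r::real) \<le> 1 + r\<^sup>2"
  using zero_le_power2[of "r - 1/2"] by (simp add: power2_eq_square algebra_simps)

text \<open>Cauchy-Schwarz bounds \<open>norm (u y - u x)\<^sup>2\<close> by length times energy;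
  squaring the triangle inequality costs the factors 2.\<close>

lemma seg_oscillation:
  assumes s: "seg a b u g" and x: "a < x" "x < b" and y: "a < y" "y < b"
  shows "(norm (u y))\<^sup>2 \<le> 2 * (norm (u x))\<^sup>2 + 2 * ((b - a) * energy a b g)"
proof -
  have a0: "0 \<le> a" and gm: "g \<in> borel_measurable \<L>" and g2: "set_integrable \<L> {a<..<b} (\<lambda>x. (norm (g x))\<^sup>2)"
    and inc: "\<And>x y. a < x \<Longrightarrow> x \<le> y \<Longrightarrow> y < b \<Longrightarrow> u y - u x = (LINT t:{x..<y}|\<L>. g t)"
    using s by (auto simp: seg_def)
  have gi: "set_integrable \<L> {a<..<b} (\<lambda>x. norm (g x))"
  proof (rule set_integrable_bound[OF _ _ AE_I2])
    show "set_integrable \<L> {a<..<b} (\<lambda>x. 1 + (norm (g x))\<^sup>2)"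
      by (intro set_integral_add(1) g2 Leb_const) (use s in \<open>auto simp: seg_def\<close>)
    show "set_borel_measurable \<L> {a<..<b} (\<lambda>x. norm (g x))"
      unfolding set_borel_measurable_def using gm Leb.Ioo_sets'[OF a0] by measurable
    show "x \<in> {a<..<b} \<longrightarrow> norm (norm (g x)) \<le> norm (1 + (norm (g x))\<^sup>2)" for x
      using le_one_plus_square[of "norm (g x)"] by simp
  qed
  have aux: "(norm (u y - u x))\<^sup>2 \<le> (b - a) * energy a b g" if xy: "a < x" "x \<le> y" "y < b" for x y
  proof -
    have sub: "{x..<y} \<subseteq> {a<..<b}" and S: "{x..<y} \<in> sets \<L>" using xy a0 by (auto intro: Leb.Ico_sets)
    have e: "emeasure \<L> {x..<y} = ennreal (y - x)" using Leb_emeasure[OF S] xy by simp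
    have "norm (u y - u x) \<le> (LINT t:{x..<y}|\<L>. norm (g t))"
      unfolding inc[OF xy]
    proof (rule set_integral_norm_bound)
      show "set_integrable \<L> {x..<y} g"
        using set_integrable_subset[OF gi S sub] gm S
        unfolding set_integrable_def
        by (subst (asm) integrable_iff_bounded, subst integrable_iff_bounded) (auto simp: norm_mult)
    qed
    then have "(norm (u y - u x))\<^sup>2 \<le> (LINT t:{x..<y}|\<L>. norm (g t))\<^sup>2"
      by (rule power_mono) simp
    also have "\<dots> \<le> measure \<L> {x..<y} * (LINT t:{x..<y}|\<L>. (norm (g t))\<^sup>2)"
      by (rule sqr_integral_le) (use S e set_integrable_subset[OF gi S sub] set_integrable_subset[OF g2 S sub] in auto)
    also have "\<dots> \<le> (b - a) * energy a b g"
      unfolding energy_def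
    proof (rule mult_mono)
      show "measure \<L> {x..<y} \<le> b - a" using e xy by (simp add: measure_def)
      show "(LINT t:{x..<y}|\<L>. (norm (g t))\<^sup>2) \<le> (LINT t:{a<..<b}|\<L>. (norm (g t))\<^sup>2)"
        by (rule Leb_Ioo_mono_set[OF g2 _ sub S]) simp
    qed (use xy in \<open>auto simp: set_lebesgue_integral_def\<close>)
    finally show ?thesis .
  qed
  have D: "(norm (u y - u x))\<^sup>2 \<le> (b - a) * energy a b g"
    using aux[of x y] aux[of y x] x y by (cases "x \<le> y") (auto simp: norm_minus_commute)
  have "norm (u y) \<le> norm (u x) + norm (u y - u x)"
    using norm_triangle_ineq[of "u x" "u y - u x"] by simp
  then have "(norm (u y))\<^sup>2 \<le> (norm (u x) + norm (u y - u x))\<^sup>2" by (rule power_mono) simp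
  also have "\<dots> \<le> 2 * (norm (u x))\<^sup>2 + 2 * (norm (u y - u x))\<^sup>2"
    using zero_le_power2[of "norm (u x) - norm (u y - u x)"] by (simp add: power2_eq_square algebra_simps)
  finally show ?thesis using D by simp
qed

text \<open>\<open>seg_oscillation\<close> integrated over \<open>x\<close>: a Sobolev bound with
  explicit dependence on the length.\<close>

lemma seg_sup:
  assumes s: "seg a b u g" and y: "a < y" "y < b"
  shows "(b - a) * (norm (u y))\<^sup>2 \<le> 2 * (LINT x:{a<..<b}|\<L>. (norm (u x))\<^sup>2) + 2 * ((b - a)\<^sup>2 * energy a b g)"
proof -
  have ab: "0 \<le> a" "a \<le> b" using s by (auto simp: seg_def)
  have "(b - a) * (norm (u y))\<^sup>2 = (LINT x:{a<..<b}|\<L>. (norm (u y))\<^sup>2)"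
    using Leb_const[OF ab] by simp
  also have "\<dots> \<le> (LINT x:{a<..<b}|\<L>. 2 * (norm (u x))\<^sup>2 + 2 * ((b - a) * energy a b g))"
    by (intro set_integral_mono Leb_const ab set_integral_add(1) set_integrable_mult_right seg_sq_integrable[OF s])
      (use seg_oscillation[OF s _ _ y] in auto)
  also have "\<dots> = 2 * (LINT x:{a<..<b}|\<L>. (norm (u x))\<^sup>2) + (b - a) * (2 * ((b - a) * energy a b g))"
    using seg_sq_integrable[OF s] Leb_const[OF ab] by (simp add: set_integral_add(2))
  finally show ?thesis by (simp add: power2_eq_square)
qed

text \<open>\<open>seg_oscillation\<close> integrated over both points, with weight \<open>p\<close>
  in \<open>x\<close> and Lebesgue measure in \<open>y\<close>: up to an energy error the weight
  acts like its mean.\<close>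

lemma seg_weight_lower:
  assumes s: "seg a b u g" and p: "set_integrable \<L> {a<..<b} p" "\<And>x. a < x \<Longrightarrow> x < b \<Longrightarrow> 0 \<le> p x"
    and M: "0 \<le> M" "M * (b - a) \<le> (LINT x:{a<..<b}|\<L>. p x)"
  shows "M * ((1/2) * (LINT x:{a<..<b}|\<L>. (norm (u x))\<^sup>2) - (b - a)\<^sup>2 * energy a b g)
    \<le> (LINT x:{a<..<b}|\<L>. p x * (norm (u x))\<^sup>2)"
proof -
  define l where "l = b - a"
  define E where "E = energy a b g"
  define U where "U = (LINT x:{a<..<b}|\<L>. (norm (u x))\<^sup>2)"
  define W where "W = (LINT x:{a<..<b}|\<L>. p x * (norm (u x))\<^sup>2)"
  define T where "T = (LINT x:{a<..<b}|\<L>. p x)"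
  have ab: "0 \<le> a" "a \<le> b" and l: "0 < l" using s by (auto simp: seg_def l_def)
  have Wi: "set_integrable \<L> {a<..<b} (\<lambda>x. p x * (norm (u x))\<^sup>2)"
    by (rule seg_weight_integrable[OF s p(1)])
  have W: "T * ((1/2) * (norm (u y))\<^sup>2 - l * E) \<le> W" if y: "a < y" "y < b" for y
  proof -
    have "T * ((1/2) * (norm (u y))\<^sup>2 - l * E) = (LINT x:{a<..<b}|\<L>. p x * ((1/2) * (norm (u y))\<^sup>2 - l * E))"
      by (simp only: T_def set_integral_mult_left)
    also have "\<dots> \<le> W"
      unfolding W_def
    proof (rule set_integral_mono[OF set_integrable_mult_left Wi])
      fix x assume "x \<in> {a<..<b}"
      then show "p x * ((1/2) * (norm (u y))\<^sup>2 - l * E) \<le> p x * (norm (u x))\<^sup>2"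
        using seg_oscillation[OF s, of x y] y p(2)[of x]
        by (intro mult_left_mono) (auto simp: l_def E_def)
    qed (rule p(1))
    finally show ?thesis .
  qed
  have "T * ((1/2) * U - l * (l * E)) = (LINT y:{a<..<b}|\<L>. T * ((1/2) * (norm (u y))\<^sup>2 - l * E))"
    using seg_sq_integrable[OF s] Leb_const[OF ab]
    by (simp add: set_integral_diff(2) U_def l_def)
  also have "\<dots> \<le> (LINT y:{a<..<b}|\<L>. W)"
    by (intro set_integral_mono Leb_const ab set_integrable_mult_right set_integral_diff(1) seg_sq_integrable[OF s])
      (use W in auto)
  also have "\<dots> = l * W" using Leb_const[OF ab] by (simp add: l_def)
  finally have A: "T * ((1/2) * U - l * (l * E)) \<le> l * W" .
  have W0: "0 \<le> W"
    unfolding W_def set_lebesgue_integral_def using p(2)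
    by (intro integral_nonneg_AE AE_I2) (auto simp: indicator_def)
  \<comment> \<open>The mean of \<open>p\<close> may be lowered to \<open>M\<close> only when the
    bracket is nonnegative; otherwise the left side is nonpositive and \<open>W\<close> is not
    negative.\<close>
  have "M * ((1/2) * U - l * (l * E)) \<le> W"
  proof (cases "0 \<le> (1/2) * U - l * (l * E)")
    case True
    have "l * (M * ((1/2) * U - l * (l * E))) = (M * l) * ((1/2) * U - l * (l * E))" by simp
    also have "\<dots> \<le> T * ((1/2) * U - l * (l * E))"
      using M(2) True by (intro mult_right_mono) (auto simp: T_def l_def)
    finally show ?thesis using A l by (meson mult_le_cancel_left_pos order_trans)
  next
    case False
    then have "M * ((1/2) * U - l * (l * E)) \<le> 0" using M(1) by (intro mult_nonneg_nonpos) auto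
    then show ?thesis using W0 by simp
  qed
  then show ?thesis by (simp add: U_def W_def E_def l_def power2_eq_square mult.assoc)
qed

text \<open>The sup bound is used on a short piece around each point: a small length
  \<open>l\<close> makes the energy term small, at the price of \<open>2 / l\<close> in front of the
  mass.\<close>

lemma seg_neg_bound:
  assumes s: "seg a b u g" and p: "set_integrable \<L> {a<..<b} p" "\<And>x. a < x \<Longrightarrow> x < b \<Longrightarrow> 0 \<le> p x"
    and K: "(LINT x:{a<..<b}|\<L>. p x) \<le> K * (b - a)" "1 \<le> K" and D: "b - a \<le> D" "1 \<le> D"
  shows "(LINT x:{a<..<b}|\<L>. p x * (norm (u x))\<^sup>2)
    \<le> (1/4) * energy a b g + 16 * K\<^sup>2 * D\<^sup>2 * (LINT x:{a<..<b}|\<L>. (norm (u x))\<^sup>2)"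
proof -
  define d where "d = b - a"
  define E where "E = energy a b g"
  define U where "U = (LINT x:{a<..<b}|\<L>. (norm (u x))\<^sup>2)"
  \<comment> \<open>Chosen so that \<open>K * d * 2 * l \<le> 1/4\<close> when
    \<open>d \<le> D\<close>, but never longer than the interval. Then
    \<open>K * d * (2 / l)\<close> is at most \<open>16 * K\<^sup>2 * D\<^sup>2\<close> in both
    cases of the minimum.\<close>
  define l where "l = min d (1 / (8 * K * D))"
  define S where "S = (2 / l) * U + 2 * l * E"
  have a0: "0 \<le> a" and d0: "0 < d" using s by (auto simp: seg_def d_def)
  have KD: "0 < 8 * K * D" using K D by simp
  then have l: "0 < l" "l \<le> d" "l \<le> 1 / (8 * K * D)" using d0 by (auto simp: l_def)
  have E0: "0 \<le> E" by (simp add: E_def energy_nonneg)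
  have U0: "0 \<le> U" by (simp add: U_def set_lebesgue_integral_def)
  have S0: "0 \<le> S" using E0 U0 l by (simp add: S_def)
  have sup: "(norm (u y))\<^sup>2 \<le> S" if y: "a < y" "y < b" for y
  proof -
    \<comment> \<open>The piece of length \<open>l\<close> centred at \<open>y\<close>, pushed back
      into \<open>(a,b)\<close> if it sticks out.\<close>
    define t where "t = min (max a (y - l/2)) (b - l)"
    have t: "a \<le> t" "t + l \<le> b" "t < y" "y < t + l"
      using y l unfolding t_def d_def by (auto simp: min_def max_def)
    have st: "seg t (t + l) u g" by (rule seg_sub[OF s t(1) _ t(2)]) (use l in simp)
    have sub: "{t<..<t + l} \<subseteq> {a<..<b}" and St: "{t<..<t + l} \<in> sets \<L>"
      using t a0 by (auto intro: Leb.Ioo_sets')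
    have "(LINT x:{t<..<t + l}|\<L>. (norm (u x))\<^sup>2) \<le> U"
      unfolding U_def by (rule Leb_Ioo_mono_set[OF seg_sq_integrable[OF s] _ sub St]) simp
    moreover have "energy t (t + l) g \<le> E"
      unfolding E_def energy_def by (rule Leb_Ioo_mono_set[OF _ _ sub St]) (use s in \<open>auto simp: seg_def\<close>)
    then have "l\<^sup>2 * energy t (t + l) g \<le> l\<^sup>2 * E" by (intro mult_left_mono) auto
    ultimately have "l * (norm (u y))\<^sup>2 \<le> 2 * U + 2 * (l\<^sup>2 * E)"
      using seg_sup[OF st t(3,4)] by simp
    also have "\<dots> = l * S" using l by (simp add: S_def power2_eq_square distrib_left)
    finally show ?thesis using l by simp
  qed
  have "(LINT x:{a<..<b}|\<L>. p x * (norm (u x))\<^sup>2) \<le> (LINT x:{a<..<b}|\<L>. p x * S)"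
    by (intro set_integral_mono seg_weight_integrable[OF s] set_integrable_mult_left p(1) mult_left_mono sup p(2)) auto
  also have "\<dots> = (LINT x:{a<..<b}|\<L>. p x) * S" by (rule set_integral_mult_left)
  also have "\<dots> \<le> (K * d) * S" using K(1) S0 by (intro mult_right_mono) (auto simp: d_def)
  also have "\<dots> = (K * d * 2 * l) * E + (K * d * (2 / l)) * U" by (simp add: S_def algebra_simps)
  also have "\<dots> \<le> (1/4) * E + (16 * K\<^sup>2 * D\<^sup>2) * U"
  proof (intro add_mono mult_right_mono E0 U0)
    have "K * d * 2 * l \<le> K * D * 2 * (1 / (8 * K * D))"
      using K D l d0 by (intro mult_mono) (auto simp: d_def)
    then show "K * d * 2 * l \<le> 1/4" using K D by simp
    show "K * d * (2 / l) \<le> 16 * K\<^sup>2 * D\<^sup>2"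
    proof (cases "d \<le> 1 / (8 * K * D)")
      case True
      then have "l = d" by (simp add: l_def)
      then have "K * d * (2 / l) = 2 * K" using d0 by simp
      also have "\<dots> \<le> 16 * K\<^sup>2 * D\<^sup>2"
      proof -
        have "1 * 1 \<le> K * D\<^sup>2" using K D by (intro mult_mono one_le_power) auto
        then have "K * 1 \<le> K * (K * D\<^sup>2)" using K by (intro mult_left_mono) auto
        then have "2 * K \<le> 16 * (K * (K * D\<^sup>2))" using K by linarith
        then show ?thesis by (simp only: power2_eq_square mult.assoc)
      qed
      finally show ?thesis .
    next
      case False
      then have "l = 1 / (8 * K * D)" by (simp add: l_def)
      then have "K * d * (2 / l) = 16 * K\<^sup>2 * D * d" by (simp add: power2_eq_square)
      also have "\<dots> \<le> 16 * K\<^sup>2 * D * D" using K D by (intro mult_left_mono) (auto simp: d_def)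
      finally show ?thesis by (simp add: power2_eq_square)
    qed
  qed
  finally show ?thesis by (simp add: E_def U_def)
qed

text \<open>The interval is cut into pieces of length between \<open>e\<close> and
  \<open>2 * e\<close>. One window gives such a piece a mean of at least \<open>2 * M\<close>, and
  \<open>seg_weight_lower\<close> then yields \<open>M\<close> times the mass with energy
  coefficient \<open>2 * M * (2 * e)\<^sup>2\<close>.\<close>

lemma seg_pos_bound:
  assumes "seg a b u g" "set_integrable \<L> {a<..<b} p" "\<And>x. a < x \<Longrightarrow> x < b \<Longrightarrow> 0 \<le> p x" "p \<in> borel_measurable \<L>"
    and "0 \<le> M" "0 < e" "e \<le> b - a"
    and "\<And>x. a \<le> x \<Longrightarrow> x + e \<le> b \<Longrightarrow> 4 * M * e \<le> (LINT t:{x<..<x+e}|\<L>. p t)"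
  shows "M * (LINT x:{a<..<b}|\<L>. (norm (u x))\<^sup>2) - 8 * M * e\<^sup>2 * energy a b g
    \<le> (LINT x:{a<..<b}|\<L>. p x * (norm (u x))\<^sup>2)"
proof -
  have short: "M * (LINT x:{a<..<b}|\<L>. (norm (u x))\<^sup>2) - 8 * M * e\<^sup>2 * energy a b g
      \<le> (LINT x:{a<..<b}|\<L>. p x * (norm (u x))\<^sup>2)"
    if s: "seg a b u g" and p: "set_integrable \<L> {a<..<b} p" "\<And>x. a < x \<Longrightarrow> x < b \<Longrightarrow> 0 \<le> p x"
      and e: "e \<le> b - a" "b - a \<le> 2 * e"
      and w: "\<And>x. a \<le> x \<Longrightarrow> x + e \<le> b \<Longrightarrow> 4 * M * e \<le> (LINT t:{x<..<x+e}|\<L>. p t)" for a b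
  proof -
    have a0: "0 \<le> a" using s by (simp add: seg_def)
    have "2 * M * (b - a) \<le> 2 * M * (2 * e)" using e assms(5) by (intro mult_left_mono) auto
    also have "\<dots> \<le> (LINT t:{a<..<a+e}|\<L>. p t)" using w[of a] e by simp
    also have "\<dots> \<le> (LINT t:{a<..<b}|\<L>. p t)"
      by (rule Leb_Ioo_mono_set[OF p]) (use e a0 in \<open>auto intro: Leb.Ioo_sets'\<close>)
    finally have "2 * M * (1 / 2 * (LINT x:{a<..<b}|\<L>. (norm (u x))\<^sup>2) - (b - a)\<^sup>2 * energy a b g)
       \<le> (LINT x:{a<..<b}|\<L>. p x * (norm (u x))\<^sup>2)"
      using assms(5) by (intro seg_weight_lower[OF s p]) auto
    moreover have "(b - a)\<^sup>2 \<le> (2 * e)\<^sup>2" using e assms(6) by (intro power_mono) auto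
    then have "2 * M * ((b - a)\<^sup>2 * energy a b g) \<le> 2 * M * ((2 * e)\<^sup>2 * energy a b g)"
      using assms(5) energy_nonneg by (intro mult_left_mono mult_right_mono) auto
    ultimately show ?thesis by (simp add: algebra_simps power2_eq_square)
  qed
  \<comment> \<open>\<open>n\<close> bounds the number of cuts; the \<open>+ 2\<close> makes
    \<open>n = 0\<close> the case of a single piece shorter than \<open>2 * e\<close>.\<close>
  obtain n where "(b - a) / e < real n" using reals_Archimedean2 by blast
  then have "b - a < (real n + 2) * e" using assms(6) by (simp add: field_simps)
  then show ?thesis
    using assms(1,2,3,7,8)
  proof (induction n arbitrary: a)
    case 0
    then show ?case by (intro short) auto
  next
    case (Suc n)
    note s = Suc.prems(2) and pi = Suc.prems(3)
    show ?case
    proof (cases "b - a \<le> 2 * e")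
      case True
      then show ?thesis using Suc.prems by (intro short) auto
    next
      case False
      define m where "m = a + e"
      have m: "a < m" "m < b" "e \<le> b - m" using False assms(6) by (auto simp: m_def)
      have a0: "0 \<le> a" and um: "u \<in> borel_measurable \<L>" and gm: "g \<in> borel_measurable \<L>"
        and gi: "set_integrable \<L> {a<..<b} (\<lambda>x. (norm (g x))\<^sup>2)"
        using s by (auto simp: seg_def)
      have s1: "seg a m u g" "seg m b u g" using seg_sub[OF s] m by auto
      have p1: "set_integrable \<L> {a<..<m} p" "set_integrable \<L> {m<..<b} p"
        using m a0 by (auto intro!: set_integrable_subset[OF pi] Leb.Ioo_sets')
      have 1: "M * (LINT x:{a<..<m}|\<L>. (norm (u x))\<^sup>2) - 8 * M * e\<^sup>2 * energy a m g
          \<le> (LINT x:{a<..<m}|\<L>. p x * (norm (u x))\<^sup>2)"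
        by (rule short[OF s1(1) p1(1)]) (use Suc.prems m assms(6) in \<open>auto simp: m_def\<close>)
      have 2: "M * (LINT x:{m<..<b}|\<L>. (norm (u x))\<^sup>2) - 8 * M * e\<^sup>2 * energy m b g
          \<le> (LINT x:{m<..<b}|\<L>. p x * (norm (u x))\<^sup>2)"
        by (rule Suc.IH[OF _ s1(2) p1(2)]) (use Suc.prems m in \<open>auto simp: m_def algebra_simps\<close>)
      have "energy a b g = energy a m g + energy m b g"
        unfolding energy_def by (rule Leb_Ioo_split[OF gi a0 m(1,2)]) (use gm in measurable)
      moreover have "(LINT x:{a<..<b}|\<L>. (norm (u x))\<^sup>2) = (LINT x:{a<..<m}|\<L>. (norm (u x))\<^sup>2) + (LINT x:{m<..<b}|\<L>. (norm (u x))\<^sup>2)"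
        by (rule Leb_Ioo_split[OF seg_sq_integrable[OF s] a0 m(1,2)]) (use um in measurable)
      moreover have "(LINT x:{a<..<b}|\<L>. p x * (norm (u x))\<^sup>2) = (LINT x:{a<..<m}|\<L>. p x * (norm (u x))\<^sup>2) + (LINT x:{m<..<b}|\<L>. p x * (norm (u x))\<^sup>2)"
        by (rule Leb_Ioo_split[OF seg_weight_integrable[OF s pi] a0 m(1,2)]) (use um assms(4) in measurable)
      ultimately show ?thesis using 1 2 by (simp add: algebra_simps)
    qed
  qed
qed

section \<open>Coercivity of the form\<close>

locale gaps = sturm_liouville \<nu> q for \<nu> q +
  fixes \<Delta> :: "nat \<Rightarrow> real set"
  assumes supp_unbounded: "\<not> bounded (measure_support \<nu>)"
    and supp_null: "measure_support \<nu> \<in> null_sets lborel"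
    and gap_bij: "bij_betw \<Delta> UNIV (components ({0<..} - measure_support \<nu>))"
    and length_bdd: "bdd_above (range (\<lambda>k. measure lborel (\<Delta> k)))"
    and neg_bdd: "bdd_above (range (\<lambda>k. 1 / measure lborel (\<Delta> k) * (LINT x:\<Delta> k|lborel. (\<bar>q x\<bar> - q x) / 2)))"
    and window_lim: "\<And>e. e > 0 \<Longrightarrow> filterlim (\<lambda>x. LINT t:{x..x + e}|lborel. q t) at_top at_top"
    and mean_lim: "filterlim (\<lambda>k. 1 / measure lborel (\<Delta> k) * (LINT x:\<Delta> k|lborel. q x)) at_top sequentially"
begin

section \<open>Geometry of the support and its gaps\<close>

abbreviation "supp \<equiv> measure_support \<nu>"

lemma space_nu: "space \<nu> = {0<..}"
  using sets_eq_imp_space_eq[OF sets_nu] by simp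

lemma supp_pos: "supp \<subseteq> {0<..}"
  by (auto simp: measure_support_def space_nu)

text \<open>The complement is a union of open null sets, possibly uncountably many; Lindelof's
  theorem selects countably many of them.\<close>

lemma complement_supp: "open ({0<..} - supp)" "emeasure \<nu> ({0<..} - supp) = 0"
proof -
  define F where "F = {U. open U \<and> emeasure \<nu> (U \<inter> {0<..}) = 0}"
  have eq: "{0<..} - supp = \<Union>F \<inter> {0<..}"
    by (auto simp: F_def measure_support_def space_nu)
  have op: "open U" if "U \<in> F" for U using that by (simp add: F_def)
  show "open ({0<..} - supp)"
    unfolding eq using op by (intro open_Int open_Union) auto
  obtain F' where F': "F' \<subseteq> F" "countable F'" "\<Union>F' = \<Union>F"
    using Lindelof[OF op] by blast
  have "(\<Union>U\<in>F'. U \<inter> {0<..}) \<in> null_sets \<nu>"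
  proof (rule null_sets_UN'[OF F'(2)])
    fix U assume "U \<in> F'"
    then have "U \<in> F" using F' by auto
    then show "U \<inter> {0<..} \<in> null_sets \<nu>"
      by (auto simp: F_def sets_nu Leb.sets_M_iff)
  qed
  moreover have "(\<Union>U\<in>F'. U \<inter> {0<..}) = {0<..} - supp" unfolding eq F'(3)[symmetric] by auto
  ultimately show "emeasure \<nu> ({0<..} - supp) = 0" by auto
qed

lemma supp_cofinal: "\<exists>c\<in>supp. x < c"
proof (rule ccontr)
  assume "\<not> ?thesis"
  then have "supp \<subseteq> {0..x}" using supp_pos by fastforce
  then have "bounded supp" using bounded_subset bounded_closed_interval by blast
  then show False using supp_unbounded by simp
qed

lemma gap_component: "\<Delta> k \<in> components ({0<..} - supp)"
  using bij_betw_apply[OF gap_bij] by simp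

lemma gap_subset: "\<Delta> k \<subseteq> {0<..} - supp"
  using gap_component in_components_subset by blast

lemma UN_gaps: "(\<Union>k. \<Delta> k) = {0<..} - supp"
  using bij_betw_imp_surj_on[OF gap_bij] Union_components[of "{0<..} - supp"] by simp

lemma gap_disjoint: "disjoint_family \<Delta>"
  unfolding disjoint_family_on_def
proof (intro ballI impI)
  fix m n :: nat assume "m \<noteq> n"
  then have "\<Delta> m \<noteq> \<Delta> n" using bij_betw_imp_inj_on[OF gap_bij] by (auto dest: injD)
  then show "\<Delta> m \<inter> \<Delta> n = {}"
    using components_nonoverlap[OF gap_component gap_component] by blast
qed

text \<open>A connected set with points on both sides of \<open>c\<close> would contain
  \<open>c\<close>. This is why truncation at support points never cuts a gap.\<close>

lemma gap_below:
  assumes "c \<in> supp" "x \<in> \<Delta> k" "x < c"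
  shows "\<Delta> k \<subseteq> {0<..<c}"
proof
  fix y assume y: "y \<in> \<Delta> k"
  have "\<not> c \<le> y"
  proof
    assume "c \<le> y"
    then have "c \<in> \<Delta> k"
      using connectedD_interval[OF in_components_connected[OF gap_component] assms(2) y, of c] assms(3) by simp
    then show False using gap_subset assms(1) by blast
  qed
  then show "y \<in> {0<..<c}" using gap_subset y by force
qed

definition gap_left :: "nat \<Rightarrow> real" where "gap_left k = Inf (\<Delta> k)"
definition gap_right :: "nat \<Rightarrow> real" where "gap_right k = Sup (\<Delta> k)"

text \<open>Boundedness comes from a support point to the right of the gap, and openness excludes
  the infimum and the supremum.\<close>

lemma gap_interval: "\<Delta> k = {gap_left k<..<gap_right k}" "0 \<le> gap_left k" "gap_left k < gap_right k"
proof -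
  have ne: "\<Delta> k \<noteq> {}" using gap_component in_components_nonempty by blast
  then obtain x where x: "x \<in> \<Delta> k" by blast
  obtain c where c: "c \<in> supp" "x < c" using supp_cofinal by blast
  have sub: "\<Delta> k \<subseteq> {0<..<c}" by (rule gap_below[OF c(1) x c(2)])
  have bb: "bdd_below (\<Delta> k)" by (rule bdd_belowI[of _ 0]) (use sub in force)
  have ba: "bdd_above (\<Delta> k)" by (rule bdd_aboveI[of _ c]) (use sub in force)
  have op: "open (\<Delta> k)" using open_components[OF complement_supp(1) gap_component] .
  show eq: "\<Delta> k = {gap_left k<..<gap_right k}"
  proof (intro equalityI subsetI)
    fix y assume y: "y \<in> \<Delta> k"
    obtain e where e: "0 < e" "cball y e \<subseteq> \<Delta> k" using op y open_contains_cball by blast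
    then have "y - e \<in> \<Delta> k" "y + e \<in> \<Delta> k" by (auto simp: cball_def dist_real_def subset_eq)
    then have "gap_left k \<le> y - e" "y + e \<le> gap_right k"
      unfolding gap_left_def gap_right_def using bb ba by (auto intro: cInf_lower cSup_upper)
    then show "y \<in> {gap_left k<..<gap_right k}" using e by simp
  next
    fix y assume "y \<in> {gap_left k<..<gap_right k}"
    then obtain s t where "s \<in> \<Delta> k" "s < y" "t \<in> \<Delta> k" "y < t"
      unfolding gap_left_def gap_right_def using cInf_lessD[OF ne, of y] less_cSupD[OF ne, of y] by auto
    then show "y \<in> \<Delta> k"
      using connectedD_interval[OF in_components_connected[OF gap_component], of s k t y] by simp
  qed
  show "gap_left k < gap_right k" using x eq by force
  show "0 \<le> gap_left k" unfolding gap_left_def using sub ne by (intro cInf_greatest) force+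
qed

lemma gap_length: "measure lborel (\<Delta> k) = gap_right k - gap_left k"
  using gap_interval[of k] by simp

lemma gap_Leb: "(LINT x:\<Delta> k|lborel. f x) = (LINT x:{gap_left k<..<gap_right k}|\<L>. f x)"
  for f :: "real \<Rightarrow> real"
proof -
  have "\<Delta> k \<subseteq> {0<..}" using gap_subset by blast
  from Leb_set_integral[OF this, of f] show ?thesis by (simp add: gap_interval(1)[symmetric])
qed

lemma P_eq_Leb_in_gap:
  fixes g :: "real \<Rightarrow> 'b::{banach,second_countable_topology}"
  assumes A: "A \<subseteq> {0<..} - supp" "A \<in> sets \<L>" and g: "g \<in> borel_measurable \<L>"
  shows "(LINT t:A|P. g t) = (LINT t:A|\<L>. g t)"
proof -
  have S: "A \<inter> space P \<in> sets P" "A \<inter> space \<L> \<in> sets \<L>" using A by auto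
  have "restrict_space P A = restrict_space \<L> A"
  proof (rule measure_eqI)
    show s: "sets (restrict_space P A) = sets (restrict_space \<L> A)"
      by (simp add: sets_restrict_space)
    fix B assume "B \<in> sets (restrict_space P A)"
    then have B: "B \<in> sets \<L>" "B \<subseteq> A"
      using A sets_restrict_space_iff[of A P B] S by auto
    have "{0<..} - supp \<in> sets \<nu>"
      unfolding sets_nu Leb.sets_M_iff using complement_supp(1) by auto
    then have "emeasure \<nu> B \<le> emeasure \<nu> ({0<..} - supp)"
      using A B by (intro emeasure_mono) auto
    then have "emeasure P B = emeasure \<L> B"
      using complement_supp(2) by (simp add: emeasure_P B)
    then show "emeasure (restrict_space P A) B = emeasure (restrict_space \<L> A) B"
      using B S by (simp add: emeasure_restrict_space)
  qed
  then show ?thesis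
    unfolding set_lebesgue_integral_def
    using integral_restrict_space[OF S(1), of g] integral_restrict_space[OF S(2), of g] by simp
qed

lemma set_integral_nonneg_UN:
  fixes f :: "real \<Rightarrow> real"
  assumes "\<And>i::nat. A i \<in> sets M" "disjoint_family A" "set_integrable M (\<Union>i. A i) f"
    and nn: "\<And>i. 0 \<le> (LINT x:A i|M. f x)"
  shows "0 \<le> (LINT x:(\<Union>i. A i)|M. f x)"
proof -
  define B where "B n = (\<Union>i<n. A i)" for n
  have UB: "(\<Union>n. B n) = (\<Union>i. A i)" by (auto simp: B_def)
  have "(\<lambda>n. LINT x:B n|M. f x) \<longlonglongrightarrow> (LINT x:(\<Union>n. B n)|M. f x)"
  proof (rule set_integral_cont_up)
    show "B n \<in> sets M" for n using assms(1) by (auto simp: B_def)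
    show "incseq B" unfolding B_def incseq_def by fastforce
  qed (simp add: UB assms(3))
  moreover have "0 \<le> (LINT x:B n|M. f x)" for n
  proof -
    have "(LINT x:B n|M. f x) = (\<Sum>i<n. LINT x:A i|M. f x)"
      unfolding B_def
      using assms(1,2) by (intro set_integral_finite_Union set_integrable_subset[OF assms(3,1)])
        (auto simp: disjoint_family_on_def)
    then show ?thesis by (simp add: sum_nonneg nn)
  qed
  ultimately show ?thesis unfolding UB by (intro LIMSEQ_le_const) auto
qed

section \<open>Estimates on whole gaps and their sum\<close>

definition qp :: "real \<Rightarrow> real" where "qp x = (\<bar>q x\<bar> + q x) / 2"
definition qm :: "real \<Rightarrow> real" where "qm x = (\<bar>q x\<bar> - q x) / 2"

lemma q_split: "q x = qp x - qm x" and qp_nonneg: "0 \<le> qp x" and qm_nonneg: "0 \<le> qm x" and q_le_qp: "q x \<le> qp x"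
  by (simp_all add: qp_def qm_def field_simps)

lemma q_int: "0 \<le> a \<Longrightarrow> set_integrable \<L> {a<..<b} q"
  by (rule Leb.set_integrable_Ioo_subset[OF q_loc Leb.Ioo_sets']) auto

lemma qp_int: "0 \<le> a \<Longrightarrow> set_integrable \<L> {a<..<b} qp"
  and qm_int: "0 \<le> a \<Longrightarrow> set_integrable \<L> {a<..<b} qm"
  using q_int[of a b] unfolding qp_def qm_def
  by (auto intro!: set_integral_add(1) set_integral_diff(1) set_integrable_abs set_integrable_divide)

lemma qp_measurable: "qp \<in> borel_measurable \<L>"
  unfolding qp_def using q_measurable by measurable

lemma gap_length_bound: "\<exists>D\<ge>1. \<forall>k. gap_right k - gap_left k \<le> D"
proof -
  obtain D where "\<And>k. measure lborel (\<Delta> k) \<le> D"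
    using length_bdd by (auto simp: bdd_above_def)
  then show ?thesis unfolding gap_length by (intro exI[of _ "max 1 D"]) (simp add: le_max_iff_disj)
qed

text \<open>One constant serves all gaps because the lengths and the means of \<open>qm\<close> are
  bounded uniformly in \<open>k\<close>.\<close>

lemma gap_lower: "\<exists>C\<ge>0. \<forall>k u g. seg (gap_left k) (gap_right k) u g \<longrightarrow>
  (LINT x:{gap_left k<..<gap_right k}|\<L>. qm x * (norm (u x))\<^sup>2) \<le>
    (1/4) * energy (gap_left k) (gap_right k) g + C * (LINT x:{gap_left k<..<gap_right k}|\<L>. (norm (u x))\<^sup>2)"
proof -
  obtain D where D: "1 \<le> D" "\<And>k. gap_right k - gap_left k \<le> D" using gap_length_bound by blast
  obtain K0 where K0: "\<And>k. 1 / measure lborel (\<Delta> k) * (LINT x:\<Delta> k|lborel. qm x) \<le> K0"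
    using neg_bdd by (auto simp: bdd_above_def qm_def)
  define K where "K = max 1 K0"
  have K: "(LINT x:{gap_left k<..<gap_right k}|\<L>. qm x) \<le> K * (gap_right k - gap_left k)" for k
  proof -
    have "1 / (gap_right k - gap_left k) * (LINT x:{gap_left k<..<gap_right k}|\<L>. qm x) \<le> K"
      using K0[of k] by (simp add: gap_Leb gap_length K_def)
    then show ?thesis using gap_interval(3)[of k] by (simp add: field_simps)
  qed
  show ?thesis
  proof (intro exI[of _ "16 * K\<^sup>2 * D\<^sup>2"] conjI allI impI)
    fix k u g assume "seg (gap_left k) (gap_right k) u g"
    then show "(LINT x:{gap_left k<..<gap_right k}|\<L>. qm x * (norm (u x))\<^sup>2) \<le>
      (1/4) * energy (gap_left k) (gap_right k) g + 16 * K\<^sup>2 * D\<^sup>2 * (LINT x:{gap_left k<..<gap_right k}|\<L>. (norm (u x))\<^sup>2)"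
      by (rule seg_neg_bound[OF _ qm_int[OF gap_interval(2)] qm_nonneg K _ D(2,1)]) (simp add: K_def)
  qed simp
qed

lemma window_integral:
  assumes "0 \<le> x"
  shows "(LINT t:{x..x + e}|lborel. q t) = (LINT t:{x<..<x + e}|\<L>. q t)"
proof -
  have "(LINT t:{x..x + e}|lborel. q t) = (LINT t:{x<..<x + e}|lborel. q t)"
    by (rule set_integral_discrete_difference[where X="{x, x + e}"]) auto
  also have "\<dots> = (LINT t:{x<..<x + e}|\<L>. q t)"
    by (rule Leb_set_integral[symmetric]) (use assms in auto)
  finally show ?thesis .
qed

text \<open>A gap of length at least \<open>e\<close> is handled by the window condition, a shorter
  one by the mean of \<open>q\<close> over it.\<close>

lemma gap_tail: "\<exists>N. \<forall>k u g. seg (gap_left k) (gap_right k) u g \<longrightarrow> N < gap_right k \<longrightarrow>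
  M * (LINT x:{gap_left k<..<gap_right k}|\<L>. (norm (u x))\<^sup>2) - (1/4) * energy (gap_left k) (gap_right k) g \<le>
    (LINT x:{gap_left k<..<gap_right k}|\<L>. qp x * (norm (u x))\<^sup>2)"
proof -
  obtain D where D: "1 \<le> D" "\<And>k. gap_right k - gap_left k \<le> D" using gap_length_bound by blast
  define M1 where "M1 = max M 1"
  \<comment> \<open>Makes \<open>8 * M1 * e\<^sup>2\<close> equal to \<open>8 / (36 * M1)\<close>,
    hence at most a quarter; \<open>M1 \<ge> 1\<close> also covers negative
    \<open>M\<close>.\<close>
  define e where "e = 1 / (6 * M1)"
  have M1: "1 \<le> M1" "M \<le> M1" by (auto simp: M1_def)
  then have e: "0 < e" by (simp add: e_def)
  have "8 * M1 * e\<^sup>2 = 8 / (36 * M1)" using M1 by (simp add: e_def power2_eq_square field_simps)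
  also have "\<dots> \<le> 8 / 36" using M1 by (intro divide_left_mono) auto
  finally have e2: "8 * M1 * e\<^sup>2 \<le> 1/4" by simp
  have "eventually (\<lambda>x. 4 * M1 * e \<le> (LINT t:{x..x + e}|lborel. q t)) at_top"
    using window_lim[OF e] by (simp add: filterlim_at_top)
  then obtain N0 where N0: "\<And>x. N0 \<le> x \<Longrightarrow> 4 * M1 * e \<le> (LINT t:{x..x + e}|lborel. q t)"
    by (auto simp: eventually_at_top_linorder)
  have "eventually (\<lambda>k. 2 * M1 \<le> 1 / measure lborel (\<Delta> k) * (LINT x:\<Delta> k|lborel. q x)) sequentially"
    using mean_lim by (simp add: filterlim_at_top)
  then obtain k0 where k0: "\<And>k. k0 \<le> k \<Longrightarrow> 2 * M1 \<le> 1 / measure lborel (\<Delta> k) * (LINT x:\<Delta> k|lborel. q x)"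
    by (auto simp: eventually_sequentially)
  \<comment> \<open>The gaps are enumerated in no particular order, so the mean condition fails to
    apply only to finitely many indices, and \<open>N\<close> lies to the right of all those gaps.
    The summand \<open>D\<close> ensures that a gap reaching beyond \<open>N\<close> starts beyond
    \<open>N0\<close>.\<close>
  define N where "N = Max (insert (N0 + D) (gap_right ` {..<k0}))"
  have N: "N0 + D \<le> N" "\<And>k. k < k0 \<Longrightarrow> gap_right k \<le> N"
    unfolding N_def by (auto intro!: Max_ge)
  show ?thesis
  proof (intro exI[of _ N] allI impI)
    fix k u g assume s: "seg (gap_left k) (gap_right k) u g" and k: "N < gap_right k"
    define U where "U = (LINT x:{gap_left k<..<gap_right k}|\<L>. (norm (u x))\<^sup>2)"
    define E where "E = energy (gap_left k) (gap_right k) g"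
    have nn: "0 \<le> U" "0 \<le> E" by (simp_all add: U_def E_def energy_nonneg set_lebesgue_integral_def)
    have MU: "M * U \<le> M1 * U" using M1 nn by (intro mult_right_mono) auto
    have kk: "k0 \<le> k" using N(2)[of k] k by force
    have ak: "N0 \<le> gap_left k" using N(1) k D(2)[of k] by linarith
    note a0 = gap_interval(2)[of k] and ab = gap_interval(3)[of k]
    show "M * (LINT x:{gap_left k<..<gap_right k}|\<L>. (norm (u x))\<^sup>2) - (1/4) * energy (gap_left k) (gap_right k) g \<le>
      (LINT x:{gap_left k<..<gap_right k}|\<L>. qp x * (norm (u x))\<^sup>2)"
    proof (cases "e \<le> gap_right k - gap_left k")
      case True
      have "M1 * U - 8 * M1 * e\<^sup>2 * E \<le> (LINT x:{gap_left k<..<gap_right k}|\<L>. qp x * (norm (u x))\<^sup>2)"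
        unfolding U_def E_def
      proof (rule seg_pos_bound[OF s qp_int[OF a0] qp_nonneg qp_measurable _ e True])
        fix x assume x: "gap_left k \<le> x"
        then have "4 * M1 * e \<le> (LINT t:{x..x + e}|lborel. q t)" using ak by (intro N0) simp
        also have "\<dots> = (LINT t:{x<..<x + e}|\<L>. q t)" by (rule window_integral) (use x a0 in simp)
        also have "\<dots> \<le> (LINT t:{x<..<x + e}|\<L>. qp t)"
          by (intro set_integral_mono q_int qp_int q_le_qp) (use x a0 in auto)
        finally show "4 * M1 * e \<le> (LINT t:{x<..<x + e}|\<L>. qp t)" .
      qed (use M1 in simp)
      moreover have "8 * M1 * e\<^sup>2 * E \<le> 1/4 * E" using e2 nn by (intro mult_right_mono) auto
      ultimately show ?thesis using MU unfolding U_def[symmetric] E_def[symmetric] by linarith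
    next
      case False
      have "2 * M1 \<le> 1 / (gap_right k - gap_left k) * (LINT x:{gap_left k<..<gap_right k}|\<L>. q x)"
        using k0[OF kk] by (simp add: gap_Leb gap_length)
      then have "2 * M1 * (gap_right k - gap_left k) \<le> (LINT x:{gap_left k<..<gap_right k}|\<L>. q x)"
        using ab by (simp add: field_simps)
      also have "\<dots> \<le> (LINT x:{gap_left k<..<gap_right k}|\<L>. qp x)"
        by (intro set_integral_mono q_int qp_int q_le_qp a0)
      finally have *: "2 * M1 * ((1/2) * U - (gap_right k - gap_left k)\<^sup>2 * E) \<le> (LINT x:{gap_left k<..<gap_right k}|\<L>. qp x * (norm (u x))\<^sup>2)"
        unfolding U_def E_def using M1
        by (intro seg_weight_lower[OF s qp_int[OF a0] qp_nonneg]) auto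
      have "(gap_right k - gap_left k)\<^sup>2 \<le> e\<^sup>2" using False ab by (intro power_mono) auto
      then have "2 * M1 * ((gap_right k - gap_left k)\<^sup>2 * E) \<le> 2 * M1 * (e\<^sup>2 * E)"
        using nn M1 by (intro mult_left_mono mult_right_mono) auto
      also have "\<dots> \<le> 8 * M1 * e\<^sup>2 * E"
        using nn M1 by (simp add: mult_right_mono)
      also have "\<dots> \<le> 1/4 * E" using e2 nn by (intro mult_right_mono) auto
      finally have "2 * M1 * ((gap_right k - gap_left k)\<^sup>2 * E) \<le> 1/4 * E" .
      moreover have "2 * M1 * ((1/2) * U - (gap_right k - gap_left k)\<^sup>2 * E) = M1 * U - 2 * M1 * ((gap_right k - gap_left k)\<^sup>2 * E)"
        by (simp add: algebra_simps)
      ultimately show ?thesis using * MU unfolding U_def[symmetric] E_def[symmetric] by linarith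
    qed
  qed
qed

text \<open>Integrand of the shifted form minus the gain in the tail. Of the half energy, one
  quarter pays for \<open>qm\<close> and one quarter for the tail estimate.\<close>

definition form_density :: "real \<Rightarrow> real \<Rightarrow> real \<Rightarrow> (real \<Rightarrow> complex) \<Rightarrow> (real \<Rightarrow> complex) \<Rightarrow> real \<Rightarrow> real" where
  "form_density C M N u g x = (1/2) * (norm (g x))\<^sup>2 + q x * (norm (u x))\<^sup>2 + C * (norm (u x))\<^sup>2
     - M * (indicator {N<..} x * (norm (u x))\<^sup>2)"

text \<open>The order of the quantifiers is essential: \<open>C\<close> must not depend on
  \<open>M\<close>, since it determines \<open>lam\<close>, whereas \<open>M\<close> is later taken
  large at fixed \<open>lam\<close>.\<close>

lemma coercive: "\<exists>C\<ge>0. \<forall>M\<ge>0. \<exists>N\<ge>0. \<forall>c u g. c \<in> supp \<longrightarrow>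
   (\<forall>k. \<Delta> k \<subseteq> {0<..<c} \<longrightarrow> seg (gap_left k) (gap_right k) u g) \<longrightarrow>
   set_integrable \<L> {0<..<c} (form_density C M N u g) \<longrightarrow>
   0 \<le> (LINT x:{0<..<c}|\<L>. form_density C M N u g x)"
proof -
  obtain C where C: "0 \<le> C" "\<And>k u g. seg (gap_left k) (gap_right k) u g \<Longrightarrow>
    (LINT x:{gap_left k<..<gap_right k}|\<L>. qm x * (norm (u x))\<^sup>2) \<le>
    (1/4) * energy (gap_left k) (gap_right k) g + C * (LINT x:{gap_left k<..<gap_right k}|\<L>. (norm (u x))\<^sup>2)"
    using gap_lower by blast
  have gap: "0 \<le> (LINT x:\<Delta> k|\<L>. form_density C M N u g x)"
    if M: "0 \<le> M" and N: "\<And>k u g. seg (gap_left k) (gap_right k) u g \<Longrightarrow> N < gap_right k \<Longrightarrow>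
      M * (LINT x:{gap_left k<..<gap_right k}|\<L>. (norm (u x))\<^sup>2) - (1/4) * energy (gap_left k) (gap_right k) g \<le>
      (LINT x:{gap_left k<..<gap_right k}|\<L>. qp x * (norm (u x))\<^sup>2)"
      and s: "seg (gap_left k) (gap_right k) u g" for M N k u g
  proof -
    define I where "I = {gap_left k<..<gap_right k}"
    \<comment> \<open>A gap reaching beyond \<open>N\<close> is credited with \<open>M\<close> times
      its whole mass, which covers the part beyond \<open>N\<close>; any other gap has nothing to
      pay for.\<close>
    define m where "m = (if N < gap_right k then M else 0)"
    define U where "U = (LINT x:I|\<L>. (norm (u x))\<^sup>2)"
    note a0 = gap_interval(2)[of k]
    have gi: "set_integrable \<L> I (\<lambda>x. (norm (g x))\<^sup>2)" and um: "u \<in> borel_measurable \<L>"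
      using s by (simp_all add: seg_def I_def)
    have ui: "set_integrable \<L> I (\<lambda>x. (norm (u x))\<^sup>2)" unfolding I_def by (rule seg_sq_integrable[OF s])
    have qpi: "set_integrable \<L> I (\<lambda>x. qp x * (norm (u x))\<^sup>2)" and qmi: "set_integrable \<L> I (\<lambda>x. qm x * (norm (u x))\<^sup>2)"
      unfolding I_def by (intro seg_weight_integrable[OF s] qp_int qm_int a0)+
    have Is: "I \<in> sets \<L>" unfolding I_def by (rule Leb.Ioo_sets'[OF a0])
    have ini: "set_integrable \<L> I (\<lambda>x. indicator {N<..} x * (norm (u x))\<^sup>2)"
    proof (rule set_integrable_bound[OF ui _ AE_I2])
      show "set_borel_measurable \<L> I (\<lambda>x. indicator {N<..} x * (norm (u x))\<^sup>2)"
      proof -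
        have [measurable]: "indicat_real {N<..} \<in> borel_measurable \<L>"
          by (rule Leb.borel_imp_M) simp
        show ?thesis
          unfolding set_borel_measurable_def using um Is by simp
      qed
    qed (auto simp: indicator_def)
    have "(LINT x:I|\<L>. form_density C M N u g x) =
      (1/2) * (LINT x:I|\<L>. (norm (g x))\<^sup>2) + ((LINT x:I|\<L>. qp x * (norm (u x))\<^sup>2)
       - (LINT x:I|\<L>. qm x * (norm (u x))\<^sup>2)) + C * U
       - M * (LINT x:I|\<L>. indicator {N<..} x * (norm (u x))\<^sup>2)"
    proof -
      have 1: "set_integrable \<L> I (\<lambda>x. (1/2) * (norm (g x))\<^sup>2)" "set_integrable \<L> I (\<lambda>x. C * (norm (u x))\<^sup>2)"
        "set_integrable \<L> I (\<lambda>x. M * (indicator {N<..} x * (norm (u x))\<^sup>2))"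
        by (rule set_integrable_mult_right, rule gi ui ini)+
      note 2 = set_integral_diff[OF qpi qmi]
      note 3 = set_integral_add[OF 1(1) 2(1)]
      note 4 = set_integral_add[OF 3(1) 1(2)]
      have "form_density C M N u g = (\<lambda>x. (1/2) * (norm (g x))\<^sup>2 + (qp x * (norm (u x))\<^sup>2 - qm x * (norm (u x))\<^sup>2)
          + C * (norm (u x))\<^sup>2 - M * (indicator {N<..} x * (norm (u x))\<^sup>2))"
        unfolding form_density_def by (rule ext) (simp add: q_split left_diff_distrib)
      then show ?thesis
        unfolding U_def
        by (simp only: set_integral_diff(2)[OF 4(1) 1(3)] 4(2) 3(2) 2(2) set_integral_mult_right)
    qed
    moreover have "M * (LINT x:I|\<L>. indicator {N<..} x * (norm (u x))\<^sup>2) \<le> m * U"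
    proof (cases "N < gap_right k")
      case True
      have "(LINT x:I|\<L>. indicator {N<..} x * (norm (u x))\<^sup>2) \<le> U"
        unfolding U_def by (rule set_integral_mono[OF ini ui]) (auto simp: indicator_def)
      then show ?thesis using M True by (simp add: m_def mult_left_mono)
    next
      case False
      have "(LINT x:I|\<L>. indicator {N<..} x * (norm (u x))\<^sup>2) = (LINT x:I|\<L>. 0)"
        by (rule set_lebesgue_integral_cong[OF Is]) (use False in \<open>auto simp: I_def indicator_def\<close>)
      then show ?thesis using False by (simp add: m_def)
    qed
    moreover have "m * U - (1/4) * (LINT x:I|\<L>. (norm (g x))\<^sup>2) \<le> (LINT x:I|\<L>. qp x * (norm (u x))\<^sup>2)"
    proof (cases "N < gap_right k")
      case True
      then show ?thesis using N[OF s] by (simp add: m_def U_def I_def energy_def)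
    next
      case False
      have "0 \<le> (LINT x:I|\<L>. qp x * (norm (u x))\<^sup>2)"
        by (simp add: set_lebesgue_integral_def qp_nonneg)
      then show ?thesis using False energy_nonneg[of "gap_left k" "gap_right k" g]
        by (simp add: m_def I_def energy_def)
    qed
    moreover have "(LINT x:I|\<L>. qm x * (norm (u x))\<^sup>2) \<le> (1/4) * (LINT x:I|\<L>. (norm (g x))\<^sup>2) + C * U"
      using C(2)[OF s] by (simp add: I_def U_def energy_def)
    ultimately show ?thesis unfolding gap_interval(1) I_def[symmetric] by linarith
  qed
  show ?thesis
  proof (rule exI[of _ C], intro conjI allI impI C(1))
    fix M :: real assume M: "0 \<le> M"
    obtain N0 where N0: "\<And>k u g. seg (gap_left k) (gap_right k) u g \<Longrightarrow> N0 < gap_right k \<Longrightarrow>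
      M * (LINT x:{gap_left k<..<gap_right k}|\<L>. (norm (u x))\<^sup>2) - (1/4) * energy (gap_left k) (gap_right k) g \<le>
      (LINT x:{gap_left k<..<gap_right k}|\<L>. qp x * (norm (u x))\<^sup>2)"
      using gap_tail[of M] by blast
    define N where "N = max 0 N0"
    show "\<exists>N\<ge>0. \<forall>c u g. c \<in> supp \<longrightarrow>
      (\<forall>k. \<Delta> k \<subseteq> {0<..<c} \<longrightarrow> seg (gap_left k) (gap_right k) u g) \<longrightarrow>
      set_integrable \<L> {0<..<c} (form_density C M N u g) \<longrightarrow>
      0 \<le> (LINT x:{0<..<c}|\<L>. form_density C M N u g x)"
    proof (intro exI[of _ N] conjI allI impI)
      fix c u g
      assume c: "c \<in> supp" and s: "\<forall>k. \<Delta> k \<subseteq> {0<..<c} \<longrightarrow> seg (gap_left k) (gap_right k) u g"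
        and i: "set_integrable \<L> {0<..<c} (form_density C M N u g)"
      \<comment> \<open>Each \<open>A k\<close> is a whole gap or empty, since \<open>c\<close> lies
        in the support.\<close>
      define A where "A k = \<Delta> k \<inter> {0<..<c}" for k
      have Acase: "A k = \<Delta> k \<and> \<Delta> k \<subseteq> {0<..<c} \<or> A k = {}" for k
        using gap_below[OF c, of _ k] unfolding A_def by fastforce
      have AS: "A k \<in> sets \<L>" for k
        using sets.Int[OF Leb.Ioo_sets'[OF gap_interval(2)[of k]] Leb.Ioo_sets[of c], of "gap_right k"]
        by (simp add: A_def gap_interval(1)[symmetric])
      have UA: "(\<Union>k. A k) = {0<..<c} - supp"
        using UN_gaps unfolding A_def by auto
      have supp_set: "supp \<in> sets \<L>"
        using supp_null supp_pos by (auto simp: Leb.sets_M_iff)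
      have "0 \<le> (LINT x:(\<Union>k. A k)|\<L>. form_density C M N u g x)"
      proof (rule set_integral_nonneg_UN[OF AS])
        show "disjoint_family A"
          using gap_disjoint unfolding A_def disjoint_family_on_def by blast
        show "set_integrable \<L> (\<Union>k. A k) (form_density C M N u g)"
          by (rule set_integrable_subset[OF i sets.countable_UN']) (use AS UA in auto)
        show "0 \<le> (LINT x:A k|\<L>. form_density C M N u g x)" for k
          using Acase[of k]
        proof
          assume k: "A k = \<Delta> k \<and> \<Delta> k \<subseteq> {0<..<c}"
          have "0 \<le> (LINT x:\<Delta> k|\<L>. form_density C M N u g x)"
            by (rule gap[OF M]) (use N0 s k in \<open>auto simp: N_def\<close>)
          then show ?thesis using k by simp
        qed simp
      qed
      \<comment> \<open>The gaps fill \<open>(0,c)\<close> up to the support, which is a Lebesgue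
        null set.\<close>
      also have "(LINT x:(\<Union>k. A k)|\<L>. form_density C M N u g x) = (LINT x:{0<..<c}|\<L>. form_density C M N u g x)"
      proof (rule set_integral_cong_set)
        show "set_borel_measurable \<L> {0<..<c} (form_density C M N u g)"
          using i unfolding set_integrable_def set_borel_measurable_def by auto
        have "set_integrable \<L> (\<Union>k. A k) (form_density C M N u g)"
          by (rule set_integrable_subset[OF i sets.countable_UN']) (use AS UA in auto)
        then show "set_borel_measurable \<L> (\<Union>k. A k) (form_density C M N u g)"
          unfolding set_integrable_def set_borel_measurable_def by auto
        have "supp \<in> null_sets \<L>"
          using supp_null supp_set Leb_emeasure[OF supp_set] by (simp add: null_sets_def)
        from AE_not_in[OF this] show "AE x in \<L>. x \<in> {0<..<c} \<longleftrightarrow> x \<in> (\<Union>k. A k)"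
          unfolding UA by eventually_elim auto
      qed
      finally show "0 \<le> (LINT x:{0<..<c}|\<L>. form_density C M N u g x)" .
    qed (simp add: N_def)
  qed
qed

end

section \<open>Green's identity and the Neumann solution\<close>

lemma set_integral_Re:
  fixes f :: "real \<Rightarrow> complex"
  assumes "set_integrable M A f"
  shows "Re (LINT x:A|M. f x) = (LINT x:A|M. Re (f x))" "set_integrable M A (\<lambda>x. Re (f x))"
proof -
  have "(\<lambda>x. Re (indicator A x *\<^sub>R f x)) = (\<lambda>x. indicator A x *\<^sub>R Re (f x))" by auto
  then show "Re (LINT x:A|M. f x) = (LINT x:A|M. Re (f x))" "set_integrable M A (\<lambda>x. Re (f x))"
    using integral_Re[of M "\<lambda>x. indicator A x *\<^sub>R f x"] assms
      integrable_Re[of M "\<lambda>x. indicator A x *\<^sub>R f x"]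
    unfolding set_lebesgue_integral_def set_integrable_def by auto
qed

lemma set_integral_cnj:
  fixes f :: "real \<Rightarrow> complex"
  shows "(LINT x:A|M. cnj (f x)) = cnj (LINT x:A|M. f x)"
    "set_integrable M A (\<lambda>x. cnj (f x)) \<longleftrightarrow> set_integrable M A f"
proof -
  have eq: "(\<lambda>x. indicator A x *\<^sub>R cnj (f x)) = (\<lambda>x. cnj (indicator A x *\<^sub>R f x))"
    by (auto simp: scaleR_conv_of_real)
  show "(LINT x:A|M. cnj (f x)) = cnj (LINT x:A|M. f x)"
    unfolding set_lebesgue_integral_def eq by (rule Bochner_Integration.integral_cnj)
  show "set_integrable M A (\<lambda>x. cnj (f x)) \<longleftrightarrow> set_integrable M A f"
    unfolding set_integrable_def eq by (rule complex_integrable_cnj)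
qed

lemma loc_ac_cnj:
  assumes "loc_ac M u g"
  shows "loc_ac M (\<lambda>x. cnj (u x)) (\<lambda>x. cnj (g x))"
  unfolding loc_ac_def
proof (intro conjI allI impI)
  show "set_integrable M {0<..<c} (\<lambda>x. cnj (g x))" for c
    using loc_ac_integrable[OF assms] by (simp add: set_integral_cnj)
  fix x :: real assume "0 \<le> x"
  have "cnj (u x) = cnj (u 0 + (LINT t:{0<..<x}|M. g t))"
    by (rule arg_cong[OF loc_ac_eq[OF assms \<open>0 \<le> x\<close>]])
  then show "cnj (u x) = cnj (u 0) + (LINT t:{0<..<x}|M. cnj (g t))"
    by (simp add: set_integral_cnj)
qed

lemma (in loc_finite) parts_integrable:
  fixes u :: "real \<Rightarrow> 'b::{real_normed_field,banach,second_countable_topology}"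
  assumes u: "loc_ac M u g" and G: "loc_ac \<L> G k"
  shows "set_integrable M {0<..<c} (\<lambda>t. g t * G t)" "set_integrable \<L> {0<..<c} (\<lambda>t. u t * k t)"
proof -
  have mG: "G \<in> borel_measurable M" using Leb.loc_ac_measurable[OF G] by (simp add: measurable_M)
  show "set_integrable \<L> {0<..<c} (\<lambda>t. u t * k t)"
    by (rule Leb.loc_ac_mult_integrable[OF loc_ac_integrable[OF G] loc_ac_measurable[OF u]]) (rule loc_ac_bounded[OF u, of _ c], auto)
  have "set_integrable M {0<..<c} (\<lambda>t. G t * g t)"
    by (rule loc_ac_mult_integrable[OF loc_ac_integrable[OF u] mG]) (rule Leb.loc_ac_bounded[OF G, of _ c], auto)
  then show "set_integrable M {0<..<c} (\<lambda>t. g t * G t)" by (simp add: mult.commute)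
qed

definition nsq :: "real \<Rightarrow> (real \<Rightarrow> complex) \<Rightarrow> real" where
  "nsq c u = (LINT x:{0<..<c}|\<L>. (norm (u x))\<^sup>2)"

lemma nsq_nonneg: "0 \<le> nsq c u"
  by (simp add: nsq_def set_lebesgue_integral_def)

lemma bounded_sq_integrable:
  assumes "u \<in> borel_measurable \<L>" "\<And>x. 0 \<le> x \<Longrightarrow> x \<le> c \<Longrightarrow> norm (u x) \<le> B"
  shows "set_integrable \<L> {0<..<c} (\<lambda>x. (norm (u x))\<^sup>2)"
proof (rule Leb.set_integrable_bounded)
  show "norm ((norm (u x))\<^sup>2) \<le> B\<^sup>2" if "0 < x" "x < c" for x
    using assms(2)[of x] that by (simp add: power_mono)
qed (use assms(1) in measurable)

lemma L2_set_integrable: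
  assumes "f \<in> L2 \<L>" "A \<in> sets \<L>"
  shows "set_integrable \<L> A (\<lambda>x. (norm (f x))\<^sup>2)"
  unfolding set_integrable_def using assms by (intro integrable_mult_indicator) (auto simp: L2_def)

lemma sq_integrable_imp_integrable:
  fixes k :: "real \<Rightarrow> complex"
  assumes "set_integrable \<L> {0<..<c} (\<lambda>x. (norm (k x))\<^sup>2)" "k \<in> borel_measurable \<L>"
  shows "set_integrable \<L> {0<..<c} k"
proof (rule set_integrable_bound[OF _ _ AE_I2])
  show "set_integrable \<L> {0<..<c} (\<lambda>x. 1 + (norm (k x))\<^sup>2)"
    by (intro set_integral_add(1) assms(1) Leb.integrable_const_Ioo)
  show "set_borel_measurable \<L> {0<..<c} k"
    unfolding set_borel_measurable_def using assms(2) by simp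
  show "x \<in> {0<..<c} \<longrightarrow> norm (k x) \<le> norm (1 + (norm (k x))\<^sup>2)" for x
    using le_one_plus_square[of "norm (k x)"] by simp
qed

lemma mult_sq_integrable:
  fixes u k :: "real \<Rightarrow> complex"
  assumes A: "A \<in> sets M"
    and u: "set_integrable M A (\<lambda>x. (norm (u x))\<^sup>2)" "u \<in> borel_measurable M"
    and k: "set_integrable M A (\<lambda>x. (norm (k x))\<^sup>2)" "k \<in> borel_measurable M"
  shows "set_integrable M A (\<lambda>x. u x * k x)"
proof (rule set_integrable_bound[OF set_integral_add(1)[OF u(1) k(1)] _ AE_I2])
  show "set_borel_measurable M A (\<lambda>x. u x * k x)"
    unfolding set_borel_measurable_def using u(2) k(2) A by simp
  show "x \<in> A \<longrightarrow> norm (u x * k x) \<le> norm ((norm (u x))\<^sup>2 + (norm (k x))\<^sup>2)" for x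
    using sum_squares_bound[of "norm (u x)" "norm (k x)"]
    by (auto simp: norm_mult power2_eq_square intro: order_trans[rotated])
qed

context sturm_liouville
begin

text \<open>Used to discard the energy carried by \<open>\<nu>\<close>.\<close>

lemma Leb_le_P:
  fixes f :: "real \<Rightarrow> real"
  assumes i: "set_integrable P A f" and f: "f \<in> borel_measurable \<L>" "\<And>x. 0 \<le> f x" and A: "A \<in> sets \<L>"
  shows "(LINT x:A|\<L>. f x) \<le> (LINT x:A|P. f x)"
proof -
  define F where "F x = indicator A x *\<^sub>R f x" for x
  have [measurable]: "F \<in> borel_measurable \<L>" unfolding F_def using f A by simp
  have [measurable]: "F \<in> borel_measurable P" by (simp add: measurable_P)
  have nn: "0 \<le> F x" for x using f by (simp add: F_def)
  have le: "\<L> \<le> P"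
    unfolding le_measure_iff le_fun_def
    by (simp, metis emeasure_P emeasure_notin_sets le_iff_add order.refl sets_sum_measure zero_le)
  have "(\<integral>\<^sup>+x. ennreal (F x) \<partial>\<L>) \<le> (\<integral>\<^sup>+x. ennreal (F x) \<partial>P)"
    by (rule nn_integral_mono_measure[OF _ le]) simp
  also have "\<dots> = ennreal (LINT x|P. F x)"
    by (rule nn_integral_eq_integral) (use i nn in \<open>auto simp: F_def set_integrable_def\<close>)
  finally have "(\<integral>\<^sup>+x. ennreal (F x) \<partial>\<L>) \<le> ennreal (LINT x|P. F x)" .
  then have "enn2real (\<integral>\<^sup>+x. ennreal (F x) \<partial>\<L>) \<le> (LINT x|P. F x)"
    by (intro enn2real_leI) (use nn in \<open>auto intro: integral_nonneg_AE\<close>)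
  then have "(LINT x|\<L>. F x) \<le> (LINT x|P. F x)"
    by (subst integral_eq_nn_integral) (use nn in auto)
  then show ?thesis by (simp add: F_def set_lebesgue_integral_def)
qed

lemma sol_sq_integrable:
  assumes "sol z k u g"
  shows "set_integrable \<L> {0<..<c} (\<lambda>x. (norm (u x))\<^sup>2)"
proof -
  obtain B where "\<And>x. 0 \<le> x \<Longrightarrow> x \<le> c \<Longrightarrow> norm (u x) \<le> B" using sol_loc_bounded[OF assms] by blast
  then show ?thesis by (rule bounded_sq_integrable[OF sol_measurable[OF assms]])
qed

lemma sol_k_measurable: "sol z k u g \<Longrightarrow> k \<in> borel_measurable \<L>"
  by (rule Leb.measurable_if_loc_integrable[OF sol_k_loc])

text \<open>The Neumann condition removes the boundary term at \<open>0\<close>.\<close>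

lemma green_first:
  assumes u: "sol z k u g" and v: "sol w l v y" and c: "0 \<le> c"
  shows "u c * cnj (y c) = (LINT t:{0<..<c}|P. g t * cnj (y t)) +
    (LINT t:{0<..<c}|\<L>. u t * cnj ((of_real (q t) - w) * v t - l t))"
  using P.integration_by_parts[OF sol_loc_ac[OF u] loc_ac_cnj[OF sol_loc_ac'[OF v]] c] sol_0[OF v] by simp

definition phi :: "complex \<Rightarrow> real \<Rightarrow> complex" where
  "phi z = (SOME u. \<exists>g. sol z (\<lambda>_. 0) u g \<and> u 0 = 1)"
definition phig :: "complex \<Rightarrow> real \<Rightarrow> complex" where
  "phig z = (SOME g. sol z (\<lambda>_. 0) (phi z) g)"

lemma phi: "sol z (\<lambda>_. 0) (phi z) (phig z)" "phi z 0 = 1"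
proof -
  have "\<exists>u g. sol z (\<lambda>_. 0) u g \<and> u 0 = 1"
    by (rule sol_exists) (simp add: set_integrable_def)
  then have *: "\<exists>g. sol z (\<lambda>_. 0) (phi z) g \<and> phi z 0 = 1"
    unfolding phi_def by (rule someI_ex)
  then show "phi z 0 = 1" by blast
  from * have "\<exists>g. sol z (\<lambda>_. 0) (phi z) g" by blast
  then show "sol z (\<lambda>_. 0) (phi z) (phig z)" unfolding phig_def by (rule someI_ex)
qed

definition sol_const :: "real \<Rightarrow> real \<Rightarrow> real" where
  "sol_const c Z = Pm c * exp (LINT t:{0<..<c}|\<L>. rate c Z t)"

lemma sol_bound_0:
  assumes u: "sol z k u g" "u 0 = 0" and z: "norm z \<le> Z" and x: "0 \<le> x" "x \<le> c"
  shows "norm (u x) \<le> sol_const c Z * (LINT t:{0<..<c}|\<L>. norm (k t))"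
  using sol_bound[OF u(1) z x] u(2) by (simp add: sol_const_def mult_ac)

lemma sol_bound_nsq:
  assumes u: "sol z k u g" "u 0 = 0" and z: "norm z \<le> Z" and x: "0 \<le> x" "x \<le> c"
    and k: "set_integrable \<L> {0<..<c} (\<lambda>x. (norm (k x))\<^sup>2)"
  shows "(norm (u x))\<^sup>2 \<le> (sol_const c Z)\<^sup>2 * c * nsq c k"
proof -
  have "(norm (u x))\<^sup>2 \<le> (sol_const c Z * (LINT t:{0<..<c}|\<L>. norm (k t)))\<^sup>2"
    using sol_bound_0[OF u z x] by (intro power_mono) auto
  also have "\<dots> = (sol_const c Z)\<^sup>2 * (LINT t:{0<..<c}|\<L>. norm (k t))\<^sup>2"
    by (simp add: power_mult_distrib)
  also have "\<dots> \<le> (sol_const c Z)\<^sup>2 * (measure \<L> {0<..<c} * (LINT t:{0<..<c}|\<L>. (norm (k t))\<^sup>2))"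
    by (intro mult_left_mono sqr_integral_le set_integrable_norm[OF sol_k_loc[OF u(1)]] k)
      (use Leb.emeasure_Ioo[of c] in auto)
  finally show ?thesis
    using Leb_measure_Ioo[of 0 c] x by (simp add: nsq_def mult.assoc)
qed

lemma sol_minus_phi:
  assumes "sol z k u g"
  shows "sol z k (\<lambda>x. u x - a * phi z x) (\<lambda>x. g x - a * phig z x)"
  using sol_lincomb[OF assms phi(1), of "-a"] by simp

text \<open>Subtracting the multiple of \<open>phi z\<close> leaves zero initial value and zero
  right-hand side, so the bound of \<open>sol_bound_0\<close> is zero. The solution space is thus
  one-dimensional.\<close>

lemma sol_0_eq_phi:
  assumes u: "sol z (\<lambda>_. 0) u g" and x: "0 \<le> x"
  shows "u x = u 0 * phi z x"
  using sol_bound_0[OF sol_minus_phi[OF u, of "u 0"] _ order.refl x order.refl] phi(2) by simp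

text \<open>If \<open>phi z\<close> vanished almost everywhere on \<open>(0,c)\<close>, its
  quasi-derivative would vanish there, and \<open>phi z\<close> would be the constant 1.\<close>

lemma phi_nsq_pos:
  assumes c: "0 < c"
  shows "0 < nsq c (phi z)"
proof (rule ccontr)
  assume "\<not> ?thesis"
  then have n0: "nsq c (phi z) = 0" using nsq_nonneg[of c "phi z"] by simp
  have i: "integrable \<L> (\<lambda>x. indicator {0<..<c} x *\<^sub>R (norm (phi z x))\<^sup>2)"
    using sol_sq_integrable[OF phi(1), of c] by (simp add: set_integrable_def)
  have ae: "AE x in \<L>. indicator {0<..<c} x *\<^sub>R (norm (phi z x))\<^sup>2 = 0"
    using integral_nonneg_eq_0_iff_AE[OF i] n0 by (simp add: nsq_def set_lebesgue_integral_def)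
  have g0: "phig z x = 0" if x: "0 \<le> x" "x \<le> c" for x
  proof -
    have "(LINT t:{0<..<x}|\<L>. (of_real (q t) - z) * phi z t - 0) = 0"
      unfolding set_lebesgue_integral_def
    proof (rule integral_eq_zero_AE)
      show "AE t in \<L>. indicat_real {0<..<x} t *\<^sub>R ((complex_of_real (q t) - z) * phi z t - 0) = 0"
        using ae by eventually_elim (use x in \<open>auto simp: indicator_def split: if_splits\<close>)
    qed
    then show ?thesis using loc_ac_eq[OF sol_loc_ac'[OF phi(1)] x(1)] sol_0[OF phi(1)] by simp
  qed
  have p1: "phi z x = 1" if x: "0 \<le> x" "x \<le> c" for x
  proof -
    have "(LINT t:{0<..<x}|P. phig z t) = (LINT t:{0<..<x}|P. 0)"
      by (rule set_lebesgue_integral_cong) (use g0 x in auto)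
    then show ?thesis using loc_ac_eq[OF sol_loc_ac[OF phi(1)] x(1)] phi(2) by simp
  qed
  have "nsq c (phi z) = (LINT x:{0<..<c}|\<L>. 1)"
    unfolding nsq_def by (rule set_lebesgue_integral_cong) (use p1 in auto)
  then have "nsq c (phi z) = c" using Leb_const(2)[of 0 c 1] c by simp
  then show False using n0 c by simp
qed

end

section \<open>Masses on \<open>(0,c)\<close> and their tails\<close>

lemma nsq_mono:
  assumes "\<And>c. set_integrable \<L> {0<..<c} (\<lambda>x. (norm (u x))\<^sup>2)" "b \<le> c"
  shows "nsq b u \<le> nsq c u"
  unfolding nsq_def by (rule Leb.Ioo_integral_mono_set[OF assms]) simp

lemma L2_if_nsq_bounded:
  assumes u: "u \<in> borel_measurable \<L>" and i: "\<And>c. set_integrable \<L> {0<..<c} (\<lambda>x. (norm (u x))\<^sup>2)"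
    and K: "\<And>c. nsq c u \<le> K"
  shows "u \<in> L2 \<L>" "(LINT x|\<L>. (norm (u x))\<^sup>2) \<le> K"
proof -
  define f where "f n x = indicator {0<..<real n} x *\<^sub>R (norm (u x))\<^sup>2" for n x
  have fi: "integrable \<L> (f n)" for n using i[of "real n"] by (simp add: f_def[abs_def] set_integrable_def)
  have fn: "integral\<^sup>L \<L> (f n) = nsq (real n) u" for n
    by (simp add: f_def[abs_def] nsq_def set_lebesgue_integral_def)
  have inc: "incseq (\<lambda>n. nsq (real n) u)"
    using nsq_mono[OF i] by (auto simp: incseq_def)
  obtain L where L: "(\<lambda>n. nsq (real n) u) \<longlonglongrightarrow> L"
    using incseq_convergent[OF inc, of K] K by blast
  have mono: "AE x in \<L>. mono (\<lambda>n. f n x)"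
    by (rule AE_I2) (auto simp: mono_def f_def indicator_def)
  have lim: "AE x in \<L>. (\<lambda>n. f n x) \<longlonglongrightarrow> (norm (u x))\<^sup>2"
  proof (rule AE_I2, rule tendsto_eventually)
    fix x assume "x \<in> space \<L>"
    moreover obtain N where "x < real N" using reals_Archimedean2 by blast
    ultimately show "\<forall>\<^sub>F n in sequentially. f n x = (norm (u x))\<^sup>2"
      by (intro eventually_sequentiallyI[of N]) (auto simp: f_def)
  qed
  have bm: "(\<lambda>x. (norm (u x))\<^sup>2) \<in> borel_measurable \<L>" using u by measurable
  have L': "(\<lambda>n. integral\<^sup>L \<L> (f n)) \<longlonglongrightarrow> L" using L by (simp add: fn)
  show "u \<in> L2 \<L>"
    using integrable_monotone_convergence[OF fi mono lim L' bm] u by (simp add: L2_def)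
  have "(LINT x|\<L>. (norm (u x))\<^sup>2) = L"
    by (rule integral_monotone_convergence[OF fi mono lim L' bm])
  also have "L \<le> K" by (rule LIMSEQ_le_const2[OF L]) (use K in auto)
  finally show "(LINT x|\<L>. (norm (u x))\<^sup>2) \<le> K" .
qed

lemma nsq_le_L2:
  assumes "u \<in> L2 \<L>"
  shows "nsq c u \<le> (LINT x|\<L>. (norm (u x))\<^sup>2)"
  unfolding nsq_def set_lebesgue_integral_def
proof (rule integral_mono)
  show "integrable \<L> (\<lambda>x. indicat_real {0<..<c} x *\<^sub>R (norm (u x))\<^sup>2)"
    using L2_set_integrable[OF assms, of "{0<..<c}"] by (simp add: set_integrable_def)
qed (use assms in \<open>auto simp: L2_def indicator_def\<close>)

definition tail :: "real \<Rightarrow> real \<Rightarrow> (real \<Rightarrow> complex) \<Rightarrow> real" where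
  "tail N c u = (LINT x:{N<..<c}|\<L>. (norm (u x))\<^sup>2)"

lemma tail_nonneg: "0 \<le> tail N c u"
  by (simp add: tail_def set_lebesgue_integral_def)

lemma tail_indicator:
  assumes "0 \<le> N"
  shows "(LINT x:{0<..<c}|\<L>. indicator {N<..} x * (norm (u x))\<^sup>2) = tail N c u"
  unfolding tail_def set_lebesgue_integral_def
  by (rule Bochner_Integration.integral_cong) (use assms in \<open>auto simp: indicator_def\<close>)

lemma nsq_split:
  assumes "0 \<le> N" "N \<le> c" "u \<in> borel_measurable \<L>" "set_integrable \<L> {0<..<c} (\<lambda>x. (norm (u x))\<^sup>2)"
  shows "nsq c u = nsq N u + tail N c u"
proof -
  consider "N = 0" | "N = c" | "0 < N" "N < c" using assms by linarith
  then show ?thesis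
  proof cases
    case 3
    then show ?thesis unfolding nsq_def tail_def
      by (intro Leb_Ioo_split[OF assms(4)]) (use assms(3) in auto)
  qed (simp_all add: nsq_def tail_def)
qed

lemma norm_add_sq_le: "(norm (a + b))\<^sup>2 \<le> 2 * (norm a)\<^sup>2 + 2 * (norm b)\<^sup>2"
  for a b :: "'a::real_normed_vector"
proof -
  have "(norm (a + b))\<^sup>2 \<le> (norm a + norm b)\<^sup>2" by (intro power_mono norm_triangle_ineq) simp
  also have "\<dots> \<le> 2 * (norm a)\<^sup>2 + 2 * (norm b)\<^sup>2"
    using zero_le_power2[of "norm a - norm b"] by (simp add: power2_eq_square algebra_simps)
  finally show ?thesis .
qed

lemma cnj_measurable [measurable]:
  "k \<in> borel_measurable M \<Longrightarrow> (\<lambda>x. cnj (k x)) \<in> borel_measurable M"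
  by (rule borel_measurable_continuous_on) (auto intro: continuous_intros)

lemma mult_cnj_integrable:
  fixes u k :: "real \<Rightarrow> complex"
  assumes A: "A \<in> sets M"
    and u: "set_integrable M A (\<lambda>x. (norm (u x))\<^sup>2)" "u \<in> borel_measurable M"
    and k: "set_integrable M A (\<lambda>x. (norm (k x))\<^sup>2)" "k \<in> borel_measurable M"
  shows "set_integrable M A (\<lambda>x. u x * cnj (k x))"
  by (rule mult_sq_integrable[OF A u]) (simp_all only: complex_mod_cnj k cnj_measurable)

lemma set_integral_lin:
  fixes f g :: "'a \<Rightarrow> real"
  assumes "set_integrable M A f" "set_integrable M A g"
  shows "(LINT x:A|M. a * f x + b * g x) = a * (LINT x:A|M. f x) + b * (LINT x:A|M. g x)"
  using set_integral_add(2)[OF set_integrable_mult_right[of a, OF assms(1)] set_integrable_mult_right[of b, OF assms(2)]]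
  by (simp only: set_integral_mult_right)

context gaps
begin

definition form_const :: real where
  "form_const = (SOME C. C\<ge>0 \<and> (\<forall>M\<ge>0. \<exists>N\<ge>0. \<forall>c u g. c \<in> supp \<longrightarrow>
   (\<forall>k. \<Delta> k \<subseteq> {0<..<c} \<longrightarrow> seg (gap_left k) (gap_right k) u g) \<longrightarrow>
   set_integrable \<L> {0<..<c} (form_density C M N u g) \<longrightarrow>
   0 \<le> (LINT x:{0<..<c}|\<L>. form_density C M N u g x)))"

lemma form_const: "0 \<le> form_const"
  "0 \<le> M \<Longrightarrow> \<exists>N\<ge>0. \<forall>c u g. c \<in> supp \<longrightarrow>
   (\<forall>k. \<Delta> k \<subseteq> {0<..<c} \<longrightarrow> seg (gap_left k) (gap_right k) u g) \<longrightarrow>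
   set_integrable \<L> {0<..<c} (form_density form_const M N u g) \<longrightarrow>
   0 \<le> (LINT x:{0<..<c}|\<L>. form_density form_const M N u g x)"
  using someI_ex[OF coercive, folded form_const_def] by blast+

text \<open>One below the lower bound \<open>- form_const\<close>; the surplus 1 becomes the term
  \<open>nsq c u\<close> in \<open>form_ineq\<close>.\<close>

definition lam :: real where "lam = - (form_const + 1)"

lemma q_sq_integrable:
  assumes "u \<in> borel_measurable \<L>" "\<And>x. 0 \<le> x \<Longrightarrow> x \<le> c \<Longrightarrow> norm (u x) \<le> B"
  shows "set_integrable \<L> {0<..<c} (\<lambda>x. q x * (norm (u x))\<^sup>2)"
proof -
  have "set_integrable \<L> {0<..<c} (\<lambda>x. (norm (u x))\<^sup>2 * q x)"
  proof (rule Leb.loc_ac_mult_integrable[OF q_loc])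
    show "norm ((norm (u x))\<^sup>2) \<le> B\<^sup>2" if "0 < x" "x < c" for x
      using assms(2)[of x] that by (simp add: power_mono)
  qed (use assms(1) in measurable)
  then show ?thesis by (simp add: mult.commute)
qed

lemma indicator_sq_integrable:
  fixes u :: "real \<Rightarrow> complex"
  assumes "u \<in> borel_measurable \<L>" "set_integrable \<L> {0<..<c} (\<lambda>x. (norm (u x))\<^sup>2)"
  shows "set_integrable \<L> {0<..<c} (\<lambda>x. indicator {N<..} x * (norm (u x))\<^sup>2)"
proof (rule set_integrable_bound[OF assms(2) _ AE_I2])
  have [measurable]: "indicat_real {N<..} \<in> borel_measurable \<L>"
    by (rule Leb.borel_imp_M) simp
  show "set_borel_measurable \<L> {0<..<c} (\<lambda>x. indicator {N<..} x * (norm (u x))\<^sup>2)"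
    unfolding set_borel_measurable_def using assms(1) by simp
qed (auto simp: indicator_def)

lemma form_density_integral:
  assumes u: "u \<in> borel_measurable \<L>" "\<And>x. 0 \<le> x \<Longrightarrow> x \<le> c \<Longrightarrow> norm (u x) \<le> B"
    and h: "h \<in> borel_measurable \<L>" "\<And>x. 0 \<le> x \<Longrightarrow> x \<le> c \<Longrightarrow> norm (h x) \<le> B'" and N: "0 \<le> N"
  shows "set_integrable \<L> {0<..<c} (form_density C M N u h)"
    "(LINT x:{0<..<c}|\<L>. form_density C M N u h x) =
      (1/2) * nsq c h + (LINT x:{0<..<c}|\<L>. q x * (norm (u x))\<^sup>2) + C * nsq c u - M * tail N c u"
proof -
  have ui: "set_integrable \<L> {0<..<c} (\<lambda>x. (norm (u x))\<^sup>2)" by (rule bounded_sq_integrable[OF u])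
  have hi: "set_integrable \<L> {0<..<c} (\<lambda>x. (norm (h x))\<^sup>2)" by (rule bounded_sq_integrable[OF h])
  have qi: "set_integrable \<L> {0<..<c} (\<lambda>x. q x * (norm (u x))\<^sup>2)" by (rule q_sq_integrable[OF u])
  note 1 = set_integrable_mult_right[of "1/2", OF hi] set_integrable_mult_right[of C, OF ui]
    set_integrable_mult_right[of M, OF indicator_sq_integrable[OF u(1) ui, where N=N]]
  note 3 = set_integral_add[OF 1(1) qi]
  note 4 = set_integral_add[OF 3(1) 1(2)]
  have eq: "form_density C M N u h = (\<lambda>x. (1/2) * (norm (h x))\<^sup>2 + q x * (norm (u x))\<^sup>2
      + C * (norm (u x))\<^sup>2 - M * (indicator {N<..} x * (norm (u x))\<^sup>2))"
    by (rule ext) (simp add: form_density_def)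
  show "set_integrable \<L> {0<..<c} (form_density C M N u h)"
    unfolding eq by (rule set_integral_diff(1)[OF 4(1) 1(3)])
  show "(LINT x:{0<..<c}|\<L>. form_density C M N u h x) =
      (1/2) * nsq c h + (LINT x:{0<..<c}|\<L>. q x * (norm (u x))\<^sup>2) + C * nsq c u - M * tail N c u"
    unfolding eq
    by (simp only: set_integral_diff(2)[OF 4(1) 1(3)] 4(2) 3(2) set_integral_mult_right nsq_def tail_indicator[OF N])
qed

lemma seg_gapI:
  assumes k: "\<Delta> k \<subseteq> {0<..<c}"
    and u: "u \<in> borel_measurable \<L>" "\<And>x. 0 \<le> x \<Longrightarrow> x \<le> c \<Longrightarrow> norm (u x) \<le> B"
    and h: "h \<in> borel_measurable \<L>" "\<And>x. 0 \<le> x \<Longrightarrow> x \<le> c \<Longrightarrow> norm (h x) \<le> B'"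
    and inc: "\<And>x y. 0 < x \<Longrightarrow> x \<le> y \<Longrightarrow> {x..<y} \<subseteq> {0<..} - supp \<Longrightarrow> u y - u x = (LINT t:{x..<y}|\<L>. h t)"
  shows "seg (gap_left k) (gap_right k) u h"
  unfolding seg_def
proof (intro conjI allI impI)
  note gi = gap_interval[of k]
  show "set_integrable \<L> {gap_left k<..<gap_right k} (\<lambda>x. (norm (h x))\<^sup>2)"
    by (rule set_integrable_subset[OF bounded_sq_integrable[OF h]])
      (use k gi Leb.Ioo_sets'[OF gi(2)] in auto)
  have "norm (u x) \<le> B" if "gap_left k < x" "x < gap_right k" for x
  proof -
    have "x \<in> \<Delta> k" using that by (simp add: gi(1))
    then have "x \<in> {0<..<c}" using k by blast
    then show ?thesis using u(2)[of x] by simp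
  qed
  then show "\<exists>B. \<forall>x. gap_left k < x \<longrightarrow> x < gap_right k \<longrightarrow> norm (u x) \<le> B" by blast
  fix x y assume xy: "gap_left k < x" "x \<le> y" "y < gap_right k"
  show "u y - u x = (LINT t:{x..<y}|\<L>. h t)"
  proof (rule inc)
    have "{x..<y} \<subseteq> \<Delta> k" unfolding gi(1) using xy by auto
    then show "{x..<y} \<subseteq> {0<..} - supp" using gap_subset by blast
  qed (use xy gi(2) in auto)
qed (use u h gap_interval[of k] in auto)

lemma Ico_in_sets: "0 < x \<Longrightarrow> {x..<y} \<in> sets \<L>"
  by (rule Leb.Ico_sets)

lemma sol_seg:
  assumes s: "sol z k u g" and c: "\<Delta> j \<subseteq> {0<..<c}"
  shows "seg (gap_left j) (gap_right j) u g"
proof -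
  obtain B where B: "\<And>x. 0 \<le> x \<Longrightarrow> x \<le> c \<Longrightarrow> norm (u x) \<le> B" using sol_loc_bounded[OF s] by blast
  obtain B' where B': "\<And>x. 0 \<le> x \<Longrightarrow> x \<le> c \<Longrightarrow> norm (g x) \<le> B'" using sol_g_loc_bounded[OF s] by blast
  show ?thesis
  proof (rule seg_gapI[OF c sol_measurable[OF s] B sol_g_measurable[OF s] B'])
    fix x y :: real assume "0 < x" "x \<le> y" "{x..<y} \<subseteq> {0<..} - supp"
    then show "u y - u x = (LINT t:{x..<y}|\<L>. g t)"
      using P.loc_ac_diff[OF sol_loc_ac[OF s], of x y] P_eq_Leb_in_gap[OF _ Ico_in_sets sol_g_measurable[OF s]] by simp
  qed
qed

text \<open>The equation is tested with \<open>u\<close> itself. With Neumann conditions at both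
  ends no boundary term remains, and \<open>coercive\<close> bounds the form from below.\<close>

lemma form_ineq:
  assumes M: "0 \<le> M"
  shows "\<exists>N\<ge>0. \<forall>c k u g. c \<in> supp \<longrightarrow> sol lam k u g \<longrightarrow> g c = 0 \<longrightarrow>
    set_integrable \<L> {0<..<c} (\<lambda>x. (norm (k x))\<^sup>2) \<longrightarrow>
    nsq c u + M * tail N c u \<le> Re (LINT x:{0<..<c}|\<L>. u x * cnj (k x))"
proof -
  obtain N where N: "0 \<le> N" and co: "\<And>c u g. c \<in> supp \<Longrightarrow>
   (\<And>k. \<Delta> k \<subseteq> {0<..<c} \<Longrightarrow> seg (gap_left k) (gap_right k) u g) \<Longrightarrow>
   set_integrable \<L> {0<..<c} (form_density form_const M N u g) \<Longrightarrow>
   0 \<le> (LINT x:{0<..<c}|\<L>. form_density form_const M N u g x)"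
    using form_const(2)[OF M] by blast
  show ?thesis
  proof (intro exI[of _ N] conjI allI impI N)
    fix c k u g
    assume c: "c \<in> supp" and s: "sol lam k u g" and g: "g c = 0"
      and k2: "set_integrable \<L> {0<..<c} (\<lambda>x. (norm (k x))\<^sup>2)"
    have c0: "0 < c" using c supp_pos by auto
    obtain B where B: "\<And>x. 0 \<le> x \<Longrightarrow> x \<le> c \<Longrightarrow> norm (u x) \<le> B" using sol_loc_bounded[OF s] by blast
    obtain B' where B': "\<And>x. 0 \<le> x \<Longrightarrow> x \<le> c \<Longrightarrow> norm (g x) \<le> B'" using sol_g_loc_bounded[OF s] by blast
    note um = sol_measurable[OF s] and gm = sol_g_measurable[OF s] and km = sol_k_measurable[OF s]
    note fd = form_density_integral[OF um B gm B' N, where C=form_const and M=M]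
    have pos: "0 \<le> (1/2) * nsq c g + (LINT x:{0<..<c}|\<L>. q x * (norm (u x))\<^sup>2) + form_const * nsq c u - M * tail N c u"
      using co[OF c sol_seg[OF s] fd(1)] fd(2) by simp
    have ui: "set_integrable \<L> {0<..<c} (\<lambda>x. (norm (u x))\<^sup>2)" by (rule bounded_sq_integrable[OF um B])
    have uk: "set_integrable \<L> {0<..<c} (\<lambda>x. u x * cnj (k x))"
      by (rule mult_cnj_integrable[OF Leb.Ioo_sets ui um k2 km])
    note pI = P.parts_integrable[OF sol_loc_ac[OF s] loc_ac_cnj[OF sol_loc_ac'[OF s]], of c]
    have gg: "(LINT t:{0<..<c}|P. (norm (g t))\<^sup>2) = Re (LINT t:{0<..<c}|P. g t * cnj (g t))"
      "set_integrable P {0<..<c} (\<lambda>t. (norm (g t))\<^sup>2)"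
      using set_integral_Re[OF pI(1)] by (simp_all add: complex_norm_square[symmetric])
    have ptw: "Re (u t * cnj ((of_real (q t) - of_real lam) * u t - k t)) =
      q t * (norm (u t))\<^sup>2 + (form_const + 1) * (norm (u t))\<^sup>2 - Re (u t * cnj (k t))" for t
    proof -
      have "u t * cnj ((of_real (q t) - of_real lam) * u t - k t) =
        of_real (q t - lam) * (u t * cnj (u t)) - u t * cnj (k t)"
        by (simp add: algebra_simps)
      also have "\<dots> = of_real ((q t - lam) * (norm (u t))\<^sup>2) - u t * cnj (k t)"
        by (simp only: complex_norm_square[symmetric] of_real_mult)
      finally show ?thesis by (simp add: lam_def algebra_simps)
    qed
    have "Re (LINT t:{0<..<c}|\<L>. u t * cnj ((of_real (q t) - of_real lam) * u t - k t)) =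
      (LINT t:{0<..<c}|\<L>. q t * (norm (u t))\<^sup>2 + (form_const + 1) * (norm (u t))\<^sup>2 - Re (u t * cnj (k t)))"
      using set_integral_Re(1)[OF pI(2)] by (simp only: ptw complex_cnj_complex_of_real)
    also have "\<dots> = (LINT t:{0<..<c}|\<L>. q t * (norm (u t))\<^sup>2) + (form_const + 1) * nsq c u - Re (LINT t:{0<..<c}|\<L>. u t * cnj (k t))"
    proof -
      note 2 = set_integral_add[OF q_sq_integrable[OF um B] set_integrable_mult_right[of "form_const + 1", OF ui]]
      show ?thesis
        by (simp only: set_integral_diff(2)[OF 2(1) set_integral_Re(2)[OF uk]] 2(2) set_integral_mult_right
            set_integral_Re(1)[OF uk] nsq_def)
    qed
    \<comment> \<open>Real part of Green's identity for the pair \<open>u\<close>, \<open>u\<close>;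
      the left side is zero because \<open>g c = 0\<close>.\<close>
    finally have "0 = (LINT t:{0<..<c}|P. (norm (g t))\<^sup>2) + ((LINT t:{0<..<c}|\<L>. q t * (norm (u t))\<^sup>2)
        + (form_const + 1) * nsq c u - Re (LINT t:{0<..<c}|\<L>. u t * cnj (k t)))"
      using arg_cong[OF green_first[OF s s], of c Re] g c0 gg(1) by simp
    moreover have "nsq c g \<le> (LINT t:{0<..<c}|P. (norm (g t))\<^sup>2)"
      unfolding nsq_def by (rule Leb_le_P[OF gg(2)]) (use gm in auto)
    ultimately show "nsq c u + M * tail N c u \<le> Re (LINT x:{0<..<c}|\<L>. u x * cnj (k x))"
      using pos nsq_nonneg[of c g] by (simp add: distrib_right)
  qed
qed

lemma Re_integral_le:
  fixes u k :: "real \<Rightarrow> complex"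
  assumes u: "u \<in> borel_measurable \<L>" "set_integrable \<L> {0<..<c} (\<lambda>x. (norm (u x))\<^sup>2)"
    and k: "k \<in> borel_measurable \<L>" "set_integrable \<L> {0<..<c} (\<lambda>x. (norm (k x))\<^sup>2)"
  shows "Re (LINT x:{0<..<c}|\<L>. u x * cnj (k x + a * u x)) \<le> (1/2 + norm a) * nsq c u + 1/2 * nsq c k"
proof -
  note [measurable] = u(1) k(1)
  have ka: "set_integrable \<L> {0<..<c} (\<lambda>x. (norm (k x + a * u x))\<^sup>2)"
  proof (rule set_integrable_bound[OF _ _ AE_I2])
    show "set_integrable \<L> {0<..<c} (\<lambda>x. 2 * (norm (k x))\<^sup>2 + 2 * ((norm a)\<^sup>2 * (norm (u x))\<^sup>2))"
      by (intro set_integral_add(1) set_integrable_mult_right u k)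
    show "set_borel_measurable \<L> {0<..<c} (\<lambda>x. (norm (k x + a * u x))\<^sup>2)"
      unfolding set_borel_measurable_def by simp
    show "x \<in> {0<..<c} \<longrightarrow> norm ((norm (k x + a * u x))\<^sup>2) \<le> norm (2 * (norm (k x))\<^sup>2 + 2 * ((norm a)\<^sup>2 * (norm (u x))\<^sup>2))" for x
      using norm_add_sq_le[of "k x" "a * u x"] by (simp add: norm_mult power_mult_distrib)
  qed
  have i: "set_integrable \<L> {0<..<c} (\<lambda>x. u x * cnj (k x + a * u x))"
    by (rule mult_cnj_integrable[OF Leb.Ioo_sets u(2,1) ka]) simp
  have "Re (LINT x:{0<..<c}|\<L>. u x * cnj (k x + a * u x)) = (LINT x:{0<..<c}|\<L>. Re (u x * cnj (k x + a * u x)))"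
    by (rule set_integral_Re(1)[OF i])
  also have "\<dots> \<le> (LINT x:{0<..<c}|\<L>. (1/2 + norm a) * (norm (u x))\<^sup>2 + 1/2 * (norm (k x))\<^sup>2)"
  proof (rule set_integral_mono[OF set_integral_Re(2)[OF i]])
    show "set_integrable \<L> {0<..<c} (\<lambda>x. (1/2 + norm a) * (norm (u x))\<^sup>2 + 1/2 * (norm (k x))\<^sup>2)"
      by (intro set_integral_add(1) set_integrable_mult_right u k)
    fix x
    have "Re (u x * cnj (k x + a * u x)) \<le> norm (u x) * norm (k x + a * u x)"
      using complex_Re_le_cmod[of "u x * cnj (k x + a * u x)"] by (simp only: norm_mult complex_mod_cnj)
    also have "\<dots> \<le> norm (u x) * (norm (k x) + norm a * norm (u x))"
      by (intro mult_left_mono) (metis norm_mult norm_triangle_ineq, simp)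
    also have "\<dots> \<le> (1/2 + norm a) * (norm (u x))\<^sup>2 + 1/2 * (norm (k x))\<^sup>2"
      using sum_squares_bound[of "norm (u x)" "norm (k x)"] by (simp add: algebra_simps power2_eq_square)
    finally show "Re (u x * cnj (k x + a * u x)) \<le> (1/2 + norm a) * (norm (u x))\<^sup>2 + 1/2 * (norm (k x))\<^sup>2" .
  qed
  also have "\<dots> = (1/2 + norm a) * nsq c u + 1/2 * nsq c k"
    unfolding nsq_def by (rule set_integral_lin[OF u(2) k(2)])
  finally show ?thesis .
qed

text \<open>If \<open>\<phi>\<^sub>z\<close> is not square integrable, a solution on \<open>(0,c)\<close> cannot be large compared
  with its right-hand side: most of its mass lies in \<open>(0,N)\<close> and it is close to a multiple of
  \<open>\<phi>\<^sub>z\<close> there, but that multiple would have too much mass in \<open>(0,X)\<close>.\<close>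

lemma truncated_bound:
  assumes nL2: "phi z \<notin> L2 \<L>"
  shows "\<exists>C>0. \<exists>c0. \<forall>c k u g. c \<in> supp \<longrightarrow> c0 \<le> c \<longrightarrow> sol z k u g \<longrightarrow> g c = 0 \<longrightarrow>
    set_integrable \<L> {0<..<c} (\<lambda>x. (norm (k x))\<^sup>2) \<longrightarrow> nsq c u \<le> C * nsq c k"
proof -
  define m where "m = norm (z - lam)"
  have m0: "0 \<le> m" by (simp add: m_def)
  obtain N where N: "0 \<le> N" and F: "\<And>c k u g. c \<in> supp \<Longrightarrow> sol lam k u g \<Longrightarrow> g c = 0 \<Longrightarrow>
    set_integrable \<L> {0<..<c} (\<lambda>x. (norm (k x))\<^sup>2) \<Longrightarrow>
    nsq c u + 4 * (1 + m) * tail N c u \<le> Re (LINT x:{0<..<c}|\<L>. u x * cnj (k x))"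
    using form_ineq[of "4 * (1 + m)"] m0 by auto
  note pi = sol_sq_integrable[OF phi(1)[of z]]
  \<comment> \<open>Since \<open>phi z\<close> is not in \<open>L2\<close>, its mass on
    \<open>(0,X)\<close> grows without bound. The factor 16 is what the final absorption
    needs.\<close>
  have "\<exists>X. 16 * nsq N (phi z) < nsq X (phi z)"
  proof (rule ccontr)
    assume "\<not> ?thesis"
    then have "nsq X (phi z) \<le> 16 * nsq N (phi z)" for X by (simp add: not_less)
    from L2_if_nsq_bounded(1)[OF sol_measurable[OF phi(1)] pi this] nL2 show False by simp
  qed
  then obtain X0 where X0: "16 * nsq N (phi z) < nsq X0 (phi z)" by blast
  define X where "X = max X0 N"
  have X: "N \<le> X" "0 \<le> X" "16 * nsq N (phi z) \<le> nsq X (phi z)"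
    using N X0 nsq_mono[OF pi, of X0 X] by (auto simp: X_def)
  define V where "V = (sol_const X (norm z))\<^sup>2 * X * X"
  have V0: "0 \<le> V" using X by (simp add: V_def)
  have main: "nsq c u \<le> (1 + 5 * V) * nsq c k"
    if c: "c \<in> supp" "X \<le> c" and s: "sol z k u g" and g: "g c = 0"
      and k2: "set_integrable \<L> {0<..<c} (\<lambda>x. (norm (k x))\<^sup>2)" for c k u g
  proof -
    define U where "U = nsq c u"
    define K where "K = nsq c k"
    define a where "a = u 0"
    define v where "v x = u x - a * phi z x" for x
    note ui = sol_sq_integrable[OF s] and um = sol_measurable[OF s] and km = sol_k_measurable[OF s]
    have U0: "0 \<le> U" and K0: "0 \<le> K" by (simp_all add: U_def K_def nsq_nonneg)
    have V: "V * K \<ge> 0" using V0 K0 by simp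
    have "U \<le> (1 + 5 * V) * K"
    proof (cases "K \<le> U")
      case False
      then show ?thesis using V by (simp add: distrib_right)
    next
      case True
      define k' where "k' x = k x + (z - lam) * u x" for x
      have s': "sol lam k' u g" using s sol_shift[of z k u g "of_real lam"] by (simp add: k'_def[abs_def])
      have k'2: "set_integrable \<L> {0<..<c} (\<lambda>x. (norm (k' x))\<^sup>2)"
      proof (rule set_integrable_bound[OF _ _ AE_I2])
        show "set_integrable \<L> {0<..<c} (\<lambda>x. 2 * (norm (k x))\<^sup>2 + 2 * ((norm (z - lam))\<^sup>2 * (norm (u x))\<^sup>2))"
          by (intro set_integral_add(1) set_integrable_mult_right ui k2)
        show "set_borel_measurable \<L> {0<..<c} (\<lambda>x. (norm (k' x))\<^sup>2)"
          unfolding set_borel_measurable_def k'_def using um km by simp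
        show "x \<in> {0<..<c} \<longrightarrow> norm ((norm (k' x))\<^sup>2) \<le> norm (2 * (norm (k x))\<^sup>2 + 2 * ((norm (z - lam))\<^sup>2 * (norm (u x))\<^sup>2))" for x
          using norm_add_sq_le[of "k x" "(z - lam) * u x"] by (simp add: norm_mult power_mult_distrib k'_def)
      qed
      have "U + 4 * (1 + m) * tail N c u \<le> (1/2 + m) * U + 1/2 * K"
        using F[OF c(1) s' g k'2] Re_integral_le[OF um ui km k2, of "z - lam"]
        by (simp add: k'_def U_def K_def m_def)
      \<comment> \<open>The case assumption \<open>K \<le> U\<close> lets the right-hand side be
        counted as mass of \<open>u\<close>; the weight \<open>4 * (1 + m)\<close> was chosen to
        leave at most a quarter of \<open>U\<close> in the tail.\<close>
      then have "(1 + m) * (4 * tail N c u) \<le> (1 + m) * U" using True by (simp add: algebra_simps) (use U0 in linarith)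
      then have T: "4 * tail N c u \<le> U" using m0 by simp
      have split: "U = nsq N u + tail N c u"
        unfolding U_def by (rule nsq_split[OF N _ um ui]) (use X c in simp)
      have sv: "sol z k v (\<lambda>x. g x - a * phig z x)" unfolding v_def by (rule sol_minus_phi[OF s])
      have v0: "v 0 = 0" by (simp add: v_def a_def phi(2))
      have kX: "set_integrable \<L> {0<..<X} (\<lambda>x. (norm (k x))\<^sup>2)"
        by (rule Leb.set_integrable_Ioo_subset[OF k2]) (use c in auto)
      have KX: "nsq X k \<le> K"
        unfolding K_def nsq_def by (rule Leb.Ioo_integral_mono_set[OF k2 c(2)]) simp
      have vX: "nsq Y v \<le> V * K" if Y: "0 \<le> Y" "Y \<le> X" for Y
      proof -
        have "nsq Y v \<le> nsq X v" by (rule nsq_mono[OF sol_sq_integrable[OF sv] Y(2)])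
        also have "\<dots> \<le> (LINT x:{0<..<X}|\<L>. (sol_const X (norm z))\<^sup>2 * X * nsq X k)"
          unfolding nsq_def[of X v]
          by (rule set_integral_mono[OF sol_sq_integrable[OF sv]])
            (use sol_bound_nsq[OF sv v0 order.refl _ _ kX] Leb.integrable_const_Ioo in auto)
        also have "\<dots> = V * nsq X k" using Leb_const(2)[of 0 X] X by (simp add: V_def mult_ac)
        also have "\<dots> \<le> V * K" by (rule mult_left_mono[OF KX V0])
        finally show ?thesis .
      qed
      have cmp: "nsq Y u \<le> 2 * (norm a)\<^sup>2 * nsq Y (phi z) + 2 * nsq Y v" for Y
      proof -
        have "nsq Y u \<le> (LINT x:{0<..<Y}|\<L>. 2 * (norm a)\<^sup>2 * (norm (phi z x))\<^sup>2 + 2 * (norm (v x))\<^sup>2)"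
          unfolding nsq_def
        proof (rule set_integral_mono[OF ui])
          show "set_integrable \<L> {0<..<Y} (\<lambda>x. 2 * (norm a)\<^sup>2 * (norm (phi z x))\<^sup>2 + 2 * (norm (v x))\<^sup>2)"
            by (intro set_integral_add(1) set_integrable_mult_right pi sol_sq_integrable[OF sv])
          show "(norm (u x))\<^sup>2 \<le> 2 * (norm a)\<^sup>2 * (norm (phi z x))\<^sup>2 + 2 * (norm (v x))\<^sup>2" for x
            using norm_add_sq_le[of "a * phi z x" "v x"] by (simp add: v_def norm_mult power_mult_distrib)
        qed
        also have "\<dots> = 2 * (norm a)\<^sup>2 * nsq Y (phi z) + 2 * nsq Y v"
          unfolding nsq_def by (rule set_integral_lin[OF pi sol_sq_integrable[OF sv]])
        finally show ?thesis .
      qed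
      have cmp': "(norm a)\<^sup>2 * nsq X (phi z) \<le> 2 * nsq X u + 2 * nsq X v"
      proof -
        have "(norm a)\<^sup>2 * nsq X (phi z) = (LINT x:{0<..<X}|\<L>. (norm (a * phi z x))\<^sup>2)"
          by (simp add: nsq_def norm_mult power_mult_distrib)
        also have "\<dots> \<le> (LINT x:{0<..<X}|\<L>. 2 * (norm (u x))\<^sup>2 + 2 * (norm (v x))\<^sup>2)"
        proof (rule set_integral_mono)
          show "set_integrable \<L> {0<..<X} (\<lambda>x. (norm (a * phi z x))\<^sup>2)"
            unfolding norm_mult power_mult_distrib by (intro set_integrable_mult_right pi)
          show "set_integrable \<L> {0<..<X} (\<lambda>x. 2 * (norm (u x))\<^sup>2 + 2 * (norm (v x))\<^sup>2)"
            by (intro set_integral_add(1) set_integrable_mult_right ui sol_sq_integrable[OF sv])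
          show "(norm (a * phi z x))\<^sup>2 \<le> 2 * (norm (u x))\<^sup>2 + 2 * (norm (v x))\<^sup>2" for x
            using norm_add_sq_le[of "u x" "- v x"] by (simp add: v_def norm_minus_commute[of "a * phi z x" "u x"])
        qed
        also have "\<dots> = 2 * nsq X u + 2 * nsq X v"
          unfolding nsq_def by (rule set_integral_lin[OF ui sol_sq_integrable[OF sv]])
        finally show ?thesis .
      qed
      have uX: "nsq X u \<le> U" unfolding U_def by (rule nsq_mono[OF ui c(2)])
      have "(norm a)\<^sup>2 * (16 * nsq N (phi z)) \<le> (norm a)\<^sup>2 * nsq X (phi z)"
        by (rule mult_left_mono[OF X(3)]) simp
      then have "16 * ((norm a)\<^sup>2 * nsq N (phi z)) \<le> 2 * U + 2 * (V * K)"
        using cmp' uX vX[OF X(2) order.refl] by (simp add: mult_ac)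
      moreover have "nsq N u \<le> 2 * (norm a)\<^sup>2 * nsq N (phi z) + 2 * (V * K)"
        using cmp[of N] vX[OF N X(1)] by simp
      \<comment> \<open>The tail takes at most \<open>U / 4\<close>. The multiple of
        \<open>phi z\<close> on \<open>(0,N)\<close> takes at most another \<open>U / 4\<close> plus
        a multiple of \<open>V * K\<close>, because 16 times its mass is bounded by the mass on
        \<open>(0,X)\<close>. Half of \<open>U\<close> remains on the left.\<close>
      ultimately have "U \<le> 5 * (V * K)" using T split V by linarith
      then show ?thesis using K0 by (simp add: distrib_right)
    qed
    then show ?thesis by (simp add: U_def K_def)
  qed
  show ?thesis
  proof (rule exI[of _ "1 + 5 * V"], rule conjI)
    show "\<exists>c0. \<forall>c k u g. c \<in> supp \<longrightarrow> c0 \<le> c \<longrightarrow> sol z k u g \<longrightarrow> g c = 0 \<longrightarrow>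
      set_integrable \<L> {0<..<c} (\<lambda>x. (norm (k x))\<^sup>2) \<longrightarrow> nsq c u \<le> (1 + 5 * V) * nsq c k"
      by (rule exI[of _ X], intro allI impI, rule main)
  qed (use V0 in simp)
qed

end

section \<open>The limit-point property\<close>

lemma loc_ac_of_real: "loc_ac \<L> complex_of_real (\<lambda>_. 1)"
proof -
  have "(LINT t:{0<..<x}|\<L>. (1::complex)) = of_real x" if "0 \<le> x" for x
    using set_integral_const[of "{0<..<x}" \<L> "1::complex"] Leb.emeasure_Ioo[of x] Leb_measure_Ioo[of 0 x] that
    by (simp add: scaleR_conv_of_real)
  then show ?thesis by (simp add: loc_ac_def Leb.integrable_const_Ioo)
qed

context gaps
begin

text \<open>The cutoff \<open>\<theta>(x) = 1 - x/c\<close> with \<open>c\<close> in the support: \<open>\<theta>\<phi>\<close> has almost the same mass as \<open>\<phi>\<close> on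
  compact sets, while its form exceeds \<open>\<lambda>\<parallel>\<theta>\<phi>\<parallel>\<^sup>2\<close> only by \<open>\<parallel>\<theta>'\<phi>\<parallel>\<^sup>2\<close>.\<close>

lemma cutoff_bound:
  assumes c: "c \<in> supp"
  shows "nsq c (\<lambda>x. of_real (1 - x / c) * phi lam x) \<le> nsq c (phi lam) / c\<^sup>2"
proof -
  have c0: "0 < c" using c supp_pos by auto
  define \<phi> where "\<phi> = phi lam"
  define g where "g = phig lam"
  have s: "sol lam (\<lambda>_. 0) \<phi> g" unfolding \<phi>_def g_def by (rule phi)
  \<comment> \<open>The slope of the cutoff. As \<open>\<theta>\<close> vanishes at
    \<open>c\<close>, no condition on \<open>phi lam\<close> at \<open>c\<close> is needed.\<close>
  define a where "a = - 1 / c"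
  define \<theta> where "\<theta> x = 1 + a * x" for x
  define X where "X x = complex_of_real (\<theta> x)" for x
  have aX: "loc_ac \<L> X (\<lambda>_. of_real a)"
  proof -
    have "loc_ac \<L> (\<lambda>x. 1 + complex_of_real a * of_real x) (\<lambda>_. 0 + complex_of_real a * 1)"
      by (intro loc_ac_add loc_ac_const loc_ac_cmult loc_ac_of_real)
    then show ?thesis by (simp add: X_def[abs_def] \<theta>_def)
  qed
  have \<theta>b: "\<bar>\<theta> x\<bar> \<le> 1" if "0 \<le> x" "x \<le> c" for x
    using that c0 by (auto simp: \<theta>_def a_def field_simps)
  have Xc: "X c = 0" using c0 by (simp add: X_def \<theta>_def a_def)
  \<comment> \<open>The equation is tested with \<open>\<theta>\<^sup>2 \<phi>\<close>: integrating
    \<open>\<phi>\<close> by parts against \<open>G\<close> leaves no boundary terms, since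
    \<open>G\<close> vanishes at \<open>0\<close> and at \<open>c\<close>.\<close>
  define G where "G x = X x * X x * cnj (g x)" for x
  define D where "D x = (of_real a * X x + X x * of_real a) * cnj (g x) + X x * X x * cnj ((of_real (q x) - of_real lam) * \<phi> x - 0)" for x
  have aG: "loc_ac \<L> G D"
    unfolding G_def[abs_def] D_def[abs_def] by (intro loc_ac_mult aX loc_ac_cnj sol_loc_ac'[OF s])
  note pI = P.parts_integrable[OF sol_loc_ac[OF s] aG, of c]
  have id0: "(LINT t:{0<..<c}|P. g t * G t) + (LINT t:{0<..<c}|\<L>. \<phi> t * D t) = 0"
    using P.integration_by_parts[OF sol_loc_ac[OF s] aG, of c] c0 Xc sol_0[OF s] by (simp add: G_def)
  have gG: "g t * G t = of_real ((\<theta> t)\<^sup>2 * (norm (g t))\<^sup>2)" for t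
  proof -
    have "g t * G t = of_real ((\<theta> t)\<^sup>2) * (g t * cnj (g t))" by (simp add: G_def X_def power2_eq_square)
    then show ?thesis by (simp only: complex_norm_square[symmetric] of_real_mult)
  qed
  define u where "u x = X x * \<phi> x" for x
  \<comment> \<open>The Lebesgue density of \<open>u = \<theta>\<phi>\<close> inside the gaps, which
    is all that \<open>coercive\<close> looks at.\<close>
  define h where "h x = X x * g x + of_real a * \<phi> x" for x
  obtain B where B: "\<And>x. 0 \<le> x \<Longrightarrow> x \<le> c \<Longrightarrow> norm (\<phi> x) \<le> B" using sol_loc_bounded[OF s] by blast
  obtain B' where B': "\<And>x. 0 \<le> x \<Longrightarrow> x \<le> c \<Longrightarrow> norm (g x) \<le> B'" using sol_g_loc_bounded[OF s] by blast
  have \<phi>m: "\<phi> \<in> borel_measurable \<L>" and gm: "g \<in> borel_measurable \<L>" and Xm: "X \<in> borel_measurable \<L>"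
    using sol_measurable[OF s] sol_g_measurable[OF s] Leb.loc_ac_measurable[OF aX] by auto
  have um: "u \<in> borel_measurable \<L>" and hm: "h \<in> borel_measurable \<L>"
    unfolding u_def[abs_def] h_def[abs_def] using \<phi>m gm Xm by auto
  have ub: "norm (u x) \<le> B" if "0 \<le> x" "x \<le> c" for x
    using mult_mono[OF \<theta>b[OF that] B[OF that]] by (simp add: u_def X_def norm_mult)
  have hb: "norm (h x) \<le> B' + \<bar>a\<bar> * B" if x: "0 \<le> x" "x \<le> c" for x
  proof -
    have "norm (X x * g x) \<le> B'" using mult_mono[OF \<theta>b[OF x] B'[OF x]] by (simp add: X_def norm_mult)
    moreover have "norm (of_real a * \<phi> x) \<le> \<bar>a\<bar> * B" using B[OF x] by (simp add: norm_mult mult_left_mono)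
    ultimately show ?thesis unfolding h_def by (rule norm_triangle_mono)
  qed
  have seg: "seg (gap_left k) (gap_right k) u h" if k: "\<Delta> k \<subseteq> {0<..<c}" for k
  proof (rule seg_gapI[OF k um ub hm hb])
    fix x y :: real assume xy: "0 < x" "x \<le> y" "{x..<y} \<subseteq> {0<..} - supp"
    note bp = P.integration_by_parts[OF sol_loc_ac[OF s] aX]
    note pi = P.parts_integrable[OF sol_loc_ac[OF s] aX, of y]
    have e: "u x - u 0 = (LINT t:{0<..<x}|P. g t * X t) + (LINT t:{0<..<x}|\<L>. \<phi> t * of_real a)"
      "u y - u 0 = (LINT t:{0<..<y}|P. g t * X t) + (LINT t:{0<..<y}|\<L>. \<phi> t * of_real a)"
      using bp[of x] bp[of y] xy by (simp_all add: u_def mult.commute)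
    have "u y - u x = (u y - u 0) - (u x - u 0)" by simp
    also have "\<dots> = (LINT t:{x..<y}|P. g t * X t) + (LINT t:{x..<y}|\<L>. \<phi> t * of_real a)"
      unfolding e P.Ioo_split[OF pi(1) xy(1,2)] Leb.Ioo_split[OF pi(2) xy(1,2)] by simp
    also have "(LINT t:{x..<y}|P. g t * X t) = (LINT t:{x..<y}|\<L>. g t * X t)"
      by (rule P_eq_Leb_in_gap[OF xy(3) Ico_in_sets[OF xy(1)]]) (use gm Xm in auto)
    also have "(LINT t:{x..<y}|\<L>. g t * X t) + (LINT t:{x..<y}|\<L>. \<phi> t * of_real a) = (LINT t:{x..<y}|\<L>. h t)"
    proof -
      have sub: "{x..<y} \<subseteq> {0<..<y}" using xy by auto
      have "set_integrable \<L> {0<..<y} (\<lambda>t. g t * X t)"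
      proof -
        have "set_integrable \<L> {0<..<y} X"
          by (rule Leb.set_integrable_bounded[OF Xm Leb.loc_ac_bounded[OF aX, of _ y]]) auto
        then show ?thesis
          by (rule Leb.loc_ac_mult_integrable[OF _ gm Leb.loc_ac_bounded[OF sol_loc_ac'[OF s], of _ y]]) auto
      qed
      then have 1: "set_integrable \<L> {x..<y} (\<lambda>t. g t * X t)"
        by (rule Leb.set_integrable_Ioo_subset[OF _ Ico_in_sets[OF xy(1)] sub])
      have 2: "set_integrable \<L> {x..<y} (\<lambda>t. \<phi> t * of_real a)"
        by (rule Leb.set_integrable_Ioo_subset[OF pi(2) Ico_in_sets[OF xy(1)] sub])
      show ?thesis
        unfolding set_integral_add(2)[OF 1 2, symmetric] h_def by (simp add: mult.commute)
    qed
    finally show "u y - u x = (LINT t:{x..<y}|\<L>. h t)" .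
  qed
  obtain N where N: "0 \<le> N" and co: "set_integrable \<L> {0<..<c} (form_density form_const 0 N u h) \<Longrightarrow>
     0 \<le> (LINT x:{0<..<c}|\<L>. form_density form_const 0 N u h x)"
    using form_const(2)[of 0] c seg by blast
  note fd = form_density_integral[OF um ub hm hb N, where C=form_const and M=0]
  have pos: "0 \<le> (1/2) * nsq c h + (LINT x:{0<..<c}|\<L>. q x * (norm (u x))\<^sup>2) + form_const * nsq c u"
    using co[OF fd(1)] fd(2) by simp
  have ui: "set_integrable \<L> {0<..<c} (\<lambda>x. (norm (u x))\<^sup>2)" by (rule bounded_sq_integrable[OF um ub])
  have hi: "set_integrable \<L> {0<..<c} (\<lambda>x. (norm (h x))\<^sup>2)" by (rule bounded_sq_integrable[OF hm hb])
  have qi: "set_integrable \<L> {0<..<c} (\<lambda>x. q x * (norm (u x))\<^sup>2)" by (rule q_sq_integrable[OF um ub])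
  note \<phi>i = sol_sq_integrable[OF s, of c]
  have gi: "set_integrable \<L> {0<..<c} (\<lambda>x. (\<theta> x)\<^sup>2 * (norm (g x))\<^sup>2)"
  proof -
    have "set_integrable \<L> {0<..<c} (\<lambda>x. (norm (X x * g x))\<^sup>2)"
    proof (rule bounded_sq_integrable)
      show "norm (X x * g x) \<le> 1 * B'" if "0 \<le> x" "x \<le> c" for x
        using mult_mono[OF \<theta>b[OF that] B'[OF that]] by (simp add: X_def norm_mult)
    qed (use Xm gm in auto)
    then show ?thesis by (simp add: X_def norm_mult power_mult_distrib)
  qed
  have gP: "set_integrable P {0<..<c} (\<lambda>t. (\<theta> t)\<^sup>2 * (norm (g t))\<^sup>2)"
    "Re (LINT t:{0<..<c}|P. g t * G t) = (LINT t:{0<..<c}|P. (\<theta> t)\<^sup>2 * (norm (g t))\<^sup>2)"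
    using set_integral_Re[OF pI(1)] unfolding gG by simp_all
  \<comment> \<open>The localisation identity: the cross terms complete the square
    \<open>(norm (h t))\<^sup>2\<close>, and the only error is
    \<open>a\<^sup>2 * (norm (\<phi> t))\<^sup>2\<close>.\<close>
  have ptw: "(\<theta> t)\<^sup>2 * (norm (g t))\<^sup>2 + Re (\<phi> t * D t) = ((norm (h t))\<^sup>2 + q t * (norm (u t))\<^sup>2)
      + ((form_const + 1) * (norm (u t))\<^sup>2 + (- (a\<^sup>2)) * (norm (\<phi> t))\<^sup>2)" for t
    unfolding cmod_power2 D_def h_def u_def X_def lam_def
    by (simp add: power2_eq_square algebra_simps)
  have "(LINT t:{0<..<c}|\<L>. (\<theta> t)\<^sup>2 * (norm (g t))\<^sup>2) + (LINT t:{0<..<c}|\<L>. Re (\<phi> t * D t)) =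
     (nsq c h + (LINT x:{0<..<c}|\<L>. q x * (norm (u x))\<^sup>2)) + ((form_const + 1) * nsq c u + (- (a\<^sup>2)) * nsq c \<phi>)"
  proof -
    have 1: "set_integrable \<L> {0<..<c} (\<lambda>t. (form_const + 1) * (norm (u t))\<^sup>2 + (- (a\<^sup>2)) * (norm (\<phi> t))\<^sup>2)"
      by (intro set_integral_add(1) set_integrable_mult_right ui \<phi>i)
    show ?thesis
      unfolding set_integral_add(2)[OF gi set_integral_Re(2)[OF pI(2)], symmetric] ptw
      by (simp only: set_integral_add(2)[OF set_integral_add(1)[OF hi qi] 1] set_integral_add(2)[OF hi qi]
          set_integral_lin[OF ui \<phi>i] nsq_def)
  qed
  moreover have "(LINT t:{0<..<c}|\<L>. (\<theta> t)\<^sup>2 * (norm (g t))\<^sup>2) \<le> (LINT t:{0<..<c}|P. (\<theta> t)\<^sup>2 * (norm (g t))\<^sup>2)"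
  proof (rule Leb_le_P[OF gP(1)])
    have "(\<lambda>x. (norm (X x * g x))\<^sup>2) \<in> borel_measurable \<L>" using Xm gm by auto
    then show "(\<lambda>x. (\<theta> x)\<^sup>2 * (norm (g x))\<^sup>2) \<in> borel_measurable \<L>"
      by (simp add: X_def norm_mult power_mult_distrib)
  qed auto
  moreover have "(LINT t:{0<..<c}|P. (\<theta> t)\<^sup>2 * (norm (g t))\<^sup>2) + (LINT t:{0<..<c}|\<L>. Re (\<phi> t * D t)) = 0"
    using arg_cong[OF id0, of Re] gP(2) set_integral_Re(1)[OF pI(2)] by simp
  ultimately have "nsq c u \<le> a\<^sup>2 * nsq c \<phi>"
    using pos nsq_nonneg[of c h] by (simp add: distrib_right)
  moreover have "u = (\<lambda>x. of_real (1 - x / c) * phi lam x)"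
    by (rule ext) (simp add: u_def X_def \<theta>_def a_def \<phi>_def)
  ultimately show ?thesis by (simp add: a_def \<phi>_def power2_eq_square)
qed

text \<open>For a square integrable \<open>phi lam\<close> the bound of \<open>cutoff_bound\<close>
  decays like \<open>1 / c\<^sup>2\<close>, while the mass on \<open>(0,1)\<close> is fixed and
  positive.\<close>

lemma phi_lam_not_L2: "phi lam \<notin> L2 \<L>"
proof
  assume L2: "phi lam \<in> L2 \<L>"
  define K where "K = (LINT x|\<L>. (norm (phi lam x))\<^sup>2)"
  define \<delta> where "\<delta> = nsq 1 (phi lam)"
  have \<delta>: "0 < \<delta>" unfolding \<delta>_def by (rule phi_nsq_pos) simp
  have K: "nsq c (phi lam) \<le> K" for c unfolding K_def by (rule nsq_le_L2[OF L2])
  \<comment> \<open>\<open>c > 2\<close> keeps the cutoff above 1/2 on \<open>(0,1)\<close>, hence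
    the factor 4; \<open>c > 4 * K / \<delta>\<close> contradicts the resulting
    \<open>\<delta> * c \<le> 4 * K\<close>.\<close>
  obtain c where c: "c \<in> supp" "2 + 4 * K / \<delta> < c" using supp_cofinal by blast
  have K0: "0 \<le> K" using K[of 1] \<delta> by (simp add: \<delta>_def)
  have c2: "2 < c" "4 * K / \<delta> < c" using c(2) K0 \<delta> divide_nonneg_pos[of "4 * K" \<delta>] by linarith+
  define u where "u x = of_real (1 - x / c) * phi lam x" for x
  have um: "set_integrable \<L> {0<..<b} (\<lambda>x. (norm (u x))\<^sup>2)" if "0 \<le> b" "b \<le> c" for b
  proof -
    obtain B where B: "\<And>x. 0 \<le> x \<Longrightarrow> x \<le> b \<Longrightarrow> norm (phi lam x) \<le> B" using sol_loc_bounded[OF phi(1)] by blast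
    show ?thesis
    proof (rule bounded_sq_integrable)
      have [measurable]: "(\<lambda>x. 1 - x / c) \<in> borel_measurable \<L>" by (rule Leb.borel_imp_M) simp
      show "u \<in> borel_measurable \<L>" unfolding u_def using sol_measurable[OF phi(1)] by simp
      show "norm (u x) \<le> 1 * B" if x: "0 \<le> x" "x \<le> b" for x
      proof -
        have "\<bar>1 - x / c\<bar> \<le> 1" using x \<open>b \<le> c\<close> c2 by (auto simp: field_simps)
        from mult_mono[OF this B[OF x]] show ?thesis unfolding u_def norm_mult norm_of_real by simp
      qed
    qed
  qed
  have "\<delta> \<le> 4 * nsq 1 u"
  proof -
    have "\<delta> \<le> (LINT x:{0<..<1}|\<L>. 4 * (norm (u x))\<^sup>2)"
      unfolding \<delta>_def nsq_def
    proof (rule set_integral_mono[OF sol_sq_integrable[OF phi(1)]])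
      show "set_integrable \<L> {0<..<1} (\<lambda>x. 4 * (norm (u x))\<^sup>2)"
        using c2 by (intro set_integrable_mult_right um) auto
      fix x :: real assume x: "x \<in> {0<..<1}"
      then have "1/2 \<le> 1 - x / c" using c2 by (simp add: field_simps)
      then have "(1/2)\<^sup>2 \<le> (1 - x / c)\<^sup>2" by (rule power_mono) simp
      then have "(1/2)\<^sup>2 * (norm (phi lam x))\<^sup>2 \<le> (1 - x / c)\<^sup>2 * (norm (phi lam x))\<^sup>2" by (rule mult_right_mono) simp
      then show "(norm (phi lam x))\<^sup>2 \<le> 4 * (norm (u x))\<^sup>2"
        unfolding u_def norm_mult norm_of_real power_mult_distrib power2_abs by (simp add: power_divide)
    qed
    then show ?thesis by (simp add: nsq_def)
  qed
  also have "nsq 1 u \<le> nsq c u"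
    unfolding nsq_def by (rule Leb.Ioo_integral_mono_set[OF um]) (use c2 in auto)
  also have "nsq c u \<le> K / c\<^sup>2"
    using cutoff_bound[OF c(1)] divide_right_mono[OF K[of c], of "c\<^sup>2"] by (simp add: u_def[abs_def])
  also have "K / c\<^sup>2 \<le> K / c"
    using c2 K0 by (intro divide_left_mono) (auto simp: power2_eq_square)
  finally have "\<delta> * c \<le> 4 * K" using c2 by (simp add: field_simps)
  moreover have "4 * K < \<delta> * c" using c2(2) \<delta> by (simp add: field_simps)
  ultimately show False by simp
qed

definition truncation_bound :: "complex \<Rightarrow> real \<Rightarrow> real \<Rightarrow> bool" where
  "truncation_bound z C c0 \<longleftrightarrow> 0 < C \<and> (\<forall>c k u g. c \<in> supp \<longrightarrow> c0 \<le> c \<longrightarrow> sol z k u g \<longrightarrow> g c = 0 \<longrightarrow>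
    set_integrable \<L> {0<..<c} (\<lambda>x. (norm (k x))\<^sup>2) \<longrightarrow> nsq c u \<le> C * nsq c k)"

lemma truncation_bound: "phi z \<notin> L2 \<L> \<Longrightarrow> \<exists>C c0. truncation_bound z C c0"
  using truncated_bound[of z] unfolding truncation_bound_def by blast

text \<open>Solutions on \<open>(0,c\<^sub>n)\<close> with Neumann conditions at both ends differ by multiples of \<open>\<phi>\<^sub>z\<close>, so
  a bound on \<open>(0,1)\<close> already yields a convergent subsequence.\<close>

lemma limit_solution:
  fixes c :: "nat \<Rightarrow> real"
  assumes tb: "truncation_bound z C c0" and k: "k \<in> L2 \<L>"
    and c: "\<And>n. c n \<in> supp" "filterlim c at_top sequentially"
  shows "\<exists>r u g b. strict_mono r \<and> sol z k u g \<and> b \<longlonglongrightarrow> 0 \<and>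
    (\<forall>n. let U = (\<lambda>x. u x + b n * phi z x); G = (\<lambda>x. g x + b n * phig z x) in
      sol z k U G \<and> G (c (r n)) = 0 \<and> nsq (c (r n)) U \<le> C * (LINT x|\<L>. (norm (k x))\<^sup>2))"
proof -
  define K where "K = (LINT x|\<L>. (norm (k x))\<^sup>2)"
  have C: "0 < C" and tb': "\<And>c k u g. c \<in> supp \<Longrightarrow> c0 \<le> c \<Longrightarrow> sol z k u g \<Longrightarrow> g c = 0 \<Longrightarrow>
    set_integrable \<L> {0<..<c} (\<lambda>x. (norm (k x))\<^sup>2) \<Longrightarrow> nsq c u \<le> C * nsq c k"
    using tb unfolding truncation_bound_def by blast+
  have k2: "set_integrable \<L> {0<..<x} (\<lambda>x. (norm (k x))\<^sup>2)" for x
    by (rule L2_set_integrable[OF k]) simp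
  have kl: "set_integrable \<L> {0<..<x} k" for x
    by (rule sq_integrable_imp_integrable[OF k2]) (use k in \<open>simp add: L2_def\<close>)
  obtain w wg where w: "sol z k w wg" "w 0 = 0" using sol_exists[OF kl, of z 0] by blast
  have "eventually (\<lambda>n. max c0 1 \<le> c n) sequentially"
    using c(2) unfolding filterlim_at_top by blast
  then obtain n0 where n0: "\<And>n. n0 \<le> n \<Longrightarrow> max c0 1 \<le> c n" by (auto simp: eventually_sequentially)
  define e where "e n = c (n + n0)" for n
  have e: "e n \<in> supp" "c0 \<le> e n" "1 \<le> e n" for n
    using c(1) n0[of "n + n0"] by (auto simp: e_def)
  \<comment> \<open>Otherwise \<open>phi z\<close> would satisfy both Neumann conditions with
    right-hand side zero, and the truncation bound would annihilate it.\<close>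
  have nz: "phig z (e n) \<noteq> 0" for n
  proof
    assume "phig z (e n) = 0"
    then have "nsq (e n) (phi z) \<le> C * nsq (e n) (\<lambda>_. 0)"
      by (intro tb'[OF e(1,2) phi(1)]) (simp_all add: set_integrable_def)
    also have "nsq (e n) (\<lambda>_. 0) = 0" by (simp add: nsq_def)
    finally show False using phi_nsq_pos[of "e n" z] e(3)[of n] by simp
  qed
  \<comment> \<open>Shooting: the multiple of \<open>phi z\<close> that repairs the Neumann
    condition at \<open>e n\<close>.\<close>
  define a where "a n = - wg (e n) / phig z (e n)" for n
  have U: "sol z k (\<lambda>x. w x + a n * phi z x) (\<lambda>x. wg x + a n * phig z x)" for n
    using sol_lincomb[OF w(1) phi(1), of "a n"] by simp
  have G0: "wg (e n) + a n * phig z (e n) = 0" for n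
    using nz[of n] by (simp add: a_def)
  have UK: "nsq (e n) (\<lambda>x. w x + a n * phi z x) \<le> C * K" for n
  proof -
    have "nsq (e n) (\<lambda>x. w x + a n * phi z x) \<le> C * nsq (e n) k"
      by (rule tb'[OF e(1,2) U G0 k2])
    also have "\<dots> \<le> C * K" unfolding K_def using nsq_le_L2[OF k] C by (intro mult_left_mono) auto
    finally show ?thesis .
  qed
  define \<delta> where "\<delta> = nsq 1 (phi z)"
  have \<delta>: "0 < \<delta>" unfolding \<delta>_def by (rule phi_nsq_pos) simp
  \<comment> \<open>On \<open>(0,1)\<close> the function \<open>a n * phi z\<close> is a difference
    of two functions of bounded mass; dividing by the mass of \<open>phi z\<close> there bounds the
    coefficient.\<close>
  define A where "A = (2 * (C * K) + 2 * nsq 1 w) / \<delta>"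
  have "(norm (a n))\<^sup>2 \<le> A" for n
  proof -
    have "(norm (a n))\<^sup>2 * \<delta> = (LINT x:{0<..<1}|\<L>. (norm (a n * phi z x))\<^sup>2)"
      by (simp add: \<delta>_def nsq_def norm_mult power_mult_distrib)
    also have "\<dots> \<le> (LINT x:{0<..<1}|\<L>. 2 * (norm (w x + a n * phi z x))\<^sup>2 + 2 * (norm (w x))\<^sup>2)"
    proof (rule set_integral_mono)
      show "set_integrable \<L> {0<..<1} (\<lambda>x. (norm (a n * phi z x))\<^sup>2)"
        unfolding norm_mult power_mult_distrib
        by (intro set_integrable_mult_right sol_sq_integrable[OF phi(1)])
      show "set_integrable \<L> {0<..<1} (\<lambda>x. 2 * (norm (w x + a n * phi z x))\<^sup>2 + 2 * (norm (w x))\<^sup>2)"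
        by (intro set_integral_add(1) set_integrable_mult_right sol_sq_integrable[OF U] sol_sq_integrable[OF w(1)])
      show "(norm (a n * phi z x))\<^sup>2 \<le> 2 * (norm (w x + a n * phi z x))\<^sup>2 + 2 * (norm (w x))\<^sup>2" for x
        using norm_add_sq_le[of "w x + a n * phi z x" "- w x"] by simp
    qed
    also have "\<dots> = 2 * nsq 1 (\<lambda>x. w x + a n * phi z x) + 2 * nsq 1 w"
      unfolding nsq_def by (rule set_integral_lin[OF sol_sq_integrable[OF U] sol_sq_integrable[OF w(1)]])
    also have "nsq 1 (\<lambda>x. w x + a n * phi z x) \<le> nsq (e n) (\<lambda>x. w x + a n * phi z x)"
      by (rule nsq_mono[OF sol_sq_integrable[OF U] e(3)])
    also have "\<dots> \<le> C * K" by (rule UK)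
    finally show ?thesis using \<delta> by (simp add: A_def field_simps)
  qed
  then have "bounded (range a)"
    unfolding bounded_iff by (auto intro!: exI[of _ "sqrt A"] real_le_rsqrt)
  then obtain \<alpha> s where s: "strict_mono s" "(a \<circ> s) \<longlonglongrightarrow> \<alpha>"
    using bounded_imp_convergent_subsequence by blast
  define b where "b n = a (s n) - \<alpha>" for n
  have b: "b \<longlonglongrightarrow> 0"
    using s(2) unfolding b_def[abs_def] comp_def by (simp add: LIM_zero)
  have eqU: "(\<lambda>x. w x + \<alpha> * phi z x + b n * phi z x) = (\<lambda>x. w x + a (s n) * phi z x)"
    and eqG: "(\<lambda>x. wg x + \<alpha> * phig z x + b n * phig z x) = (\<lambda>x. wg x + a (s n) * phig z x)" for n
    by (auto simp: b_def algebra_simps)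
  have G0': "wg (c (s n + n0)) + a (s n) * phig z (c (s n + n0)) = 0"
    and UK': "nsq (c (s n + n0)) (\<lambda>x. w x + a (s n) * phi z x) \<le> C * K" for n
    using G0[of "s n"] UK[of "s n"] by (simp_all add: e_def)
  have u: "sol z k (\<lambda>x. w x + \<alpha> * phi z x) (\<lambda>x. wg x + \<alpha> * phig z x)"
    using sol_lincomb[OF w(1) phi(1), of \<alpha>] by simp
  have r: "strict_mono (\<lambda>n. s n + n0)" using s(1) by (auto simp: strict_mono_def)
  show ?thesis
    apply (rule exI[of _ "\<lambda>n. s n + n0"])
    apply (rule exI[of _ "\<lambda>x. w x + \<alpha> * phi z x"])
    apply (rule exI[of _ "\<lambda>x. wg x + \<alpha> * phig z x"])
    apply (rule exI[of _ b])
    unfolding Let_def K_def[symmetric] eqU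
    using r u b U G0' UK' by (simp add: fun_cong[OF eqG] eqG)
qed

end

section \<open>Solutions in \<open>L\<^sup>2\<close>\<close>

lemma L2_measurable: "f \<in> L2 M \<Longrightarrow> f \<in> borel_measurable M"
  and L2_sq_integrable: "f \<in> L2 M \<Longrightarrow> integrable M (\<lambda>x. (norm (f x))\<^sup>2)"
  by (simp_all add: L2_def)

lemma L2_add:
  assumes f: "f \<in> L2 M" and g: "g \<in> L2 M"
  shows "(\<lambda>x. f x + a * g x) \<in> L2 M"
proof -
  note [measurable] = L2_measurable[OF f] L2_measurable[OF g]
  have "integrable M (\<lambda>x. (norm (f x + a * g x))\<^sup>2)"
  proof (rule Bochner_Integration.integrable_bound)
    show "integrable M (\<lambda>x. 2 * (norm (f x))\<^sup>2 + 2 * ((norm a)\<^sup>2 * (norm (g x))\<^sup>2))"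
      using L2_sq_integrable[OF f] L2_sq_integrable[OF g] by simp
    show "AE x in M. norm ((norm (f x + a * g x))\<^sup>2) \<le> norm (2 * (norm (f x))\<^sup>2 + 2 * ((norm a)\<^sup>2 * (norm (g x))\<^sup>2))"
    proof (rule AE_I2)
      fix x
      show "norm ((norm (f x + a * g x))\<^sup>2) \<le> norm (2 * (norm (f x))\<^sup>2 + 2 * ((norm a)\<^sup>2 * (norm (g x))\<^sup>2))"
        using norm_add_sq_le[of "f x" "a * g x"] by (simp add: norm_mult power_mult_distrib)
    qed
  qed measurable
  then show ?thesis by (simp add: L2_def)
qed

lemma L2_zero: "(\<lambda>_. 0) \<in> L2 M"
  by (simp add: L2_def)

lemma L2_cmult: "g \<in> L2 M \<Longrightarrow> (\<lambda>x. a * g x) \<in> L2 M"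
  using L2_add[OF L2_zero, of g M a] by simp

lemma L2_diff: "f \<in> L2 M \<Longrightarrow> g \<in> L2 M \<Longrightarrow> (\<lambda>x. f x - g x) \<in> L2 M"
  using L2_add[of f M g "-1"] by simp

lemma L2_AE_cong:
  assumes "f \<in> L2 M" "g \<in> borel_measurable M" "AE x in M. f x = g x"
  shows "g \<in> L2 M"
proof -
  have "integrable M (\<lambda>x. (norm (g x))\<^sup>2)"
    by (rule integrable_cong_AE_imp[OF L2_sq_integrable[OF assms(1)]]) (use assms in auto)
  then show ?thesis using assms by (simp add: L2_def)
qed

lemma L2_inner_integrable:
  assumes f: "f \<in> L2 M" and g: "g \<in> L2 M"
  shows "integrable M (\<lambda>x. f x * cnj (g x))"
proof (rule Bochner_Integration.integrable_bound)
  show "integrable M (\<lambda>x. (norm (f x))\<^sup>2 + (norm (g x))\<^sup>2)"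
    using L2_sq_integrable[OF f] L2_sq_integrable[OF g] by simp
  show "(\<lambda>x. f x * cnj (g x)) \<in> borel_measurable M"
    using L2_measurable[OF f] L2_measurable[OF g] by simp
  show "AE x in M. norm (f x * cnj (g x)) \<le> norm ((norm (f x))\<^sup>2 + (norm (g x))\<^sup>2)"
  proof (rule AE_I2)
    fix x
    show "norm (f x * cnj (g x)) \<le> norm ((norm (f x))\<^sup>2 + (norm (g x))\<^sup>2)"
    proof -
      have "0 \<le> norm (f x) * norm (g x)" by simp
      then have "norm (f x) * norm (g x) \<le> (norm (f x))\<^sup>2 + (norm (g x))\<^sup>2"
        using sum_squares_bound[of "norm (f x)" "norm (g x)"] by linarith
      then show ?thesis by (simp add: norm_mult)
    qed
  qed
qed

lemma L2_inner_add_left: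
  assumes "f \<in> L2 M" "g \<in> L2 M" "h \<in> L2 M"
  shows "L2_inner M (\<lambda>x. f x + a * g x) h = L2_inner M f h + a * L2_inner M g h"
proof -
  have "(\<lambda>x. (f x + a * g x) * cnj (h x)) = (\<lambda>x. f x * cnj (h x) + a * (g x * cnj (h x)))"
    by (auto simp: algebra_simps)
  then show ?thesis
    using L2_inner_integrable[OF assms(1,3)] L2_inner_integrable[OF assms(2,3)] by (simp add: L2_inner_def)
qed

lemma L2_inner_commute: "L2_inner M f g = cnj (L2_inner M g f)"
  unfolding L2_inner_def Bochner_Integration.integral_cnj[symmetric] by (simp add: mult.commute)

lemma L2_inner_add_right:
  assumes "f \<in> L2 M" "g \<in> L2 M" "h \<in> L2 M"
  shows "L2_inner M h (\<lambda>x. f x + a * g x) = L2_inner M h f + cnj a * L2_inner M h g"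
  using L2_inner_add_left[OF assms, of a] by (subst (1 2 3) L2_inner_commute) simp

lemma L2_inner_self: "L2_inner M f f = of_real (LINT x|M. (norm (f x))\<^sup>2)"
proof -
  have eq: "f x * cnj (f x) = of_real ((norm (f x))\<^sup>2)" for x by (rule complex_norm_square[symmetric])
  show ?thesis unfolding L2_inner_def eq by (rule integral_complex_of_real)
qed

lemma L2_inner_cong_AE:
  assumes "AE x in M. f x = f' x" "AE x in M. g x = g' x"
    "f \<in> borel_measurable M" "f' \<in> borel_measurable M" "g \<in> borel_measurable M" "g' \<in> borel_measurable M"
  shows "L2_inner M f g = L2_inner M f' g'"
  unfolding L2_inner_def by (rule integral_cong_AE) (use assms in auto)

lemma L2_norm_sq: "(L2_norm M f)\<^sup>2 = (LINT x|M. (norm (f x))\<^sup>2)"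
  by (simp add: L2_norm_def)

lemma L2_AE_zero:
  assumes "f \<in> L2 M" "(LINT x|M. (norm (f x))\<^sup>2) \<le> 0"
  shows "AE x in M. f x = 0"
proof -
  have "(LINT x|M. (norm (f x))\<^sup>2) = 0"
    by (rule antisym[OF assms(2)]) (rule integral_nonneg_AE, simp)
  then show ?thesis using integral_nonneg_eq_0_iff_AE[OF L2_sq_integrable[OF assms(1)]] by simp
qed

lemma nsq_approx_L2:
  assumes k: "k \<in> L2 \<L>" and "0 < \<delta>"
  shows "\<exists>X\<ge>0. (LINT x|\<L>. (norm (k x))\<^sup>2) - nsq X k < \<delta>"
proof (rule ccontr)
  assume "\<not> ?thesis"
  then have *: "nsq X k \<le> (LINT x|\<L>. (norm (k x))\<^sup>2) - \<delta>" if "0 \<le> X" for X using that by force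
  have "nsq X k \<le> (LINT x|\<L>. (norm (k x))\<^sup>2) - \<delta>" for X
    using *[of X] *[of 0] by (cases "0 \<le> X") (auto simp: nsq_def)
  from L2_if_nsq_bounded(2)[OF L2_measurable[OF k] L2_set_integrable[OF k] this]
  show False using assms(2) by simp
qed

text \<open>Beyond a large \<open>X\<close> the mass of \<open>k\<close> is negligible and the
  \<open>d n\<close> are bounded, so only the integral over \<open>(0,X)\<close> decides.\<close>

lemma weak_limit_0:
  assumes d: "\<And>n. d n \<in> L2 \<L>" "\<And>n. (LINT x|\<L>. (norm (d n x))\<^sup>2) \<le> K" and k: "k \<in> L2 \<L>"
    and loc: "\<And>X. (\<lambda>n. LINT x:{0<..<X}|\<L>. d n x * cnj (k x)) \<longlonglongrightarrow> 0"
  shows "(\<lambda>n. L2_inner \<L> (d n) k) \<longlonglongrightarrow> 0"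
proof (rule LIMSEQ_I)
  fix e :: real assume e: "0 < e"
  have K: "0 \<le> K" by (rule order_trans[OF _ d(2)[of 0]]) (rule integral_nonneg_AE, simp)
  \<comment> \<open>Weight of the arithmetic-geometric inequality: its two terms, at most
    \<open>\<delta> * K / 2\<close> and \<open>\<delta> / 2\<close>, add up to
    \<open>e / 2\<close>.\<close>
  define \<delta> where "\<delta> = e / (K + 1)"
  have \<delta>: "0 < \<delta>" using e K by (simp add: \<delta>_def)
  obtain X where X: "0 \<le> X" "(LINT x|\<L>. (norm (k x))\<^sup>2) - nsq X k < \<delta>\<^sup>2"
    using nsq_approx_L2[OF k, of "\<delta>\<^sup>2"] \<delta> by auto
  define I where "I n = (LINT x:{0<..<X}|\<L>. d n x * cnj (k x))" for n
  have far: "norm (L2_inner \<L> (d n) k - I n) \<le> e / 2" for n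
  proof -
    note i1 = L2_inner_integrable[OF d(1)[of n] k]
    have i2: "integrable \<L> (\<lambda>x. indicator {0<..<X} x *\<^sub>R (d n x * cnj (k x)))"
      by (rule integrable_mult_indicator[OF Leb.Ioo_sets i1])
    note i3 = L2_sq_integrable[OF d(1)[of n]] and i4 = L2_sq_integrable[OF k]
    have i5: "integrable \<L> (\<lambda>x. indicator {0<..<X} x *\<^sub>R (norm (k x))\<^sup>2)"
      by (rule integrable_mult_indicator[OF Leb.Ioo_sets i4])
    have "L2_inner \<L> (d n) k - I n = (LINT x|\<L>. d n x * cnj (k x) - indicator {0<..<X} x *\<^sub>R (d n x * cnj (k x)))"
      unfolding L2_inner_def I_def set_lebesgue_integral_def
      by (rule Bochner_Integration.integral_diff[symmetric, OF i1 i2])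
    also have "norm \<dots> \<le> (LINT x|\<L>. norm (d n x * cnj (k x) - indicator {0<..<X} x *\<^sub>R (d n x * cnj (k x))))"
      by (rule integral_norm_bound)
    also have "\<dots> \<le> (LINT x|\<L>. \<delta> / 2 * (norm (d n x))\<^sup>2 + 1 / (2 * \<delta>) * ((norm (k x))\<^sup>2 - indicator {0<..<X} x *\<^sub>R (norm (k x))\<^sup>2))"
    proof (rule integral_mono)
      show "integrable \<L> (\<lambda>x. norm (d n x * cnj (k x) - indicator {0<..<X} x *\<^sub>R (d n x * cnj (k x))))"
        by (intro integrable_norm Bochner_Integration.integrable_diff i1 i2)
      show "integrable \<L> (\<lambda>x. \<delta> / 2 * (norm (d n x))\<^sup>2 + 1 / (2 * \<delta>) * ((norm (k x))\<^sup>2 - indicator {0<..<X} x *\<^sub>R (norm (k x))\<^sup>2))"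
        by (intro Bochner_Integration.integrable_add integrable_mult_right Bochner_Integration.integrable_diff i3 i4 i5)
      fix x
      show "norm (d n x * cnj (k x) - indicator {0<..<X} x *\<^sub>R (d n x * cnj (k x)))
         \<le> \<delta> / 2 * (norm (d n x))\<^sup>2 + 1 / (2 * \<delta>) * ((norm (k x))\<^sup>2 - indicator {0<..<X} x *\<^sub>R (norm (k x))\<^sup>2)"
      proof (cases "x \<in> {0<..<X}")
        case True
        then show ?thesis using \<delta> by simp
      next
        case False
        have "0 \<le> (\<delta> * norm (d n x) - norm (k x))\<^sup>2" by simp
        then have "2 * \<delta> * (norm (d n x) * norm (k x)) \<le> 2 * \<delta> * (\<delta> / 2 * (norm (d n x))\<^sup>2 + 1 / (2 * \<delta>) * (norm (k x))\<^sup>2)"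
          using \<delta> by (simp add: power2_eq_square algebra_simps)
        then have "norm (d n x) * norm (k x) \<le> \<delta> / 2 * (norm (d n x))\<^sup>2 + 1 / (2 * \<delta>) * (norm (k x))\<^sup>2"
          using \<delta> by (subst (asm) mult_le_cancel_left_pos) auto
        then show ?thesis using False by (simp add: norm_mult)
      qed
    qed
    also have "\<dots> = \<delta> / 2 * (LINT x|\<L>. (norm (d n x))\<^sup>2) + 1 / (2 * \<delta>) * ((LINT x|\<L>. (norm (k x))\<^sup>2) - nsq X k)"
      using i3 i4 i5 by (simp only: Bochner_Integration.integral_add integrable_mult_right Bochner_Integration.integrable_diff
          Bochner_Integration.integral_diff integral_mult_right_zero nsq_def set_lebesgue_integral_def)
    also have "\<dots> \<le> \<delta> / 2 * K + 1 / (2 * \<delta>) * \<delta>\<^sup>2"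
      using d(2)[of n] X \<delta> by (intro add_mono mult_left_mono) auto
    also have "\<dots> = \<delta> * (K + 1) / 2" using \<delta> by (simp add: power2_eq_square field_simps)
    also have "\<dots> = e / 2" using K by (simp add: \<delta>_def)
    finally show ?thesis .
  qed
  obtain n0 where n0: "\<And>n. n0 \<le> n \<Longrightarrow> norm (I n) < e / 2"
    using LIMSEQ_D[OF loc[of X], of "e / 2"] e by (auto simp: I_def)
  show "\<exists>no. \<forall>n\<ge>no. norm (L2_inner \<L> (d n) k - 0) < e"
  proof (intro exI[of _ n0] allI impI)
    fix n assume "n0 \<le> n"
    then show "norm (L2_inner \<L> (d n) k - 0) < e"
      using norm_triangle_ineq[of "L2_inner \<L> (d n) k - I n" "I n"] far[of n] n0[of n] by simp
  qed
qed

context gaps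
begin

text \<open>The truncated solutions differ from \<open>u\<close> by \<open>b n * phi z\<close>,
  whose mass on a bounded set tends to zero. The crude factor 2 saves a discussion of convergence of
  norms.\<close>

lemma approx_sq:
  assumes u: "sol z k u g" and S: "S \<in> sets \<L>" "S \<subseteq> {0<..<X}"
    and b: "b \<longlonglongrightarrow> (0::complex)" and K: "\<forall>\<^sub>F n in sequentially. (LINT x:S|\<L>. (norm (u x + b n * phi z x))\<^sup>2) \<le> K"
  shows "(LINT x:S|\<L>. (norm (u x))\<^sup>2) \<le> 2 * K"
proof -
  have U: "sol z k (\<lambda>x. u x + b n * phi z x) (\<lambda>x. g x + b n * phig z x)" for n
    using sol_lincomb[OF u phi(1), of "b n"] by simp
  note iu = Leb.set_integrable_Ioo_subset[OF sol_sq_integrable[OF u] S]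
  note ip = Leb.set_integrable_Ioo_subset[OF sol_sq_integrable[OF phi(1)] S]
  note iU = Leb.set_integrable_Ioo_subset[OF sol_sq_integrable[OF U] S]
  define F where "F = (LINT x:S|\<L>. (norm (phi z x))\<^sup>2)"
  have le: "(LINT x:S|\<L>. (norm (u x))\<^sup>2) \<le> 2 * (LINT x:S|\<L>. (norm (u x + b n * phi z x))\<^sup>2) + 2 * (norm (b n))\<^sup>2 * F" for n
  proof -
    have "(LINT x:S|\<L>. (norm (u x))\<^sup>2) \<le> (LINT x:S|\<L>. 2 * (norm (u x + b n * phi z x))\<^sup>2 + 2 * (norm (b n))\<^sup>2 * (norm (phi z x))\<^sup>2)"
    proof (rule set_integral_mono[OF iu])
      show "set_integrable \<L> S (\<lambda>x. 2 * (norm (u x + b n * phi z x))\<^sup>2 + 2 * (norm (b n))\<^sup>2 * (norm (phi z x))\<^sup>2)"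
        by (intro set_integral_add(1) set_integrable_mult_right iU ip)
      show "(norm (u x))\<^sup>2 \<le> 2 * (norm (u x + b n * phi z x))\<^sup>2 + 2 * (norm (b n))\<^sup>2 * (norm (phi z x))\<^sup>2" for x
        using norm_add_sq_le[of "u x + b n * phi z x" "- b n * phi z x"] by (simp add: norm_mult power_mult_distrib)
    qed
    also have "\<dots> = 2 * (LINT x:S|\<L>. (norm (u x + b n * phi z x))\<^sup>2) + 2 * (norm (b n))\<^sup>2 * F"
      unfolding F_def by (rule set_integral_lin[OF iU ip])
    finally show ?thesis .
  qed
  have "(\<lambda>n. 2 * K + 2 * (norm (b n))\<^sup>2 * F) \<longlonglongrightarrow> 2 * K + 2 * (norm (0::complex))\<^sup>2 * F"
    by (intro tendsto_intros b)
  moreover have "\<forall>\<^sub>F n in sequentially. (LINT x:S|\<L>. (norm (u x))\<^sup>2) \<le> 2 * K + 2 * (norm (b n))\<^sup>2 * F"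
    using K
  proof eventually_elim
    case (elim n)
    then show ?case using le[of n] by linarith
  qed
  ultimately show ?thesis
    using tendsto_lowerbound[of "\<lambda>n. 2 * K + 2 * (norm (b n))\<^sup>2 * F" _ sequentially] by simp
qed

lemma approx_nsq_L2:
  assumes u: "sol z k u g" and b: "b \<longlonglongrightarrow> (0::complex)" and c: "filterlim c at_top sequentially"
    and K: "\<And>n. nsq (c n) (\<lambda>x. u x + b n * phi z x) \<le> K"
  shows "u \<in> L2 \<L>" "(LINT x|\<L>. (norm (u x))\<^sup>2) \<le> 2 * K"
proof -
  have U: "sol z k (\<lambda>x. u x + b n * phi z x) (\<lambda>x. g x + b n * phig z x)" for n
    using sol_lincomb[OF u phi(1), of "b n"] by simp
  have "nsq X u \<le> 2 * K" for X
    unfolding nsq_def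
  proof (rule approx_sq[OF u _ order.refl b])
    have "eventually (\<lambda>n. X \<le> c n) sequentially" using c unfolding filterlim_at_top by blast
    then show "\<forall>\<^sub>F n in sequentially. (LINT x:{0<..<X}|\<L>. (norm (u x + b n * phi z x))\<^sup>2) \<le> K"
    proof eventually_elim
      case (elim n)
      then show ?case using nsq_mono[OF sol_sq_integrable[OF U] elim, of n] K[of n] by (simp add: nsq_def)
    qed
  qed simp
  from L2_if_nsq_bounded[OF sol_measurable[OF u] sol_sq_integrable[OF u] this]
  show "u \<in> L2 \<L>" "(LINT x|\<L>. (norm (u x))\<^sup>2) \<le> 2 * K" by auto
qed

text \<open>Extended by zero, the truncated solutions are bounded in \<open>L2\<close> and tend to
  \<open>u\<close> on bounded intervals, hence converge weakly.\<close>

lemma approx_inner: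
  assumes u: "sol z k u g" and b: "b \<longlonglongrightarrow> (0::complex)" and c: "filterlim c at_top sequentially"
    and K: "\<And>n. nsq (c n) (\<lambda>x. u x + b n * phi z x) \<le> K" and l: "l \<in> L2 \<L>"
  shows "(\<lambda>n. LINT x:{0<..<c n}|\<L>. (u x + b n * phi z x) * cnj (l x)) \<longlonglongrightarrow> L2_inner \<L> u l"
proof -
  have U: "sol z k (\<lambda>x. u x + b n * phi z x) (\<lambda>x. g x + b n * phig z x)" for n
    using sol_lincomb[OF u phi(1), of "b n"] by simp
  note uL = approx_nsq_L2[OF u b c K]
  define f where "f n x = indicator {0<..<c n} x *\<^sub>R (u x + b n * phi z x)" for n x
  have f2: "(\<lambda>x. (norm (f n x))\<^sup>2) = (\<lambda>x. indicator {0<..<c n} x *\<^sub>R (norm (u x + b n * phi z x))\<^sup>2)" for n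
    by (auto simp: f_def indicator_def)
  have fL: "f n \<in> L2 \<L>" for n
    unfolding L2_def f2 mem_Collect_eq
    using sol_sq_integrable[OF U[of n], of "c n"] sol_measurable[OF U[of n]]
    by (simp add: set_integrable_def f_def[abs_def])
  have fK: "(LINT x|\<L>. (norm (f n x))\<^sup>2) \<le> K" for n
    unfolding f2 using K[of n] by (simp add: nsq_def set_lebesgue_integral_def)
  have "(\<lambda>n. L2_inner \<L> (\<lambda>x. f n x - u x) l) \<longlonglongrightarrow> 0"
  proof (rule weak_limit_0[OF L2_diff[OF fL uL(1)] _ l])
    show "(LINT x|\<L>. (norm (f n x - u x))\<^sup>2) \<le> 2 * K + 2 * (2 * K)" for n
    proof -
      note i = L2_sq_integrable[OF fL[of n]] L2_sq_integrable[OF uL(1)]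
      have "(LINT x|\<L>. (norm (f n x - u x))\<^sup>2) \<le> (LINT x|\<L>. 2 * (norm (f n x))\<^sup>2 + 2 * (norm (u x))\<^sup>2)"
      proof (rule integral_mono)
        show "integrable \<L> (\<lambda>x. (norm (f n x - u x))\<^sup>2)" by (rule L2_sq_integrable[OF L2_diff[OF fL uL(1)]])
        show "(norm (f n x - u x))\<^sup>2 \<le> 2 * (norm (f n x))\<^sup>2 + 2 * (norm (u x))\<^sup>2" for x
          using norm_add_sq_le[of "f n x" "- u x"] by simp
      qed (use i in simp)
      also have "\<dots> = 2 * (LINT x|\<L>. (norm (f n x))\<^sup>2) + 2 * (LINT x|\<L>. (norm (u x))\<^sup>2)" using i by simp
      finally show ?thesis using fK[of n] uL(2) by linarith
    qed
    fix X
    define J where "J = (LINT x:{0<..<X}|\<L>. phi z x * cnj (l x))"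
    have "(\<lambda>n. b n * J) \<longlonglongrightarrow> 0 * J" by (intro tendsto_intros b)
    moreover have "\<forall>\<^sub>F n in sequentially. b n * J = (LINT x:{0<..<X}|\<L>. (f n x - u x) * cnj (l x))"
    proof -
      have "eventually (\<lambda>n. X \<le> c n) sequentially" using c unfolding filterlim_at_top by blast
      then show ?thesis
      proof eventually_elim
        case (elim n)
        have "b n * J = (LINT x:{0<..<X}|\<L>. b n * (phi z x * cnj (l x)))" by (simp add: J_def)
        also have "\<dots> = (LINT x:{0<..<X}|\<L>. (f n x - u x) * cnj (l x))"
          by (rule set_lebesgue_integral_cong) (use elim in \<open>auto simp: f_def mult.assoc\<close>)
        finally show ?case .
      qed
    qed
    ultimately show "(\<lambda>n. LINT x:{0<..<X}|\<L>. (f n x - u x) * cnj (l x)) \<longlonglongrightarrow> 0"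
      using Lim_transform_eventually by fastforce
  qed
  moreover have "L2_inner \<L> (\<lambda>x. f n x - u x) l = L2_inner \<L> (f n) l - L2_inner \<L> u l" for n
    using L2_inner_add_left[OF fL uL(1) l, of n "-1"] by simp
  ultimately have "(\<lambda>n. L2_inner \<L> (f n) l) \<longlonglongrightarrow> L2_inner \<L> u l"
    by (simp add: LIM_zero_iff)
  moreover have "L2_inner \<L> (f n) l = (LINT x:{0<..<c n}|\<L>. (u x + b n * phi z x) * cnj (l x))" for n
    unfolding L2_inner_def set_lebesgue_integral_def f_def by simp
  ultimately show ?thesis by simp
qed

lemma supp_sequence: "\<exists>c. (\<forall>n. c n \<in> supp) \<and> filterlim c at_top sequentially"
proof -
  have "\<forall>n::nat. \<exists>c. c \<in> supp \<and> real n < c" using supp_cofinal by blast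
  then obtain c where c: "\<And>n::nat. c n \<in> supp \<and> real n < c n" by metis
  have "filterlim c at_top sequentially"
    by (rule filterlim_at_top_mono[OF filterlim_real_sequentially]) (use c in \<open>auto intro!: always_eventually less_imp_le\<close>)
  then show ?thesis using c by blast
qed

text \<open>The difference is a square integrable multiple of \<open>phi z\<close>, so the
  coefficient must be zero.\<close>

lemma sol_L2_unique:
  assumes "phi z \<notin> L2 \<L>" "sol z k u g" "sol z k v h" "u \<in> L2 \<L>" "v \<in> L2 \<L>" "0 \<le> x"
  shows "u x = v x"
proof -
  define \<alpha> where "\<alpha> = u 0 - v 0"
  have s0: "sol z (\<lambda>_. 0) (\<lambda>x. u x - v x) (\<lambda>x. g x - h x)"
    using sol_lincomb[OF assms(2,3), of "-1"] by simp
  have eq: "u x - v x = \<alpha> * phi z x" if "0 \<le> x" for x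
    unfolding \<alpha>_def by (rule sol_0_eq_phi[OF s0 that])
  have "\<alpha> = 0"
  proof (rule ccontr)
    assume a: "\<alpha> \<noteq> 0"
    have "(\<lambda>x. 1 / \<alpha> * (u x - v x)) \<in> L2 \<L>" by (intro L2_cmult L2_diff assms)
    then have "phi z \<in> L2 \<L>"
      by (rule L2_AE_cong[OF _ sol_measurable[OF phi(1)]]) (use eq a in \<open>auto intro!: AE_I2\<close>)
    then show False using assms(1) by simp
  qed
  then show ?thesis using eq[OF assms(6)] by simp
qed

lemma resolvent_solution:
  assumes "phi z \<notin> L2 \<L>"
  shows "\<exists>C>0. \<forall>k\<in>L2 \<L>. \<exists>u g. sol z k u g \<and> u \<in> L2 \<L> \<and>
    (LINT x|\<L>. (norm (u x))\<^sup>2) \<le> C * (LINT x|\<L>. (norm (k x))\<^sup>2)"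
proof -
  obtain C c0 where tb: "truncation_bound z C c0" using truncation_bound[OF assms] by blast
  then have C: "0 < C" by (simp add: truncation_bound_def)
  obtain c where c: "\<And>n. c n \<in> supp" "filterlim c at_top sequentially" using supp_sequence by blast
  show ?thesis
  proof (rule exI[of _ "2 * C"], intro conjI ballI)
    fix k assume k: "k \<in> L2 \<L>"
    obtain r u g b where r: "strict_mono r" "sol z k u g" "b \<longlonglongrightarrow> 0"
      "\<And>n. nsq (c (r n)) (\<lambda>x. u x + b n * phi z x) \<le> C * (LINT x|\<L>. (norm (k x))\<^sup>2)"
      using limit_solution[OF tb k c] unfolding Let_def by blast
    have "filterlim (\<lambda>n. c (r n)) at_top sequentially"
      using filterlim_compose[OF c(2) filterlim_subseq[OF r(1)]] .
    from approx_nsq_L2[OF r(2,3) this r(4)] r(2)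
    show "\<exists>u g. sol z k u g \<and> u \<in> L2 \<L> \<and> (LINT x|\<L>. (norm (u x))\<^sup>2) \<le> 2 * C * (LINT x|\<L>. (norm (k x))\<^sup>2)"
      by (intro exI[of _ u] exI[of _ g]) auto
  qed (use C in simp)
qed

definition form_tail :: "real \<Rightarrow> real \<Rightarrow> bool" where
  "form_tail M N \<longleftrightarrow> 0 \<le> N \<and> (\<forall>c k u g. c \<in> supp \<longrightarrow> sol lam k u g \<longrightarrow> g c = 0 \<longrightarrow>
    set_integrable \<L> {0<..<c} (\<lambda>x. (norm (k x))\<^sup>2) \<longrightarrow>
    nsq c u + M * tail N c u \<le> Re (LINT x:{0<..<c}|\<L>. u x * cnj (k x)))"

lemma form_tail: "0 \<le> M \<Longrightarrow> \<exists>N. form_tail M N"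
  using form_ineq[of M] unfolding form_tail_def by blast

text \<open>By uniqueness every square integrable solution is the limit of the truncated ones, so
  \<open>form_ineq\<close> survives the limit, weakened by the factor 2 from
  \<open>approx_sq\<close>.\<close>

lemma lam_solution:
  assumes k: "k \<in> L2 \<L>" and M: "0 < M" "form_tail M N" and s: "sol lam k u g" "u \<in> L2 \<L>"
  shows "(LINT x|\<L>. (norm (u x))\<^sup>2) \<le> 2 * Re (L2_inner \<L> u k)"
    "M * tail N X u \<le> (LINT x|\<L>. (norm (k x))\<^sup>2)"
proof -
  define K where "K = (LINT x|\<L>. (norm (k x))\<^sup>2)"
  obtain C c0 where tb: "truncation_bound lam C c0" using truncation_bound[OF phi_lam_not_L2] by blast
  obtain c where c: "\<And>n. c n \<in> supp" "filterlim c at_top sequentially" using supp_sequence by blast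
  obtain r v h b where r: "strict_mono r" "sol lam k v h" "b \<longlonglongrightarrow> 0" and
    U: "\<And>n. sol lam k (\<lambda>x. v x + b n * phi lam x) (\<lambda>x. h x + b n * phig lam x)"
      "\<And>n. h (c (r n)) + b n * phig lam (c (r n)) = 0"
      "\<And>n. nsq (c (r n)) (\<lambda>x. v x + b n * phi lam x) \<le> C * K"
    using limit_solution[OF tb k c] unfolding Let_def K_def by blast
  define e where "e n = c (r n)" for n
  define V where "V n x = v x + b n * phi lam x" for n x
  have e: "e n \<in> supp" for n using c(1) by (simp add: e_def)
  have elim: "filterlim e at_top sequentially"
    using filterlim_compose[OF c(2) filterlim_subseq[OF r(1)]] by (simp add: e_def[abs_def])
  have VK: "nsq (e n) (\<lambda>x. v x + b n * phi lam x) \<le> C * K" for n using U(3) by (simp add: e_def)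
  note vL = approx_nsq_L2[OF r(2,3) elim VK]
  have uv: "u x = v x" if "0 \<le> x" for x
    by (rule sol_L2_unique[OF phi_lam_not_L2 s(1) r(2) s(2) vL(1) that])
  have k2: "set_integrable \<L> {0<..<x} (\<lambda>x. (norm (k x))\<^sup>2)" for x
    by (rule L2_set_integrable[OF k]) simp
  have F: "nsq (e n) (V n) + M * tail N (e n) (V n) \<le> Re (LINT x:{0<..<e n}|\<L>. V n x * cnj (k x))" for n
    using M(2) e[of n] U(1)[of n] U(2)[of n] k2[of "e n"] unfolding form_tail_def V_def[abs_def] e_def by blast
  have N0: "0 \<le> N" using M(2) by (simp add: form_tail_def)
  have "(\<lambda>n. LINT x:{0<..<e n}|\<L>. V n x * cnj (k x)) \<longlonglongrightarrow> L2_inner \<L> v k"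
    unfolding V_def by (rule approx_inner[OF r(2,3) elim VK k])
  then have lim: "(\<lambda>n. Re (LINT x:{0<..<e n}|\<L>. V n x * cnj (k x))) \<longlonglongrightarrow> Re (L2_inner \<L> v k)"
    by (rule tendsto_Re)
  have iu: "L2_inner \<L> u k = L2_inner \<L> v k"
    unfolding L2_inner_def by (rule Bochner_Integration.integral_cong) (use uv in auto)
  have nu: "(LINT x|\<L>. (norm (u x))\<^sup>2) = (LINT x|\<L>. (norm (v x))\<^sup>2)"
    by (rule Bochner_Integration.integral_cong) (use uv in auto)
  have VV: "sol lam k (V n) (\<lambda>x. h x + b n * phig lam x)" for n using U(1) by (simp add: V_def[abs_def])
  \<comment> \<open>The bounding integrals converge but need not lie below their limit, hence the
    \<open>\<epsilon>\<close>.\<close>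
  have Re_le: "(LINT x|\<L>. (norm (v x))\<^sup>2) \<le> 2 * (Re (L2_inner \<L> v k) + \<epsilon>)" if "0 < \<epsilon>" for \<epsilon>
  proof -
    have "nsq X v \<le> 2 * (Re (L2_inner \<L> v k) + \<epsilon>)" for X
      unfolding nsq_def
    proof (rule approx_sq[OF r(2) _ order.refl r(3)])
      have "eventually (\<lambda>n. X \<le> e n) sequentially" using elim unfolding filterlim_at_top by blast
      moreover have "eventually (\<lambda>n. Re (LINT x:{0<..<e n}|\<L>. V n x * cnj (k x)) < Re (L2_inner \<L> v k) + \<epsilon>) sequentially"
        by (rule order_tendstoD(2)[OF lim]) (use that in simp)
      ultimately show "\<forall>\<^sub>F n in sequentially. (LINT x:{0<..<X}|\<L>. (norm (v x + b n * phi lam x))\<^sup>2) \<le> Re (L2_inner \<L> v k) + \<epsilon>"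
      proof eventually_elim
        case (elim n)
        have "nsq X (V n) \<le> nsq (e n) (V n)" by (rule nsq_mono[OF sol_sq_integrable[OF VV] elim(1)])
        also have "\<dots> \<le> Re (LINT x:{0<..<e n}|\<L>. V n x * cnj (k x))"
          using F[of n] mult_nonneg_nonneg[OF less_imp_le[OF M(1)] tail_nonneg[of N "e n" "V n"]] by linarith
        finally show ?case using elim(2) by (simp add: nsq_def V_def)
      qed
    qed simp
    from L2_if_nsq_bounded(2)[OF sol_measurable[OF r(2)] sol_sq_integrable[OF r(2)] this] show ?thesis .
  qed
  have "(LINT x|\<L>. (norm (v x))\<^sup>2) \<le> 2 * Re (L2_inner \<L> v k)"
  proof (rule field_le_epsilon)
    fix \<epsilon> :: real assume "0 < \<epsilon>"
    then show "(LINT x|\<L>. (norm (v x))\<^sup>2) \<le> 2 * Re (L2_inner \<L> v k) + \<epsilon>"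
      using Re_le[of "\<epsilon> / 2"] by simp
  qed
  then show "(LINT x|\<L>. (norm (u x))\<^sup>2) \<le> 2 * Re (L2_inner \<L> u k)" by (simp add: iu nu)
  have "tail N X v \<le> 2 * (K / (2 * M))"
    unfolding tail_def
  proof (rule approx_sq[OF r(2) Leb.Ioo_sets'[OF N0] _ r(3)])
    show "{N<..<X} \<subseteq> {0<..<X}" using N0 by auto
    have "eventually (\<lambda>n. X \<le> e n) sequentially" using elim unfolding filterlim_at_top by blast
    then show "\<forall>\<^sub>F n in sequentially. (LINT x:{N<..<X}|\<L>. (norm (v x + b n * phi lam x))\<^sup>2) \<le> K / (2 * M)"
    proof eventually_elim
      case (elim n)
      have "tail N X (V n) \<le> tail N (e n) (V n)"
        unfolding tail_def
      proof (rule Leb_Ioo_mono_set)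
        show "set_integrable \<L> {N<..<e n} (\<lambda>x. (norm (V n x))\<^sup>2)"
          by (rule Leb.set_integrable_Ioo_subset[OF sol_sq_integrable[OF VV] Leb.Ioo_sets'[OF N0]]) (use N0 in auto)
      qed (use elim Leb.Ioo_sets'[OF N0] in auto)
      then have "M * tail N X (V n) \<le> M * tail N (e n) (V n)" using M(1) by simp
      also have "\<dots> \<le> Re (LINT x:{0<..<e n}|\<L>. V n x * cnj (k x)) - nsq (e n) (V n)" using F[of n] by linarith
      also have "\<dots> \<le> 1/2 * nsq (e n) k"
        using Re_integral_le[where c="e n" and a=0, OF sol_measurable[OF VV[of n]] sol_sq_integrable[OF VV[of n]] L2_measurable[OF k] k2]
          nsq_nonneg[of "e n" "V n"] by simp
      also have "\<dots> \<le> 1/2 * K" using nsq_le_L2[OF k, of "e n"] by (simp add: K_def)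
      finally have "tail N X (V n) \<le> K / (2 * M)" using M(1) by (simp add: field_simps)
      then show ?case by (simp add: tail_def V_def)
    qed
  qed
  moreover have "tail N X u = tail N X v"
    unfolding tail_def by (rule set_lebesgue_integral_cong) (use Leb.Ioo_sets'[OF N0] uv N0 in auto)
  ultimately show "M * tail N X u \<le> (LINT x|\<L>. (norm (k x))\<^sup>2)"
    using M(1) by (simp add: K_def field_simps)
qed

text \<open>For truncated solutions with Neumann conditions at the same point, Green's identity in
  both orders gives symmetry at once; weak convergence carries it to the limit.\<close>

lemma lam_symmetric:
  assumes k: "k \<in> L2 \<L>" "l \<in> L2 \<L>" and u: "sol lam k u g" "u \<in> L2 \<L>" and v: "sol lam l v y" "v \<in> L2 \<L>"
  shows "L2_inner \<L> u l = L2_inner \<L> k v"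
proof -
  obtain C c0 where tb: "truncation_bound lam C c0" using truncation_bound[OF phi_lam_not_L2] by blast
  obtain c where c: "\<And>n. c n \<in> supp" "filterlim c at_top sequentially" using supp_sequence by blast
  obtain r u' g' b where r: "strict_mono r" "sol lam k u' g'" "b \<longlonglongrightarrow> 0" and
    U: "\<And>n. sol lam k (\<lambda>x. u' x + b n * phi lam x) (\<lambda>x. g' x + b n * phig lam x)"
      "\<And>n. g' (c (r n)) + b n * phig lam (c (r n)) = 0"
      "\<And>n. nsq (c (r n)) (\<lambda>x. u' x + b n * phi lam x) \<le> C * (LINT x|\<L>. (norm (k x))\<^sup>2)"
    using limit_solution[OF tb k(1) c] unfolding Let_def by blast
  have cr: "filterlim (\<lambda>n. c (r n)) at_top sequentially"
    using filterlim_compose[OF c(2) filterlim_subseq[OF r(1)]] .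
  \<comment> \<open>The second approximation is taken along the subsequence of the first, so that
    both satisfy the Neumann condition at \<open>e n = c (r (s n))\<close>.\<close>
  obtain s v' y' b' where s: "strict_mono s" "sol lam l v' y'" "b' \<longlonglongrightarrow> 0" and
    V: "\<And>n. sol lam l (\<lambda>x. v' x + b' n * phi lam x) (\<lambda>x. y' x + b' n * phig lam x)"
      "\<And>n. y' (c (r (s n))) + b' n * phig lam (c (r (s n))) = 0"
      "\<And>n. nsq (c (r (s n))) (\<lambda>x. v' x + b' n * phi lam x) \<le> C * (LINT x|\<L>. (norm (l x))\<^sup>2)"
    using limit_solution[OF tb k(2) c(1) cr] unfolding Let_def by blast
  define e where "e n = c (r (s n))" for n
  have elim: "filterlim e at_top sequentially"
    using filterlim_compose[OF cr filterlim_subseq[OF s(1)]] by (simp add: e_def[abs_def])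
  have e0: "0 \<le> e n" for n using c(1)[of "r (s n)"] supp_pos by (force simp: e_def)
  have bs: "(\<lambda>n. b (s n)) \<longlonglongrightarrow> 0" using LIMSEQ_subseq_LIMSEQ[OF r(3) s(1)] by (simp add: comp_def)
  have UK: "nsq (e n) (\<lambda>x. u' x + b (s n) * phi lam x) \<le> C * (LINT x|\<L>. (norm (k x))\<^sup>2)"
    and VK: "nsq (e n) (\<lambda>x. v' x + b' n * phi lam x) \<le> C * (LINT x|\<L>. (norm (l x))\<^sup>2)" for n
    using U(3) V(3) by (simp_all add: e_def)
  define Wn where "Wn n x = u' x + b (s n) * phi lam x" for n x
  define Vn where "Vn n x = v' x + b' n * phi lam x" for n x
  define Gn where "Gn n x = g' x + b (s n) * phig lam x" for n x
  define Yn where "Yn n x = y' x + b' n * phig lam x" for n x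
  have Us: "sol lam k (Wn n) (Gn n)" and Vs: "sol lam l (Vn n) (Yn n)" and G0: "Gn n (e n) = 0" and Y0: "Yn n (e n) = 0" for n
    using U(1,2) V(1,2) by (simp_all add: Wn_def[abs_def] Gn_def[abs_def] Vn_def[abs_def] Yn_def[abs_def] e_def)
  have l1: "(\<lambda>n. LINT x:{0<..<e n}|\<L>. Wn n x * cnj (l x)) \<longlonglongrightarrow> L2_inner \<L> u' l"
    unfolding Wn_def by (rule approx_inner[OF r(2) bs elim UK k(2)])
  have l2: "(\<lambda>n. LINT x:{0<..<e n}|\<L>. Vn n x * cnj (k x)) \<longlonglongrightarrow> L2_inner \<L> v' k"
    unfolding Vn_def by (rule approx_inner[OF s(2,3) elim VK k(1)])
  have k2: "set_integrable \<L> {0<..<x} (\<lambda>x. (norm (k x))\<^sup>2)" "set_integrable \<L> {0<..<x} (\<lambda>x. (norm (l x))\<^sup>2)" for x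
    by (rule L2_set_integrable[OF k(1)], simp) (rule L2_set_integrable[OF k(2)], simp)
  have "(LINT x:{0<..<e n}|\<L>. Wn n x * cnj (l x)) = cnj (LINT x:{0<..<e n}|\<L>. Vn n x * cnj (k x))" for n
  proof -
    define Q where "Q x = of_real (q x - lam) * Wn n x * cnj (Vn n x)" for x
    note um = sol_measurable[OF Us[of n]] and vm = sol_measurable[OF Vs[of n]]
    note ui = sol_sq_integrable[OF Us[of n]] and vi = sol_sq_integrable[OF Vs[of n]]
    have i1: "set_integrable \<L> {0<..<e n} (\<lambda>x. Wn n x * cnj (l x))"
      by (rule mult_cnj_integrable[OF Leb.Ioo_sets ui um k2(2) L2_measurable[OF k(2)]])
    have i2: "set_integrable \<L> {0<..<e n} (\<lambda>x. Vn n x * cnj (k x))"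
      by (rule mult_cnj_integrable[OF Leb.Ioo_sets vi vm k2(1) L2_measurable[OF k(1)]])
    have p1: "Wn n t * cnj ((of_real (q t) - of_real lam) * Vn n t - l t) = Q t - Wn n t * cnj (l t)"
      and p2: "Vn n t * cnj ((of_real (q t) - of_real lam) * Wn n t - k t) = cnj (Q t) - Vn n t * cnj (k t)" for t
      by (auto simp: Q_def algebra_simps)
    have iQ: "set_integrable \<L> {0<..<e n} Q"
      using set_integral_add(1)[OF P.parts_integrable(2)[OF sol_loc_ac[OF Us[of n]] loc_ac_cnj[OF sol_loc_ac'[OF Vs[of n]]], of "e n"] i1]
      unfolding p1 by simp
    have 1: "0 = (LINT t:{0<..<e n}|P. Gn n t * cnj (Yn n t)) + ((LINT t:{0<..<e n}|\<L>. Q t) - (LINT t:{0<..<e n}|\<L>. Wn n t * cnj (l t)))"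
      using green_first[OF Us[of n] Vs[of n] e0[of n]] Y0[of n] unfolding p1 set_integral_diff(2)[OF iQ i1] by simp
    have 2: "0 = cnj (LINT t:{0<..<e n}|P. Gn n t * cnj (Yn n t)) + (cnj (LINT t:{0<..<e n}|\<L>. Q t) - (LINT t:{0<..<e n}|\<L>. Vn n t * cnj (k t)))"
    proof -
      have iQ': "set_integrable \<L> {0<..<e n} (\<lambda>t. cnj (Q t))" using iQ by (simp add: set_integral_cnj)
      have "(LINT t:{0<..<e n}|P. Yn n t * cnj (Gn n t)) = cnj (LINT t:{0<..<e n}|P. Gn n t * cnj (Yn n t))"
        unfolding set_integral_cnj(1)[symmetric] by (simp add: mult.commute)
      then show ?thesis
        using green_first[OF Vs[of n] Us[of n] e0[of n]] G0[of n]
        unfolding p2 set_integral_diff(2)[OF iQ' i2] set_integral_cnj(1) by simp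
    qed
    have 3: "0 = (LINT t:{0<..<e n}|P. Gn n t * cnj (Yn n t)) + ((LINT t:{0<..<e n}|\<L>. Q t) - cnj (LINT t:{0<..<e n}|\<L>. Vn n t * cnj (k t)))"
      using arg_cong[OF 2, of cnj] by simp
    have "X = Y" if "0 = A + (B - X)" "0 = A + (B - Y)" for A B X Y :: complex
      using that by algebra
    from this[OF 1 3] show ?thesis .
  qed
  with l1 have "(\<lambda>n. cnj (LINT x:{0<..<e n}|\<L>. Vn n x * cnj (k x))) \<longlonglongrightarrow> L2_inner \<L> u' l" by simp
  moreover have "(\<lambda>n. cnj (LINT x:{0<..<e n}|\<L>. Vn n x * cnj (k x))) \<longlonglongrightarrow> cnj (L2_inner \<L> v' k)"
    using l2 by (rule tendsto_cnj)
  ultimately have "L2_inner \<L> u' l = cnj (L2_inner \<L> v' k)" by (rule LIMSEQ_unique)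
  then have "L2_inner \<L> u' l = L2_inner \<L> k v'" by (subst (2) L2_inner_commute)
  moreover have uu: "u x = u' x" if "0 \<le> x" for x
    by (rule sol_L2_unique[OF phi_lam_not_L2 u(1) r(2) u(2) approx_nsq_L2(1)[OF r(2) bs elim UK] that])
  moreover have vv: "v x = v' x" if "0 \<le> x" for x
    by (rule sol_L2_unique[OF phi_lam_not_L2 v(1) s(2) v(2) approx_nsq_L2(1)[OF s(2,3) elim VK] that])
  moreover have "L2_inner \<L> u l = L2_inner \<L> u' l" "L2_inner \<L> k v = L2_inner \<L> k v'"
    unfolding L2_inner_def by (rule Bochner_Integration.integral_cong; use uu vv in auto)+
  ultimately show ?thesis by simp
qed

end

section \<open>Symmetry, adjoint and spectrum\<close>

lemma loc_ac_density_cong: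
  assumes u: "loc_ac \<L> u g" and ae: "AE x in \<L>. g x = h x" and h: "h \<in> borel_measurable \<L>"
  shows "loc_ac \<L> u h"
  unfolding loc_ac_def
proof (intro conjI allI impI)
  have ae': "AE x in \<L>. indicator {0<..<c} x *\<^sub>R g x = indicator {0<..<c} x *\<^sub>R h x" for c :: real
    using ae by eventually_elim simp
  have gm: "g \<in> borel_measurable \<L>" by (rule Leb.loc_ac_measurable_density[OF u])
  show "set_integrable \<L> {0<..<c} h" for c
    using integrable_cong_AE_imp[OF loc_ac_integrable[OF u, of c, unfolded set_integrable_def] _ ae'[of c]] h
    by (simp add: set_integrable_def)
  fix x :: real assume x: "0 \<le> x"
  have "(LINT t:{0<..<x}|\<L>. g t) = (LINT t:{0<..<x}|\<L>. h t)"
    unfolding set_lebesgue_integral_def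
    by (rule integral_cong_AE[OF _ _ ae']) (use gm h in simp_all)
  then show "u x = u 0 + (LINT t:{0<..<x}|\<L>. h t)" using loc_ac_eq[OF u x] by simp
qed

section \<open>From elements of the graph to solutions and back\<close>

context sturm_liouville
begin

text \<open>The right-hand side may be any measurable representative, since a primitive sees its
  density only almost everywhere.\<close>

lemma ham_repr:
  assumes fh: "(f, h) \<in> hamiltonian \<nu> q" and k: "AE x in \<L>. k x = h x - z * f x" "k \<in> borel_measurable \<L>"
  shows "\<exists>u g. sol z k u g \<and> u \<in> L2 \<L> \<and> (AE x in \<L>. f x = u x)"
proof -
  obtain u g k' where f: "f \<in> L2 \<L>" and h: "h \<in> L2 \<L>" and fu: "AE x in \<L>. f x = u x"
    and ug: "loc_ac P u g" and gk: "loc_ac \<L> g k'" and g0: "g 0 = 0"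
    and hk: "AE x in \<L>. h x = - k' x + complex_of_real (q x) * u x"
    using fh unfolding hamiltonian_def
    by (auto simp: P.has_loc_density_iff Leb.has_loc_density_iff)
  have um: "u \<in> borel_measurable \<L>" by (rule P.loc_ac_measurable[OF ug])
  have "loc_ac \<L> g (\<lambda>x. (of_real (q x) - z) * u x - k x)"
  proof (rule loc_ac_density_cong[OF gk])
    show "AE x in \<L>. k' x = (of_real (q x) - z) * u x - k x"
      using hk fu k(1) by eventually_elim (simp add: algebra_simps)
    show "(\<lambda>x. (of_real (q x) - z) * u x - k x) \<in> borel_measurable \<L>"
      using q_measurable um k(2) by simp
  qed
  then have "sol z k u g" using ug g0 by (simp add: sol_def)
  moreover have "u \<in> L2 \<L>" by (rule L2_AE_cong[OF f um fu])
  ultimately show ?thesis using fu by blast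
qed

lemma ham_intro:
  assumes s: "sol z k u g" and u: "u \<in> L2 \<L>" and k: "k \<in> L2 \<L>"
  shows "(u, \<lambda>x. k x + z * u x) \<in> hamiltonian \<nu> q"
proof -
  have "AE x in \<L>. k x + z * u x = - ((of_real (q x) - z) * u x - k x) + complex_of_real (q x) * u x"
    by (rule AE_I2) (simp add: algebra_simps)
  then have "\<exists>v g l. (AE x in \<L>. u x = v x) \<and> loc_ac P v g \<and> loc_ac \<L> g l \<and> g 0 = 0 \<and>
      (AE x in \<L>. k x + z * u x = - l x + complex_of_real (q x) * v x)"
    using sol_loc_ac[OF s] sol_loc_ac'[OF s] sol_0[OF s]
    by (rule_tac exI[of _ u], rule_tac exI[of _ g], rule_tac exI[of _ "\<lambda>x. (of_real (q x) - z) * u x - k x"]) simp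
  then show ?thesis
    unfolding hamiltonian_def mem_Collect_eq case_prod_conv P.has_loc_density_iff Leb.has_loc_density_iff
    using L2_add[OF k u, of z] u by blast
qed

lemma ham_L2: "(f, h) \<in> hamiltonian \<nu> q \<Longrightarrow> f \<in> L2 \<L> \<and> h \<in> L2 \<L>"
  by (auto simp: hamiltonian_def)

lemma ham_cong_AE:
  assumes "(f, h) \<in> hamiltonian \<nu> q" "f' \<in> L2 \<L>" "h' \<in> L2 \<L>" "AE x in \<L>. f' x = f x" "AE x in \<L>. h' x = h x"
  shows "(f', h') \<in> hamiltonian \<nu> q"
proof -
  obtain u g k' where *: "AE x in \<L>. f x = u x" "has_loc_density P u g" "has_loc_density \<L> g k'" "g 0 = 0"
    "AE x in \<L>. h x = - k' x + complex_of_real (q x) * u x"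
    using assms(1) unfolding hamiltonian_def by auto
  have "AE x in \<L>. f' x = u x" using assms(4) *(1) by eventually_elim simp
  moreover have "AE x in \<L>. h' x = - k' x + complex_of_real (q x) * u x"
    using assms(5) *(5) by eventually_elim simp
  ultimately show ?thesis unfolding hamiltonian_def using assms(2,3) *(2,3,4) by auto
qed

lemma ham_repr':
  assumes fh: "(f, h) \<in> hamiltonian \<nu> q"
  shows "\<exists>u g. sol z (\<lambda>x. h x - z * f x) u g \<and> u \<in> L2 \<L> \<and> (AE x in \<L>. f x = u x) \<and> (\<lambda>x. h x - z * f x) \<in> L2 \<L>"
proof -
  have k: "(\<lambda>x. h x - z * f x) \<in> L2 \<L>"
    using ham_L2[OF fh] L2_add[of h \<L> f "- z"] by simp
  show ?thesis using ham_repr[OF fh _ L2_measurable[OF k]] k by auto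
qed

end

context gaps
begin

text \<open>As \<open>lam\<close> is real, symmetry of \<open>H - lam\<close> is symmetry of
  \<open>H\<close>.\<close>

lemma ham_symmetric:
  assumes 1: "(f, h) \<in> hamiltonian \<nu> q" and 2: "(f', h') \<in> hamiltonian \<nu> q"
  shows "L2_inner \<L> h f' = L2_inner \<L> f h'"
proof -
  define k where "k x = h x - lam * f x" for x
  define k' where "k' x = h' x - lam * f' x" for x
  obtain u g where u: "sol lam k u g" "u \<in> L2 \<L>" "AE x in \<L>. f x = u x" and k: "k \<in> L2 \<L>"
    using ham_repr'[OF 1, of lam] unfolding k_def[abs_def] by blast
  obtain v y where v: "sol lam k' v y" "v \<in> L2 \<L>" "AE x in \<L>. f' x = v x" and k': "k' \<in> L2 \<L>"
    using ham_repr'[OF 2, of lam] unfolding k'_def[abs_def] by blast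
  have L: "f \<in> L2 \<L>" "h \<in> L2 \<L>" "f' \<in> L2 \<L>" "h' \<in> L2 \<L>" using ham_L2[OF 1] ham_L2[OF 2] by auto
  have "L2_inner \<L> u k' = L2_inner \<L> f k'" "L2_inner \<L> k v = L2_inner \<L> k f'"
    by (rule L2_inner_cong_AE; use u v L k k' in \<open>auto dest: L2_measurable elim: eventually_mono\<close>)+
  then have "L2_inner \<L> f k' = L2_inner \<L> k f'"
    using lam_symmetric[OF k k' u(1,2) v(1,2)] by simp
  then have "L2_inner \<L> f h' - lam * L2_inner \<L> f f' = L2_inner \<L> h f' - lam * L2_inner \<L> f f'"
    using L2_inner_add_right[OF L(4,3,1), of "- of_real lam"] L2_inner_add_left[OF L(2,1,3), of "- of_real lam"]
    by (simp add: k_def[abs_def] k'_def[abs_def])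
  then show ?thesis by simp
qed

text \<open>The margin 1/2 is what the factor 2 in \<open>lam_solution\<close> leaves of the surplus
  1; that it is positive is needed for density of the domain.\<close>

lemma ham_semibounded:
  assumes 1: "(f, h) \<in> hamiltonian \<nu> q"
  shows "lam * (L2_norm \<L> f)\<^sup>2 + 1/2 * (L2_norm \<L> f)\<^sup>2 \<le> Re (L2_inner \<L> h f)"
proof -
  define k where "k x = h x - lam * f x" for x
  obtain u g where u: "sol lam k u g" "u \<in> L2 \<L>" "AE x in \<L>. f x = u x" and k: "k \<in> L2 \<L>"
    using ham_repr'[OF 1, of lam] unfolding k_def[abs_def] by blast
  have L: "f \<in> L2 \<L>" "h \<in> L2 \<L>" using ham_L2[OF 1] by auto
  obtain N where N: "form_tail 1 N" using form_tail[of 1] by auto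
  have "(LINT x|\<L>. (norm (u x))\<^sup>2) \<le> 2 * Re (L2_inner \<L> u k)"
    by (rule lam_solution(1)[OF k _ N u(1,2)]) simp
  moreover have "L2_inner \<L> u k = L2_inner \<L> f k" "(LINT x|\<L>. (norm (u x))\<^sup>2) = (LINT x|\<L>. (norm (f x))\<^sup>2)"
    using u k L by (auto intro!: L2_inner_cong_AE integral_cong_AE dest: L2_measurable elim: eventually_mono)
  moreover have "L2_inner \<L> f k = cnj (L2_inner \<L> h f) - lam * of_real ((L2_norm \<L> f)\<^sup>2)"
    using L2_inner_add_right[OF L(2,1,1), of "- of_real lam"] L2_inner_commute[of \<L> f h]
    by (simp add: k_def[abs_def] L2_inner_self L2_norm_sq)
  ultimately show ?thesis by (simp add: L2_norm_sq)
qed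

lemma ham_onto:
  assumes p: "p \<in> L2 \<L>" and "phi z \<notin> L2 \<L>"
  shows "\<exists>(f, h)\<in>hamiltonian \<nu> q. AE x in \<L>. h x - z * f x = p x"
proof -
  obtain u g where "sol z p u g" "u \<in> L2 \<L>" using resolvent_solution[OF assms(2)] p by blast
  then have "(u, \<lambda>x. p x + z * u x) \<in> hamiltonian \<nu> q" by (intro ham_intro p)
  then show ?thesis by (intro bexI[of _ "(u, \<lambda>x. p x + z * u x)"]) auto
qed

text \<open>A symmetric operator with \<open>H - lam\<close> onto for a real \<open>lam\<close> has
  no proper extension by its adjoint: for \<open>(g, k)\<close> in the adjoint solve
  \<open>(H - lam) f = k - lam g\<close>. Then \<open>d = g - f\<close> is orthogonal to the range
  of \<open>H - lam\<close>, in particular to itself.\<close>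

lemma ham_eq_adjoint: "hamiltonian \<nu> q = adjoint_graph \<L> (hamiltonian \<nu> q)"
proof (intro equalityI subsetI)
  fix p assume "p \<in> hamiltonian \<nu> q"
  then show "p \<in> adjoint_graph \<L> (hamiltonian \<nu> q)"
    using ham_symmetric ham_L2 unfolding adjoint_graph_def by (cases p) auto
next
  fix p assume p: "p \<in> adjoint_graph \<L> (hamiltonian \<nu> q)"
  obtain g k where gk: "p = (g, k)" by (cases p)
  have g: "g \<in> L2 \<L>" and k: "k \<in> L2 \<L>"
    and adj: "\<And>f h. (f, h) \<in> hamiltonian \<nu> q \<Longrightarrow> L2_inner \<L> h g = L2_inner \<L> f k"
    using p unfolding gk adjoint_graph_def by auto
  have "(\<lambda>x. k x + (- of_real lam) * g x) \<in> L2 \<L>" by (rule L2_add[OF k g])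
  from ham_onto[OF this phi_lam_not_L2] obtain f h :: "real \<Rightarrow> complex" where fh: "(f, h) \<in> hamiltonian \<nu> q"
    and eq: "AE x in \<L>. h x - lam * f x = k x + (- of_real lam) * g x" by auto
  have L: "f \<in> L2 \<L>" "h \<in> L2 \<L>" using ham_L2[OF fh] by auto
  define d where "d x = g x - f x" for x
  have d: "d \<in> L2 \<L>" unfolding d_def[abs_def] by (rule L2_diff[OF g L(1)])
  obtain f' h' :: "real \<Rightarrow> complex" where fh': "(f', h') \<in> hamiltonian \<nu> q" and eq': "AE x in \<L>. h' x - lam * f' x = d x"
    using ham_onto[OF d phi_lam_not_L2] by auto
  have L': "f' \<in> L2 \<L>" "h' \<in> L2 \<L>" using ham_L2[OF fh'] by auto
  have "L2_inner \<L> h' g + (-1) * L2_inner \<L> h' f = L2_inner \<L> f' k + (-1) * L2_inner \<L> f' h"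
    using adj[OF fh'] ham_symmetric[OF fh' fh] by simp
  then have "L2_inner \<L> h' d = L2_inner \<L> f' (\<lambda>x. k x - h x)"
    using L2_inner_add_right[OF g L(1) L'(2), of "-1"] L2_inner_add_right[OF k L(2) L'(1), of "-1"]
    by (simp add: d_def[abs_def])
  also have "\<dots> = L2_inner \<L> f' (\<lambda>x. 0 + of_real lam * d x)"
  proof (rule L2_inner_cong_AE)
    show "AE x in \<L>. k x - h x = 0 + of_real lam * d x"
      using eq by eventually_elim (simp add: d_def algebra_simps)
  qed (use L L' k d L2_diff[OF k L(2)] in \<open>auto dest: L2_measurable\<close>)
  also have "\<dots> = of_real lam * L2_inner \<L> f' d"
    using L2_inner_add_right[OF L2_zero d L'(1), of "of_real lam"] by (simp add: L2_inner_def)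
  finally have "L2_inner \<L> h' d + (- of_real lam) * L2_inner \<L> f' d = 0" by simp
  then have "L2_inner \<L> (\<lambda>x. h' x + (- of_real lam) * f' x) d = 0"
    using L2_inner_add_left[OF L'(2,1) d, of "- of_real lam"] by simp
  moreover have "L2_inner \<L> (\<lambda>x. h' x + (- of_real lam) * f' x) d = L2_inner \<L> d d"
    by (rule L2_inner_cong_AE) (use eq' L' d L2_add[OF L'(2,1), of "- of_real lam"] in \<open>auto dest: L2_measurable\<close>)
  ultimately have "(LINT x|\<L>. (norm (d x))\<^sup>2) = 0" by (simp add: L2_inner_self)
  then have "AE x in \<L>. d x = 0" by (intro L2_AE_zero[OF d]) simp
  then have gf: "AE x in \<L>. g x = f x" by eventually_elim (simp add: d_def)
  then have "AE x in \<L>. k x = h x" using eq by eventually_elim (simp add: algebra_simps)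
  with gf show "p \<in> hamiltonian \<nu> q" unfolding gk by (intro ham_cong_AE[OF fh g k])
qed

lemma phi_ham: "phi z \<in> L2 \<L> \<Longrightarrow> (phi z, \<lambda>x. z * phi z x) \<in> hamiltonian \<nu> q"
  using ham_intro[OF phi(1) _ L2_zero] by simp

text \<open>By uniqueness each element of the domain is the solution built from its right-hand side,
  so it inherits the norm bound.\<close>

lemma resolvent_if:
  assumes "phi z \<notin> L2 \<L>"
  shows "z \<in> resolvent_set \<L> (hamiltonian \<nu> q)"
proof -
  obtain C where C: "0 < C" "\<And>k. k \<in> L2 \<L> \<Longrightarrow> \<exists>u g. sol z k u g \<and> u \<in> L2 \<L> \<and>
    (LINT x|\<L>. (norm (u x))\<^sup>2) \<le> C * (LINT x|\<L>. (norm (k x))\<^sup>2)"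
    using resolvent_solution[OF assms] by blast
  have "L2_norm \<L> f \<le> sqrt C * L2_norm \<L> (\<lambda>x. h x - z * f x)" if fh: "(f, h) \<in> hamiltonian \<nu> q" for f h
  proof -
    obtain u g where u: "sol z (\<lambda>x. h x - z * f x) u g" "u \<in> L2 \<L>" "AE x in \<L>. f x = u x"
      and k: "(\<lambda>x. h x - z * f x) \<in> L2 \<L>"
      using ham_repr'[OF fh, of z] by blast
    obtain v y where v: "sol z (\<lambda>x. h x - z * f x) v y" "v \<in> L2 \<L>"
      "(LINT x|\<L>. (norm (v x))\<^sup>2) \<le> C * (LINT x|\<L>. (norm (h x - z * f x))\<^sup>2)"
      using C(2)[OF k] by blast
    have "(LINT x|\<L>. (norm (f x))\<^sup>2) = (LINT x|\<L>. (norm (v x))\<^sup>2)"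
    proof (rule integral_cong_AE)
      show "AE x in \<L>. (norm (f x))\<^sup>2 = (norm (v x))\<^sup>2"
        using u(3) AE_space
      proof eventually_elim
        case (elim x)
        then show ?case using sol_L2_unique[OF assms u(1) v(1) u(2) v(2), of x] by simp
      qed
    qed (use ham_L2[OF fh] v(2) in \<open>auto dest: L2_measurable\<close>)
    then show ?thesis using v(3) unfolding L2_norm_def real_sqrt_mult[symmetric] by simp
  qed
  then show ?thesis
    unfolding resolvent_set_def using ham_onto[OF _ assms] by blast
qed

lemma spectrum_phi: "z \<in> spectrum \<L> (hamiltonian \<nu> q) \<Longrightarrow> phi z \<in> L2 \<L>"
  using resolvent_if unfolding spectrum_def by blast

lemma phi_norm_pos: "phi z \<in> L2 \<L> \<Longrightarrow> 0 < (LINT x|\<L>. (norm (phi z x))\<^sup>2)"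
  using phi_nsq_pos[of 1 z] nsq_le_L2[of "phi z" 1] by simp

text \<open>An eigenfunction solves the homogeneous Neumann problem and hence is a multiple of
  \<open>phi z\<close>, so the multiplicity is one.\<close>

lemma eigenvalue_phi:
  assumes "phi z \<in> L2 \<L>"
  shows "eigenvalue \<L> (hamiltonian \<nu> q) z" "finite_multiplicity \<L> (hamiltonian \<nu> q) z"
proof -
  have e: "phi z \<in> eigenspace \<L> (hamiltonian \<nu> q) z"
    using phi_ham[OF assms] by (simp add: eigenspace_def)
  have "\<not> (AE x in \<L>. phi z x = 0)"
  proof
    assume "AE x in \<L>. phi z x = 0"
    then have "(LINT x|\<L>. (norm (phi z x))\<^sup>2) = 0"
      by (intro integral_eq_zero_AE) (auto elim: eventually_mono)
    then show False using phi_norm_pos[OF assms] by simp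
  qed
  then show "eigenvalue \<L> (hamiltonian \<nu> q) z" unfolding eigenvalue_def using e by blast
  have "\<exists>c. AE x in \<L>. f x = (\<Sum>b\<in>{phi z}. c b * b x)" if f: "f \<in> eigenspace \<L> (hamiltonian \<nu> q) z" for f
  proof -
    have "(f, \<lambda>x. z * f x) \<in> hamiltonian \<nu> q" using f by (simp add: eigenspace_def)
    from ham_repr[OF this, of "\<lambda>_. 0" z] obtain u g where u: "sol z (\<lambda>_. 0) u g" "AE x in \<L>. f x = u x"
      by auto
    have "AE x in \<L>. f x = u 0 * phi z x"
      using u(2) AE_space
    proof eventually_elim
      case (elim x)
      then show ?case using sol_0_eq_phi[OF u(1), of x] by simp
    qed
    then show ?thesis by (intro exI[of _ "\<lambda>_. u 0"]) simp
  qed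
  then show "finite_multiplicity \<L> (hamiltonian \<nu> q) z"
    unfolding finite_multiplicity_def using e by (intro exI[of _ "{phi z}"]) auto
qed

lemma eigenvalue_real:
  assumes "phi z \<in> L2 \<L>"
  shows "cnj z = z"
proof -
  note s = ham_symmetric[OF phi_ham[OF assms] phi_ham[OF assms]]
  have "z * L2_inner \<L> (phi z) (phi z) = cnj z * L2_inner \<L> (phi z) (phi z)"
    using s L2_inner_add_left[OF L2_zero assms assms, of z] L2_inner_add_right[OF L2_zero assms assms, of z]
    by (simp add: L2_inner_def)
  then show ?thesis using phi_norm_pos[OF assms] by (simp add: L2_inner_self)
qed

lemma eigen_orthogonal:
  assumes "phi z \<in> L2 \<L>" "phi w \<in> L2 \<L>" "w \<noteq> z"
  shows "L2_inner \<L> (phi w) (phi z) = 0"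
proof -
  note s = ham_symmetric[OF phi_ham[OF assms(2)] phi_ham[OF assms(1)]]
  have "w * L2_inner \<L> (phi w) (phi z) = cnj z * L2_inner \<L> (phi w) (phi z)"
    using s L2_inner_add_left[OF L2_zero assms(2,1), of w] L2_inner_add_right[OF L2_zero assms(1,2), of z]
    by (simp add: L2_inner_def)
  then show ?thesis using assms(3) eigenvalue_real[OF assms(1)] by simp
qed

text \<open>At the parameter \<open>lam\<close> the function \<open>phi w\<close> has right-hand
  side \<open>(w - lam) * phi w\<close>, which makes the tail bound proportional to its own
  mass.\<close>

lemma eigen_tail:
  assumes "phi w \<in> L2 \<L>" "0 < M" "form_tail M N"
  shows "M * tail N X (phi w) \<le> (norm (w - lam))\<^sup>2 * (LINT x|\<L>. (norm (phi w x))\<^sup>2)"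
proof -
  have s: "sol lam (\<lambda>x. (w - lam) * phi w x) (phi w) (phig w)"
    using phi(1)[of w] sol_shift[of w "\<lambda>_. 0" "phi w" "phig w" "of_real lam"] by simp
  have "M * tail N X (phi w) \<le> (LINT x|\<L>. (norm ((w - lam) * phi w x))\<^sup>2)"
    by (rule lam_solution(2)[OF L2_cmult[OF assms(1)] assms(2,3) s assms(1)])
  then show ?thesis by (simp add: norm_mult power_mult_distrib)
qed

text \<open>Eigenfunctions to different eigenvalues are orthogonal; but \<open>\<phi>\<^sub>w\<close> tends to \<open>\<phi>\<^sub>z\<close> on
  compact sets as \<open>w \<rightarrow> z\<close>, and the tails are uniformly small.\<close>

lemma eigenvalue_isolated:
  assumes z: "phi z \<in> L2 \<L>"
  shows "\<exists>e>0. \<forall>w. phi w \<in> L2 \<L> \<longrightarrow> dist w z < e \<longrightarrow> w = z"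
proof -
  \<comment> \<open>Bounds \<open>(norm (w - lam))\<^sup>2\<close> for all \<open>w\<close> within
    distance 1 of \<open>z\<close>; with weight \<open>8 * m\<close> the tails beyond
    \<open>N\<close> carry at most an eighth of the mass.\<close>
  define m where "m = (norm (z - lam) + 1)\<^sup>2"
  have m: "0 < m" unfolding m_def by (intro zero_less_power add_nonneg_pos) auto
  obtain N where N: "form_tail (8 * m) N" using form_tail[of "8 * m"] m by auto
  then have N0: "0 \<le> N" by (simp add: form_tail_def)
  define V where "V = (sol_const N (norm z))\<^sup>2 * N * N"
  have V: "0 \<le> V" using N0 by (simp add: V_def)
  \<comment> \<open>Makes \<open>V * (norm (w - z))\<^sup>2\<close> at most 1/2, where
    \<open>V\<close> is the constant of continuous dependence on \<open>(0,N)\<close>.\<close>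
  define e where "e = min 1 (1 / (2 * (V + 1)))"
  have e: "0 < e" "e \<le> 1" "e \<le> 1 / (2 * (V + 1))" using V by (auto simp: e_def)
  have "w = z" if w: "phi w \<in> L2 \<L>" "dist w z < e" for w
  proof (rule ccontr)
    assume ne: "w \<noteq> z"
    define A where "A = (LINT x|\<L>. (norm (phi w x))\<^sup>2)"
    define B where "B = (LINT x|\<L>. (norm (phi z x))\<^sup>2)"
    have AB: "0 < A" "0 < B" using phi_norm_pos w z by (simp_all add: A_def B_def)
    have tl: "8 * tail N X (phi y) \<le> (LINT x|\<L>. (norm (phi y x))\<^sup>2)" if y: "phi y \<in> L2 \<L>" "dist y z < 1" for y X
    proof -
      have "norm (y - lam) \<le> norm (z - lam) + 1"
        using norm_triangle_ineq[of "z - lam" "y - z"] y(2) by (simp add: dist_norm)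
      then have "(norm (y - lam))\<^sup>2 \<le> m" unfolding m_def by (rule power_mono) simp
      then have le: "(norm (y - lam))\<^sup>2 * (LINT x|\<L>. (norm (phi y x))\<^sup>2) \<le> m * (LINT x|\<L>. (norm (phi y x))\<^sup>2)"
        using phi_norm_pos[OF y(1)] by (intro mult_right_mono) auto
      have "m * (8 * tail N X (phi y)) \<le> m * (LINT x|\<L>. (norm (phi y x))\<^sup>2)"
        using order_trans[OF eigen_tail[OF y(1) _ N, of X] le] m by (simp add: mult_ac)
      then show ?thesis using m by (subst (asm) mult_le_cancel_left_pos) auto
    qed
    have tw: "8 * tail N X (phi w) \<le> A" for X unfolding A_def using e w by (intro tl) auto
    have tz: "8 * tail N X (phi z) \<le> B" for X unfolding B_def by (rule tl[OF z]) simp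
    define d where "d x = phi w x - phi z x" for x
    have dL: "d \<in> L2 \<L>" unfolding d_def[abs_def] by (rule L2_diff[OF w(1) z])
    note i = L2_set_integrable[OF w(1)] L2_set_integrable[OF z] L2_set_integrable[OF dL]
    have dtail: "tail N X d \<le> A / 4 + B / 4" for X
    proof -
      have S: "{N<..<X} \<in> sets \<L>" by (rule Leb.Ioo_sets'[OF N0])
      have "tail N X d \<le> (LINT x:{N<..<X}|\<L>. 2 * (norm (phi w x))\<^sup>2 + 2 * (norm (phi z x))\<^sup>2)"
        unfolding tail_def
      proof (rule set_integral_mono[OF i(3)[OF S]])
        show "set_integrable \<L> {N<..<X} (\<lambda>x. 2 * (norm (phi w x))\<^sup>2 + 2 * (norm (phi z x))\<^sup>2)"
          by (intro set_integral_add(1) set_integrable_mult_right i S)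
        show "(norm (d x))\<^sup>2 \<le> 2 * (norm (phi w x))\<^sup>2 + 2 * (norm (phi z x))\<^sup>2" for x
          using norm_add_sq_le[of "phi w x" "- phi z x"] by (simp add: d_def)
      qed
      also have "\<dots> = 2 * tail N X (phi w) + 2 * tail N X (phi z)"
        unfolding tail_def by (rule set_integral_lin[OF i(1,2)[OF S]])
      finally show ?thesis using tw[of X] tz[of X] by linarith
    qed
    \<comment> \<open>Pythagoras: orthogonal eigenfunctions cannot be close to each other in
      \<open>L2\<close>.\<close>
    have dsq: "(LINT x|\<L>. (norm (d x))\<^sup>2) = A + B"
    proof -
      have "L2_inner \<L> d d = L2_inner \<L> (phi w) d + (-1) * L2_inner \<L> (phi z) d"
        using L2_inner_add_left[OF w(1) z dL, of "-1"] by (simp add: d_def[abs_def])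
      also have "L2_inner \<L> (phi w) d = of_real A"
        using L2_inner_add_right[OF w(1) z w(1), of "-1"] eigen_orthogonal[OF z w(1) ne]
        by (simp add: d_def[abs_def] L2_inner_self A_def)
      also have "L2_inner \<L> (phi z) d = - of_real B"
        using L2_inner_add_right[OF w(1) z z, of "-1"] eigen_orthogonal[OF w(1) z ne[symmetric]]
        by (simp add: d_def[abs_def] L2_inner_self B_def)
      finally have "complex_of_real (LINT x|\<L>. (norm (d x))\<^sup>2) = of_real (A + B)" by (simp add: L2_inner_self)
      then show ?thesis by (simp only: of_real_eq_iff)
    qed
    have "nsq X d \<le> nsq N d + (A / 4 + B / 4)" for X
    proof (cases "N \<le> X")
      case True
      have "nsq X d = nsq N d + tail N X d"
        by (rule nsq_split[OF N0 True L2_measurable[OF dL] i(3)[OF Leb.Ioo_sets]])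
      then show ?thesis using dtail[of X] by simp
    next
      case False
      then have "nsq X d \<le> nsq N d" by (intro nsq_mono i(3) Leb.Ioo_sets) auto
      then show ?thesis using AB by simp
    qed
    from L2_if_nsq_bounded(2)[OF L2_measurable[OF dL] i(3)[OF Leb.Ioo_sets] this]
    \<comment> \<open>The tail of \<open>d\<close> accounts for at most a quarter of
      \<open>A + B\<close>, so the rest sits on \<open>(0,N)\<close>; continuous dependence allows
      only \<open>A / 2\<close> there.\<close>
    have lower: "3/4 * (A + B) \<le> nsq N d" unfolding dsq by simp
    have sw: "sol z (\<lambda>x. (w - z) * phi w x) (phi w) (phig w)"
      using phi(1)[of w] sol_shift[of w "\<lambda>_. 0" "phi w" "phig w" z] by simp
    have sd: "sol z (\<lambda>x. (w - z) * phi w x) d (\<lambda>x. phig w x - phig z x)"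
      using sol_minus_phi[OF sw, of 1] by (simp add: d_def[abs_def])
    have d0: "d 0 = 0" by (simp add: d_def phi(2))
    have kN: "nsq N (\<lambda>x. (w - z) * phi w x) \<le> (norm (w - z))\<^sup>2 * A"
      using nsq_le_L2[OF L2_cmult[OF w(1), of "w - z"], of N] by (simp add: A_def norm_mult power_mult_distrib)
    have "nsq N d \<le> (LINT x:{0<..<N}|\<L>. (sol_const N (norm z))\<^sup>2 * N * nsq N (\<lambda>x. (w - z) * phi w x))"
      unfolding nsq_def[of N d]
    proof (rule set_integral_mono[OF i(3)[OF Leb.Ioo_sets] Leb.integrable_const_Ioo])
      fix x assume "x \<in> {0<..<N}"
      then show "(norm (d x))\<^sup>2 \<le> (sol_const N (norm z))\<^sup>2 * N * nsq N (\<lambda>x. (w - z) * phi w x)"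
        by (intro sol_bound_nsq[OF sd d0 order.refl] L2_set_integrable[OF L2_cmult[OF w(1)]] Leb.Ioo_sets) auto
    qed
    also have "\<dots> = V * nsq N (\<lambda>x. (w - z) * phi w x)"
      using Leb_const(2)[OF order.refl N0] by (simp add: V_def mult_ac)
    also have "\<dots> \<le> V * ((norm (w - z))\<^sup>2 * A)" by (rule mult_left_mono[OF kN V])
    also have "\<dots> \<le> 1/2 * A"
    proof -
      have "(norm (w - z))\<^sup>2 \<le> e * 1"
        unfolding power2_eq_square using w(2) e by (intro mult_mono) (auto simp: dist_norm)
      then have "V * (norm (w - z))\<^sup>2 \<le> V * (1 / (2 * (V + 1)))" using e V by (intro mult_left_mono) auto
      also have "\<dots> \<le> 1/2" using V by (simp add: field_simps)
      finally have "V * (norm (w - z))\<^sup>2 * A \<le> 1/2 * A" using AB by (intro mult_right_mono) auto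
      then show ?thesis by (simp add: mult.assoc)
    qed
    finally show False using lower AB by simp
  qed
  then show ?thesis using e(1) by blast
qed

lemma ham_discrete: "discrete_spectrum \<L> (hamiltonian \<nu> q)"
  unfolding discrete_spectrum_def
proof (intro ballI conjI)
  fix z assume z: "z \<in> spectrum \<L> (hamiltonian \<nu> q)"
  note pz = spectrum_phi[OF z]
  obtain e where e: "0 < e" "\<And>w. phi w \<in> L2 \<L> \<Longrightarrow> dist w z < e \<Longrightarrow> w = z"
    using eigenvalue_isolated[OF pz] by blast
  have "ball z e \<inter> spectrum \<L> (hamiltonian \<nu> q) = {z}"
    using z e spectrum_phi by (auto simp: dist_commute)
  then show "z isolated_in spectrum \<L> (hamiltonian \<nu> q)"
    unfolding isolated_in_def using z open_ball by blast
qed (use eigenvalue_phi spectrum_phi in blast)+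

end

section \<open>Density of the domain\<close>

text \<open>Completeness of \<open>L2\<close> in terms of representatives: the geometric rate gives
  convergence almost everywhere without passing to a subsequence.\<close>

lemma L2_Cauchy_limit:
  fixes f :: "nat \<Rightarrow> 'a \<Rightarrow> complex"
  assumes f: "\<And>n. f n \<in> L2 M"
    and cau: "\<And>n m. (LINT x|M. (norm (f n x - f m x))\<^sup>2) \<le> C * ((1/8)^n + (1/8)^m)"
  shows "\<exists>p\<in>L2 M. \<forall>n. (LINT x|M. (norm (f n x - p x))\<^sup>2) \<le> 2 * C * (1/8)^n"
proof -
  note [measurable] = L2_measurable[OF f]
  have C: "0 \<le> C"
    using order_trans[OF _ cau[of 0 0], of 0] by simp
  have nn: "(\<integral>\<^sup>+x. ennreal ((norm (f n x - f m x))\<^sup>2) \<partial>M) \<le> ennreal (C * ((1/8)^n + (1/8)^m))" for n m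
    unfolding nn_integral_eq_integral[OF L2_sq_integrable[OF L2_diff[OF f f]] AE_I2[OF zero_le_power2]]
    by (rule ennreal_leI[OF cau])
  \<comment> \<open>The weight \<open>2^n\<close> still leaves a summable bound of order
    \<open>(1/4)^n\<close>, and a finite sum at \<open>x\<close> forces the increments to decay like
    \<open>(sqrt (1/2))^n\<close>.\<close>
  define D where "D n x = ennreal (2^n * (norm (f (Suc n) x - f n x))\<^sup>2)" for n x
  have [measurable]: "D n \<in> borel_measurable M" for n unfolding D_def by measurable
  have Dint: "(\<integral>\<^sup>+x. D n x \<partial>M) \<le> ennreal (2 * C * (1/4)^n)" for n
  proof -
    have "(\<integral>\<^sup>+x. D n x \<partial>M) = (\<integral>\<^sup>+x. ennreal (2^n) * ennreal ((norm (f (Suc n) x - f n x))\<^sup>2) \<partial>M)"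
      unfolding D_def by (intro nn_integral_cong) (simp add: ennreal_mult)
    also have "\<dots> = ennreal (2^n) * (\<integral>\<^sup>+x. ennreal ((norm (f (Suc n) x - f n x))\<^sup>2) \<partial>M)"
      by (rule nn_integral_cmult) measurable
    also have "\<dots> \<le> ennreal (2^n) * ennreal (C * ((1/8)^Suc n + (1/8)^n))"
      by (intro mult_left_mono nn) simp
    also have "\<dots> = ennreal (2^n * (C * ((1/8)^Suc n + (1/8)^n)))"
      using C by (subst ennreal_mult) auto
    also have "\<dots> \<le> ennreal (2 * C * (1/4)^n)"
    proof (rule ennreal_leI)
      have "2^n * (C * ((1/8)^Suc n + (1/8)^n)) = 9/8 * C * (2 * (1/8))^n"
        unfolding power_mult_distrib by (simp add: algebra_simps)
      also have "\<dots> \<le> 2 * C * (1/4)^n" using C by (simp add: mult_right_mono)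
      finally show "2^n * (C * ((1/8)^Suc n + (1/8)^n)) \<le> 2 * C * (1/4)^n" .
    qed
    finally show ?thesis .
  qed
  have "(\<integral>\<^sup>+x. (\<Sum>n. D n x) \<partial>M) = (\<Sum>n. \<integral>\<^sup>+x. D n x \<partial>M)"
    by (rule nn_integral_suminf) measurable
  also have "\<dots> \<le> (\<Sum>n. ennreal (2 * C * (1/4)^n))"
    by (intro suminf_le Dint) auto
  also have "\<dots> = ennreal (\<Sum>n. 2 * C * (1/4)^n)"
    using C by (intro suminf_ennreal2 summable_mult summable_geometric) auto
  also have "\<dots> < \<infinity>" by simp
  finally have fin: "(\<integral>\<^sup>+x. (\<Sum>n. D n x) \<partial>M) \<noteq> \<infinity>" by simp
  have "AE x in M. (\<Sum>n. D n x) \<noteq> \<infinity>"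
    by (rule nn_integral_PInf_AE[OF _ fin]) measurable
  then have conv: "AE x in M. (\<lambda>n. f n x) \<longlonglongrightarrow> lim (\<lambda>n. f n x)"
  proof eventually_elim
    case (elim x)
    then obtain S where S: "0 \<le> S" "(\<Sum>n. D n x) = ennreal S" by (cases "\<Sum>n. D n x") auto
    have b: "norm (f (Suc n) x - f n x) \<le> sqrt S * (sqrt (1/2))^n" for n
    proof -
      have "D n x \<le> ennreal S" unfolding S(2)[symmetric] using sum_le_suminf[of "\<lambda>n. D n x" "{n}"] by simp
      then have "2^n * (norm (f (Suc n) x - f n x))\<^sup>2 \<le> S"
        using S(1) unfolding D_def by (subst (asm) ennreal_le_iff) auto
      then have "(norm (f (Suc n) x - f n x))\<^sup>2 \<le> S * (1/2)^n"
        by (simp add: field_simps power_one_over)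
      then have "norm (f (Suc n) x - f n x) \<le> sqrt (S * (1/2)^n)" by (rule real_le_rsqrt)
      then show ?thesis by (simp add: real_sqrt_mult real_sqrt_power)
    qed
    have "sqrt (1/2) < 1" by simp
    then have "summable (\<lambda>n. sqrt S * (sqrt (1/2))^n)"
      by (intro summable_mult summable_geometric) simp
    then have "summable (\<lambda>n. f (Suc n) x - f n x)"
      by (rule summable_comparison_test'[where N=0]) (rule b)
    then have "convergent (\<lambda>n. \<Sum>i<n. f (Suc i) x - f i x)" by (simp add: summable_iff_convergent)
    then have "convergent (\<lambda>n. f n x - f 0 x)" by (simp only: sum_lessThan_telescope[of "\<lambda>i. f i x"])
    then have "convergent (\<lambda>n. f n x)" using convergent_diff_const_right_iff by blast
    then show ?case by (simp add: convergent_LIMSEQ_iff)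
  qed
  define p where "p x = lim (\<lambda>n. f n x)" for x
  have [measurable]: "p \<in> borel_measurable M" unfolding p_def by measurable
  \<comment> \<open>Fatou's lemma in the second index of the Cauchy estimate.\<close>
  have est: "(\<integral>\<^sup>+x. ennreal ((norm (f n x - p x))\<^sup>2) \<partial>M) \<le> ennreal (2 * C * (1/8)^n)" for n
  proof -
    have "(\<integral>\<^sup>+x. ennreal ((norm (f n x - p x))\<^sup>2) \<partial>M)
        = (\<integral>\<^sup>+x. liminf (\<lambda>m. ennreal ((norm (f n x - f m x))\<^sup>2)) \<partial>M)"
    proof (rule nn_integral_cong_AE)
      show "AE x in M. ennreal ((norm (f n x - p x))\<^sup>2) = liminf (\<lambda>m. ennreal ((norm (f n x - f m x))\<^sup>2))"
        using conv
      proof eventually_elim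
        case (elim x)
        then have "(\<lambda>m. ennreal ((norm (f n x - f m x))\<^sup>2)) \<longlonglongrightarrow> ennreal ((norm (f n x - p x))\<^sup>2)"
          unfolding p_def by (intro tendsto_intros tendsto_ennrealI)
        from lim_imp_Liminf[OF sequentially_bot this] show ?case by (rule sym)
      qed
    qed
    also have "\<dots> \<le> liminf (\<lambda>m. \<integral>\<^sup>+x. ennreal ((norm (f n x - f m x))\<^sup>2) \<partial>M)"
      by (rule nn_integral_liminf) measurable
    also have "\<dots> \<le> ennreal (2 * C * (1/8)^n)"
    proof (rule Liminf_le)
      show "\<forall>\<^sub>F m in sequentially. (\<integral>\<^sup>+x. ennreal ((norm (f n x - f m x))\<^sup>2) \<partial>M) \<le> ennreal (2 * C * (1/8)^n)"
      proof (rule eventually_sequentiallyI[of n])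
        fix m assume "n \<le> m"
        then have "(1/8::real)^m \<le> (1/8)^n" by (intro power_decreasing) auto
        then have "C * ((1/8)^n + (1/8)^m) \<le> C * (2 * (1/8)^n)" using C by (intro mult_left_mono) auto
        then show "(\<integral>\<^sup>+x. ennreal ((norm (f n x - f m x))\<^sup>2) \<partial>M) \<le> ennreal (2 * C * (1/8)^n)"
          by (intro order_trans[OF nn] ennreal_leI) (simp add: mult_ac)
      qed
    qed simp
    finally show ?thesis .
  qed
  have int: "integrable M (\<lambda>x. (norm (f n x - p x))\<^sup>2)" for n
    by (rule integrableI_bounded) (use order.strict_trans1[OF est[of n]] in auto)
  then have "(\<lambda>x. f 0 x - p x) \<in> L2 M" by (simp add: L2_def)
  from L2_diff[OF f[of 0] this] have "p \<in> L2 M" by simp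
  moreover have "(LINT x|M. (norm (f n x - p x))\<^sup>2) \<le> 2 * C * (1/8)^n" for n
    using est[of n] C unfolding nn_integral_eq_integral[OF int AE_I2[OF zero_le_power2]]
    by (subst (asm) ennreal_le_iff) auto
  ultimately show ?thesis by blast
qed

lemma L2_parallelogram:
  assumes "a \<in> L2 M" "b \<in> L2 M"
  shows "(LINT x|M. (norm (a x - b x))\<^sup>2) = 2 * (LINT x|M. (norm (a x))\<^sup>2) + 2 * (LINT x|M. (norm (b x))\<^sup>2)
    - (LINT x|M. (norm (a x + b x))\<^sup>2)"
proof -
  have "(norm (s - t))\<^sup>2 + (norm (s + t))\<^sup>2 = 2 * (norm s)\<^sup>2 + 2 * (norm t)\<^sup>2" for s t :: complex
    unfolding cmod_power2 by (simp add: power2_eq_square algebra_simps)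
  then have "(LINT x|M. (norm (a x - b x))\<^sup>2 + (norm (a x + b x))\<^sup>2) = (LINT x|M. 2 * (norm (a x))\<^sup>2 + 2 * (norm (b x))\<^sup>2)"
    by simp
  moreover have "integrable M (\<lambda>x. (norm (a x - b x))\<^sup>2)" "integrable M (\<lambda>x. (norm (a x + b x))\<^sup>2)"
    using L2_sq_integrable[OF L2_diff[OF assms]] L2_sq_integrable[OF L2_add[OF assms, of 1]] by simp_all
  ultimately show ?thesis
    using L2_sq_integrable[OF assms(1)] L2_sq_integrable[OF assms(2)] by simp
qed

lemma L2_expand:
  assumes a: "a \<in> L2 M" and b: "b \<in> L2 M"
  shows "(LINT x|M. (norm (a x + t * b x))\<^sup>2) = (LINT x|M. (norm (a x))\<^sup>2) + 2 * Re (cnj t * L2_inner M a b)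
    + (norm t)\<^sup>2 * (LINT x|M. (norm (b x))\<^sup>2)"
proof -
  have i: "integrable M (\<lambda>x. cnj t * (a x * cnj (b x)))"
    by (intro integrable_mult_right L2_inner_integrable a b)
  have "(norm (a x + t * b x))\<^sup>2 = ((norm (a x))\<^sup>2 + 2 * Re (cnj t * (a x * cnj (b x)))) + (norm t)\<^sup>2 * (norm (b x))\<^sup>2" for x
    unfolding cmod_power2 by (simp add: power2_eq_square algebra_simps)
  then have "(LINT x|M. (norm (a x + t * b x))\<^sup>2) =
      (LINT x|M. ((norm (a x))\<^sup>2 + 2 * Re (cnj t * (a x * cnj (b x)))) + (norm t)\<^sup>2 * (norm (b x))\<^sup>2)" by simp
  also have "\<dots> = ((LINT x|M. (norm (a x))\<^sup>2) + 2 * (LINT x|M. Re (cnj t * (a x * cnj (b x))))) + (norm t)\<^sup>2 * (LINT x|M. (norm (b x))\<^sup>2)"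
    using L2_sq_integrable[OF a] L2_sq_integrable[OF b] integrable_Re[OF i]
    by (simp only: Bochner_Integration.integral_add Bochner_Integration.integrable_add integrable_mult_right
        integral_mult_right_zero)
  also have "(LINT x|M. Re (cnj t * (a x * cnj (b x)))) = Re (LINT x|M. cnj t * (a x * cnj (b x)))"
    by (rule integral_Re[OF i])
  also have "(LINT x|M. cnj t * (a x * cnj (b x))) = cnj t * L2_inner M a b"
    by (simp add: L2_inner_def)
  finally show ?thesis .
qed

lemma L2_cmult_sq:
  fixes f :: "'a \<Rightarrow> complex"
  shows "(LINT x|M. (norm (c * f x))\<^sup>2) = (norm c)\<^sup>2 * (LINT x|M. (norm (f x))\<^sup>2)"
  by (simp add: norm_mult power_mult_distrib)

text \<open>A minimising sequence for the distance converges, and the error is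
  orthogonal to the subspace.\<close>

lemma L2_dense_if_orthogonal_trivial:
  assumes D: "D \<subseteq> L2 M" "D \<noteq> {}" "\<And>f g a. f \<in> D \<Longrightarrow> g \<in> D \<Longrightarrow> (\<lambda>x. f x + a * g x) \<in> D"
    and triv: "\<And>w. w \<in> L2 M \<Longrightarrow> (\<And>f. f \<in> D \<Longrightarrow> L2_inner M w f = 0) \<Longrightarrow> AE x in M. w x = 0"
    and g: "g \<in> L2 M" and e: "0 < e"
  shows "\<exists>f\<in>D. L2_norm M (\<lambda>x. g x - f x) < e"
proof -
  define dd where "dd f = (LINT x|M. (norm (g x - f x))\<^sup>2)" for f
  define \<delta> where "\<delta> = Inf (dd ` D)"
  have dd0: "0 \<le> dd f" for f unfolding dd_def by (rule integral_nonneg_AE) simp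
  have bb: "bdd_below (dd ` D)" by (rule bdd_belowI[of _ 0]) (use dd0 in auto)
  have low: "\<delta> \<le> dd f" if "f \<in> D" for f unfolding \<delta>_def by (rule cInf_lower[OF _ bb]) (use that in simp)
  have "\<exists>f\<in>D. dd f < \<delta> + (1/8)^n" for n
    using cInf_lessD[of "dd ` D" "\<delta> + (1/8)^n"] D(2) by (auto simp: \<delta>_def)
  then obtain f where f: "\<And>n. f n \<in> D" "\<And>n. dd (f n) < \<delta> + (1/8)^n" by metis
  have fL: "f n \<in> L2 M" for n using f(1) D(1) by blast
  have gf: "(\<lambda>x. g x - f n x) \<in> L2 M" for n by (rule L2_diff[OF g fL])
  have "(LINT x|M. (norm (f n x - f m x))\<^sup>2) \<le> 2 * ((1/8)^n + (1/8)^m)" for n m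
  proof -
    \<comment> \<open>The midpoint is again in \<open>D\<close>, so its distance is at least
      \<open>\<delta>\<close>, and the parallelogram identity makes the minimising sequence
      Cauchy.\<close>
    define h where "h x = (1/2) * (f n x + f m x)" for x
    have h: "h \<in> D"
    proof -
      \<comment> \<open>The closure property keeps coefficient 1 on its first argument, so half of
        \<open>f n\<close> is written as \<open>f n - f n / 2\<close>.\<close>
      have "(\<lambda>x. f n x + (-1/2) * f n x) \<in> D" by (rule D(3)[OF f(1) f(1)])
      then have "(\<lambda>x. (f n x + (-1/2) * f n x) + (1/2) * f m x) \<in> D" by (rule D(3)[OF _ f(1)])
      moreover have "(\<lambda>x. (f n x + (-1/2) * f n x) + (1/2) * f m x) = h" by (auto simp: h_def)
      ultimately show ?thesis by simp
    qed
    have "(LINT x|M. (norm ((g x - f m x) - (g x - f n x)))\<^sup>2) = 2 * dd (f m) + 2 * dd (f n)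
        - (LINT x|M. (norm ((g x - f m x) + (g x - f n x)))\<^sup>2)"
      unfolding dd_def by (rule L2_parallelogram[OF gf gf])
    moreover have "(LINT x|M. (norm ((g x - f m x) + (g x - f n x)))\<^sup>2) = 4 * dd h"
    proof -
      have "(g x - f m x) + (g x - f n x) = 2 * (g x - h x)" for x
        by (simp add: h_def field_simps)
      then show ?thesis using L2_cmult_sq[of M 2 "\<lambda>x. g x - h x"] unfolding dd_def by (simp only:) simp
    qed
    ultimately show ?thesis using f(2)[of n] f(2)[of m] low[OF h] by simp
  qed
  from L2_Cauchy_limit[of f, OF fL this] obtain p where p: "p \<in> L2 M"
    and fp: "\<And>n. (LINT x|M. (norm (f n x - p x))\<^sup>2) \<le> 2 * 2 * (1/8)^n" by blast
  define w where "w x = g x - p x" for x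
  have w: "w \<in> L2 M" unfolding w_def[abs_def] by (rule L2_diff[OF g p])
  have orth: "L2_inner M w h = 0" if h: "h \<in> D" for h
  proof (rule ccontr)
    define c where "c = L2_inner M w h"
    assume "L2_inner M w h \<noteq> 0"
    then have c: "c \<noteq> 0" by (simp add: c_def)
    have hL: "h \<in> L2 M" using h D(1) by blast
    define H where "H = (LINT x|M. (norm (h x))\<^sup>2)"
    have H0: "0 \<le> H" unfolding H_def by (rule integral_nonneg_AE) simp
    have lim: "(\<lambda>n. L2_inner M (\<lambda>x. g x - f n x) h) \<longlonglongrightarrow> c"
    proof -
      have "(\<lambda>n. L2_inner M (\<lambda>x. f n x - p x) h) \<longlonglongrightarrow> 0"
      proof (rule Lim_null_comparison[OF always_eventually[OF allI]])
        fix n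
        have fpL: "(\<lambda>x. f n x - p x) \<in> L2 M" by (rule L2_diff[OF fL p])
        have "norm (L2_inner M (\<lambda>x. f n x - p x) h) \<le> (LINT x|M. norm ((f n x - p x) * cnj (h x)))"
          unfolding L2_inner_def by (rule integral_norm_bound)
        also have "\<dots> \<le> (LINT x|M. 2^n * (norm (f n x - p x))\<^sup>2 + (1/2)^n * (norm (h x))\<^sup>2)"
        proof (rule integral_mono)
          show "integrable M (\<lambda>x. norm ((f n x - p x) * cnj (h x)))"
            by (intro integrable_norm L2_inner_integrable fpL hL)
          show "integrable M (\<lambda>x. 2^n * (norm (f n x - p x))\<^sup>2 + (1/2)^n * (norm (h x))\<^sup>2)"
            by (intro Bochner_Integration.integrable_add integrable_mult_right L2_sq_integrable fpL hL)
          fix x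
          define s where "s = norm (f n x - p x)"
          define t where "t = norm (h x)"
          have st: "0 \<le> s * t" by (simp add: s_def t_def)
          \<comment> \<open>The weights \<open>2^n\<close> and \<open>(1/2)^n\<close> make both
            terms vanish, because the squared error decays like \<open>(1/8)^n\<close>.\<close>
          have "0 \<le> (2^n * s - t)\<^sup>2" by simp
          then have "2^n * (2 * (s * t)) \<le> 2^n * (2^n * s\<^sup>2 + (1/2)^n * t\<^sup>2)"
            by (simp add: power2_eq_square algebra_simps power_one_over)
          then have "2 * (s * t) \<le> 2^n * s\<^sup>2 + (1/2)^n * t\<^sup>2" by (subst (asm) mult_le_cancel_left_pos) auto
          then have "s * t \<le> 2^n * s\<^sup>2 + (1/2)^n * t\<^sup>2" using st by linarith
          then show "norm ((f n x - p x) * cnj (h x)) \<le> 2^n * (norm (f n x - p x))\<^sup>2 + (1/2)^n * (norm (h x))\<^sup>2"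
            by (simp add: norm_mult s_def t_def)
        qed
        also have "\<dots> = 2^n * (LINT x|M. (norm (f n x - p x))\<^sup>2) + (1/2)^n * H"
          using L2_sq_integrable[OF fpL] L2_sq_integrable[OF hL] by (simp add: H_def)
        also have "\<dots> \<le> 2^n * (4 * (1/8)^n) + (1/2)^n * H"
          using fp[of n] by (intro add_right_mono mult_left_mono) auto
        also have "2^n * (4 * (1/8)^n) = 4 * (1/4::real)^n"
          unfolding power_one_over by (simp add: field_simps flip: power_mult_distrib)
        finally show "norm (L2_inner M (\<lambda>x. f n x - p x) h) \<le> 4 * (1/4)^n + (1/2)^n * H" .
      next
        have "(\<lambda>n. 4 * (1/4::real)^n + (1/2)^n * H) \<longlonglongrightarrow> 4 * 0 + 0 * H"
          by (intro tendsto_intros LIMSEQ_power_zero) auto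
        then show "(\<lambda>n. 4 * (1/4::real)^n + (1/2)^n * H) \<longlonglongrightarrow> 0" by simp
      qed
      then have "(\<lambda>n. c - L2_inner M (\<lambda>x. f n x - p x) h) \<longlonglongrightarrow> c - 0" by (intro tendsto_intros)
      moreover have "L2_inner M (\<lambda>x. g x - f n x) h = c - L2_inner M (\<lambda>x. f n x - p x) h" for n
        using L2_inner_add_left[OF w L2_diff[OF fL p] hL, of "-1" n] by (simp add: w_def c_def)
      ultimately show ?thesis by simp
    qed
    \<comment> \<open>Length of a step in the direction of \<open>h\<close>: it changes the squared
      distance by \<open>- 2 * s + s\<^sup>2 * H\<close> times \<open>(norm c)\<^sup>2\<close>,
      which is negative as \<open>s * H < 1\<close>.\<close>
    define s where "s = 1 / (H + 1)"
    have s: "0 < s" "s * H < 1" using H0 by (auto simp: s_def field_simps)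
    define t where "t = - of_real s * c"
    have ineq: "0 \<le> (1/8)^n + 2 * Re (cnj t * L2_inner M (\<lambda>x. g x - f n x) h) + (norm t)\<^sup>2 * H" for n
    proof -
      have "(\<lambda>x. f n x + (-t) * h x) \<in> D" by (rule D(3)[OF f(1) h])
      from low[OF this] have "\<delta> \<le> (LINT x|M. (norm ((g x - f n x) + t * h x))\<^sup>2)"
        by (simp add: dd_def algebra_simps)
      also have "\<dots> = dd (f n) + 2 * Re (cnj t * L2_inner M (\<lambda>x. g x - f n x) h) + (norm t)\<^sup>2 * H"
        unfolding dd_def H_def by (rule L2_expand[OF gf hL])
      finally show ?thesis using f(2)[of n] by linarith
    qed
    have "(\<lambda>n. (1/8)^n + 2 * Re (cnj t * L2_inner M (\<lambda>x. g x - f n x) h) + (norm t)\<^sup>2 * H)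
        \<longlonglongrightarrow> 0 + 2 * Re (cnj t * c) + (norm t)\<^sup>2 * H"
      by (intro tendsto_intros LIMSEQ_power_zero lim) auto
    then have "0 \<le> 0 + 2 * Re (cnj t * c) + (norm t)\<^sup>2 * H"
      by (rule LIMSEQ_le_const) (use ineq in auto)
    moreover have "Re (cnj t * c) = - s * (norm c)\<^sup>2"
    proof -
      have "cnj t * c = of_real (- s) * (c * cnj c)" by (simp add: t_def)
      also have "\<dots> = of_real (- s * (norm c)\<^sup>2)" by (simp only: complex_norm_square[symmetric] of_real_mult)
      finally show ?thesis by simp
    qed
    moreover have "(norm t)\<^sup>2 = s * s * (norm c)\<^sup>2" using s by (simp add: t_def norm_mult power_mult_distrib power2_eq_square)
    ultimately have "0 \<le> s * (norm c)\<^sup>2 * (s * H - 2)" by (simp add: algebra_simps)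
    moreover have "s * (norm c)\<^sup>2 * (s * H - 2) < 0"
      using s c by (intro mult_pos_neg mult_pos_pos) auto
    ultimately show False by simp
  qed
  have wz: "AE x in M. w x = 0" by (rule triv[OF w orth])
  have "dd (f n) \<le> 4 * (1/8)^n" for n
  proof -
    have "dd (f n) = (LINT x|M. (norm (f n x - p x))\<^sup>2)"
      unfolding dd_def
    proof (rule integral_cong_AE)
      show "AE x in M. (norm (g x - f n x))\<^sup>2 = (norm (f n x - p x))\<^sup>2"
        using wz by eventually_elim (simp add: w_def norm_minus_commute)
    qed (use L2_measurable[OF g] L2_measurable[OF fL] L2_measurable[OF p] in simp_all)
    then show ?thesis using fp[of n] by simp
  qed
  moreover have "(\<lambda>n. 4 * (1/8::real)^n) \<longlonglongrightarrow> 4 * 0" by (intro tendsto_intros LIMSEQ_power_zero) auto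
  then have "\<forall>\<^sub>F n in sequentially. 4 * (1/8::real)^n < e\<^sup>2"
    using order_tendstoD(2)[of _ "0::real" sequentially "e\<^sup>2"] e by simp
  then obtain n where "4 * (1/8::real)^n < e\<^sup>2" by (auto simp: eventually_sequentially)
  ultimately have "dd (f n) < e\<^sup>2" by (meson le_less_trans)
  then have "L2_norm M (\<lambda>x. g x - f n x) < e"
    unfolding L2_norm_def dd_def using e real_less_lsqrt[of e] by simp
  then show ?thesis using f(1) by blast
qed

text \<open>The integrals over rays \<open>{..<a}\<close> vanish. Rays are stable under intersection
  and generate the Borel sets, so the integrals over all Borel sets vanish, and then the density
  does.\<close>

lemma AE_zero_if_primitive_zero:
  fixes k :: "real \<Rightarrow> complex"
  assumes i: "\<And>c. set_integrable \<L> {0<..<c} k" and z: "\<And>x. 0 \<le> x \<Longrightarrow> (LINT t:{0<..<x}|\<L>. k t) = 0"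
  shows "AE x in \<L>. k x = 0"
proof -
  have "AE x in \<L>. indicator {0<..<real n} x *\<^sub>R k x = 0" for n
  proof (rule Leb.density_zero)
    define f where "f x = indicator {0<..<real n} x *\<^sub>R k x" for x
    have fi: "integrable \<L> f" using i[of "real n"] unfolding set_integrable_def f_def[abs_def] .
    then show "integrable \<L> (\<lambda>x. indicator {0<..<real n} x *\<^sub>R k x)" by (simp add: f_def[abs_def])
    have fA: "set_integrable \<L> B f" if "B \<in> sets \<L>" for B
      unfolding set_integrable_def by (rule integrable_mult_indicator[OF that fi])
    have tot: "(LINT x|\<L>. f x) = 0" using z[of "real n"] by (simp add: f_def[abs_def] set_lebesgue_integral_def)
    have pos: "B \<inter> {0<..} \<in> sets \<L>" if "B \<in> sets borel" for B :: "real set"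
      using that by (simp add: Leb.sets_M_iff)
    have bor: "sets borel = sigma_sets UNIV (range (lessThan :: real \<Rightarrow> real set))"
      unfolding borel_Iio by (rule sets_measure_of) simp
    have "(LINT x:(B \<inter> {0<..})|\<L>. f x) = 0" if "B \<in> sigma_sets UNIV (range (lessThan :: real \<Rightarrow> real set))" for B
      using that
    proof (rule sigma_sets_induct_disjoint[rotated 2])
      show "Int_stable (range (lessThan :: real \<Rightarrow> real set))"
      proof (rule Int_stableI)
        fix a b assume "a \<in> range (lessThan :: real \<Rightarrow> real set)" "b \<in> range (lessThan :: real \<Rightarrow> real set)"
        then obtain s t where "a = {..<s}" "b = {..<t}" by auto
        then have "a \<inter> b = {..<min s t}" by auto
        then show "a \<inter> b \<in> range (lessThan :: real \<Rightarrow> real set)" by simp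
      qed
      fix B assume "B \<in> range (lessThan :: real \<Rightarrow> real set)"
      then obtain a where B: "B = {..<a}" by auto
      \<comment> \<open>The maximum with \<open>0\<close> and the minimum with \<open>real n\<close>
        account for rays ending left of \<open>0\<close> and for the truncation of
        \<open>k\<close>.\<close>
      have "(LINT x:(B \<inter> {0<..})|\<L>. f x) = (LINT x:{0<..<max 0 (min a (real n))}|\<L>. k x)"
        unfolding set_lebesgue_integral_def f_def B
        by (rule Bochner_Integration.integral_cong) (auto simp: indicator_def)
      then show "(LINT x:(B \<inter> {0<..})|\<L>. f x) = 0" using z by simp
    next
      fix B assume B: "B \<in> sigma_sets UNIV (range (lessThan :: real \<Rightarrow> real set))" "(LINT x:(B \<inter> {0<..})|\<L>. f x) = 0"
      have S: "B \<inter> {0<..} \<in> sets \<L>" "(UNIV - B) \<inter> {0<..} \<in> sets \<L>"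
        using B(1) by (auto intro!: pos simp: bor[symmetric])
      have "(LINT x|\<L>. f x) = (LINT x:(B \<inter> {0<..}) \<union> ((UNIV - B) \<inter> {0<..})|\<L>. f x)"
        unfolding set_lebesgue_integral_def by (rule Bochner_Integration.integral_cong) (auto simp: indicator_def)
      also have "\<dots> = (LINT x:(B \<inter> {0<..})|\<L>. f x) + (LINT x:((UNIV - B) \<inter> {0<..})|\<L>. f x)"
        by (rule set_integral_Un[OF _ fA[OF S(1)] fA[OF S(2)]]) auto
      finally show "(LINT x:((UNIV - B) \<inter> {0<..})|\<L>. f x) = 0" using B(2) tot by simp
    next
      fix A :: "nat \<Rightarrow> real set"
      assume A: "disjoint_family A" "range A \<subseteq> sigma_sets UNIV (range lessThan)" "\<And>i. (LINT x:(A i \<inter> {0<..})|\<L>. f x) = 0"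
      have S: "A i \<inter> {0<..} \<in> sets \<L>" for i using A(2) by (intro pos) (auto simp: bor)
      have "(LINT x:(\<Union>i. A i \<inter> {0<..})|\<L>. f x) = (\<Sum>i. LINT x:(A i \<inter> {0<..})|\<L>. f x)"
      proof (rule lebesgue_integral_countable_add[OF S])
        show "(A i \<inter> {0<..}) \<inter> (A j \<inter> {0<..}) = {}" if "i \<noteq> j" for i j
          using A(1) that by (auto simp: disjoint_family_on_def)
        show "set_integrable \<L> (\<Union>i. A i \<inter> {0<..}) f" by (rule fA, rule sets.countable_UN') (use S in auto)
      qed
      then show "(LINT x:((\<Union>i. A i) \<inter> {0<..})|\<L>. f x) = 0" using A(3) by simp
    qed auto
    note all = this
    fix B assume B: "B \<in> sets \<L>"
    then have "B \<in> sets borel" "B \<inter> {0<..} = B" by (auto simp: Leb.sets_M_iff)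
    then have "(LINT x:B|\<L>. f x) = 0" using all[of B] by (simp add: bor)
    then show "(LINT x:B|\<L>. indicator {0<..<real n} x *\<^sub>R k x) = 0" by (simp add: f_def[abs_def])
  qed
  then have "AE x in \<L>. \<forall>n. indicator {0<..<real n} x *\<^sub>R k x = 0"
    by (subst AE_all_countable) blast
  then show ?thesis
    using AE_space
  proof eventually_elim
    case (elim x)
    moreover obtain n where "x < real n" using reals_Archimedean2 by blast
    ultimately show ?case using spec[OF elim(1), of n] by simp
  qed
qed

lemma AE_zero_imp_zero_in_interval:
  assumes "AE x in \<L>. u x = 0" "0 \<le> a" "a < b"
  shows "\<exists>x. a < x \<and> x < b \<and> u x = 0"
proof (rule ccontr)
  assume *: "\<not> ?thesis"
  have "(LINT x:{a<..<b}|\<L>. (1::real)) = 0"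
    unfolding set_lebesgue_integral_def
  proof (rule integral_eq_zero_AE)
    show "AE x in \<L>. indicat_real {a<..<b} x *\<^sub>R (1::real) = 0"
      using assms(1) by eventually_elim (use * in \<open>auto simp: indicator_def\<close>)
  qed
  then show False using Leb_const(2)[of a b 1] assms by simp
qed

context sturm_liouville
begin

text \<open>The relation is single-valued: \<open>u = 0\<close> forces \<open>u\<^sup>[\<^sup>1\<^sup>] = 0\<close> by Green's identity, hence \<open>k = 0\<close>.\<close>

lemma sol_single_valued:
  assumes s: "sol z k u g" and u: "AE x in \<L>. u x = 0"
  shows "AE x in \<L>. k x = 0"
proof -
  define E where "E x = (of_real (q x) - z) * u x - k x" for x
  have E: "loc_ac \<L> g E" using sol_loc_ac'[OF s] by (simp add: E_def[abs_def])
  have gi: "set_integrable \<L> {0<..<c} (\<lambda>x. (norm (g x))\<^sup>2)" for c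
    using bounded_sq_integrable[OF sol_g_measurable[OF s] Leb.loc_ac_bounded[OF E, of _ c]] by simp
  have "nsq X g \<le> 0" for X
  proof -
    \<comment> \<open>A zero of \<open>u\<close> beyond \<open>X\<close> removes the boundary term
      there, so the energy on \<open>(0,x)\<close> vanishes without any condition at
      infinity.\<close>
    obtain x where x: "max X 0 < x" "u x = 0"
      using AE_zero_imp_zero_in_interval[OF u, of "max X 0" "max X 0 + 1"] by auto
    have "(LINT t:{0<..<x}|\<L>. u t * cnj ((of_real (q t) - z) * u t - k t)) = 0"
      unfolding set_lebesgue_integral_def
    proof (rule integral_eq_zero_AE)
      show "AE t in \<L>. indicat_real {0<..<x} t *\<^sub>R (u t * cnj ((of_real (q t) - z) * u t - k t)) = 0"
        using u by eventually_elim simp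
    qed
    then have "(LINT t:{0<..<x}|P. g t * cnj (g t)) = 0"
      using green_first[OF s s, of x] x by simp
    moreover note i = P.parts_integrable(1)[OF sol_loc_ac[OF s] loc_ac_cnj[OF sol_loc_ac'[OF s]], of x]
    have "(LINT t:{0<..<x}|P. (norm (g t))\<^sup>2) = Re (LINT t:{0<..<x}|P. g t * cnj (g t))"
      "set_integrable P {0<..<x} (\<lambda>t. (norm (g t))\<^sup>2)"
      using set_integral_Re[OF i] by (simp_all add: complex_norm_square[symmetric])
    moreover from this(2) have "nsq x g \<le> (LINT t:{0<..<x}|P. (norm (g t))\<^sup>2)"
      unfolding nsq_def by (rule Leb_le_P) (use sol_g_measurable[OF s] in auto)
    ultimately have "nsq x g \<le> 0" by simp
    then show ?thesis using nsq_mono[OF gi, of X x] x(1) by simp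
  qed
  note L2_if_nsq_bounded[OF sol_g_measurable[OF s] gi this]
  then have g: "AE x in \<L>. g x = 0" by (rule L2_AE_zero)
  \<comment> \<open>Left continuity upgrades vanishing almost everywhere to vanishing at each
    point.\<close>
  have g0: "g x = 0" if x: "0 \<le> x" for x
  proof (rule ccontr)
    assume ne: "g x \<noteq> 0"
    then have x0: "0 < x" using x sol_0[OF s] by (cases "x = 0") auto
    have "eventually (\<lambda>y. g y \<noteq> 0) (at_left x)"
      by (rule tendsto_imp_eventually_ne[OF Leb.loc_ac_left_limit[OF E x0] ne])
    then obtain b where b: "b < x" "\<And>y. b < y \<Longrightarrow> y < x \<Longrightarrow> g y \<noteq> 0"
      by (auto simp: eventually_at_left_field)
    then show False
      using AE_zero_imp_zero_in_interval[OF g, of "max b 0" x] x0 by auto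
  qed
  have "AE x in \<L>. E x = 0"
  proof (rule AE_zero_if_primitive_zero[OF loc_ac_integrable[OF E]])
    fix x :: real assume "0 \<le> x"
    then show "(LINT t:{0<..<x}|\<L>. E t) = 0"
      using loc_ac_eq[OF E, of x] g0[of x] g0[of 0] by simp
  qed
  then show ?thesis using u by eventually_elim (simp add: E_def)
qed

end

context gaps
begin

lemma ham_lincomb:
  assumes 1: "(f, h) \<in> hamiltonian \<nu> q" and 2: "(f', h') \<in> hamiltonian \<nu> q"
  shows "(\<lambda>x. f x + a * f' x, \<lambda>x. h x + a * h' x) \<in> hamiltonian \<nu> q"
proof -
  obtain u g where u: "sol 0 (\<lambda>x. h x - 0 * f x) u g" "u \<in> L2 \<L>" "AE x in \<L>. f x = u x"
    using ham_repr'[OF 1, of 0] by blast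
  obtain v y where v: "sol 0 (\<lambda>x. h' x - 0 * f' x) v y" "v \<in> L2 \<L>" "AE x in \<L>. f' x = v x"
    using ham_repr'[OF 2, of 0] by blast
  have L: "f \<in> L2 \<L>" "h \<in> L2 \<L>" "f' \<in> L2 \<L>" "h' \<in> L2 \<L>" using ham_L2[OF 1] ham_L2[OF 2] by auto
  have "sol 0 (\<lambda>x. h x + a * h' x) (\<lambda>x. u x + a * v x) (\<lambda>x. g x + a * y x)"
    using sol_lincomb[OF u(1) v(1), of a] by simp
  from ham_intro[OF this L2_add[OF u(2) v(2)] L2_add[OF L(2,4)]]
  show ?thesis
    by (rule ham_cong_AE[OF _ L2_add[OF L(1,3)] L2_add[OF L(2,4)]])
      (use u(3) v(3) in \<open>eventually_elim, simp\<close>, simp)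
qed

text \<open>Reduces to vectors \<open>w\<close> orthogonal to the domain. Since
  \<open>H - lam\<close> is onto, \<open>w = (H - lam) f\<close> for some \<open>f\<close> in the
  domain, and \<open>w\<close> is orthogonal to this \<open>f\<close>.\<close>

lemma ham_dense: "densely_defined \<L> (hamiltonian \<nu> q)"
  unfolding densely_defined_def
proof (intro ballI allI impI)
  fix g and e :: real assume g: "g \<in> L2 \<L>" and e: "0 < e"
  have "\<exists>f\<in>fst ` hamiltonian \<nu> q. L2_norm \<L> (\<lambda>x. g x - f x) < e"
  proof (rule L2_dense_if_orthogonal_trivial[OF _ _ _ _ g e])
    show "fst ` hamiltonian \<nu> q \<subseteq> L2 \<L>" using ham_L2 by auto
    show "fst ` hamiltonian \<nu> q \<noteq> {}" using ham_onto[OF L2_zero phi_lam_not_L2] by auto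
    show "(\<lambda>x. f x + a * f' x) \<in> fst ` hamiltonian \<nu> q"
      if ff': "f \<in> fst ` hamiltonian \<nu> q" "f' \<in> fst ` hamiltonian \<nu> q" for f f' a
    proof -
      obtain h h' where "(f, h) \<in> hamiltonian \<nu> q" "(f', h') \<in> hamiltonian \<nu> q" using ff' by auto
      from ham_lincomb[OF this, of a] show ?thesis by force
    qed
    fix w assume w: "w \<in> L2 \<L>" and orth: "\<And>f. f \<in> fst ` hamiltonian \<nu> q \<Longrightarrow> L2_inner \<L> w f = 0"
    obtain f h :: "real \<Rightarrow> complex" where fh: "(f, h) \<in> hamiltonian \<nu> q" and hw: "AE x in \<L>. h x - lam * f x = w x"
      using ham_onto[OF w phi_lam_not_L2] by auto
    have L: "f \<in> L2 \<L>" "h \<in> L2 \<L>" using ham_L2[OF fh] by auto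
    have "L2_inner \<L> w f = 0" by (rule orth) (use fh in force)
    moreover have "L2_inner \<L> w f = L2_inner \<L> (\<lambda>x. h x + (- of_real lam) * f x) f"
      by (rule L2_inner_cong_AE) (use hw w L L2_add[OF L(2,1), of "- of_real lam"] in \<open>auto dest: L2_measurable elim: eventually_mono\<close>)
    ultimately have "L2_inner \<L> h f = of_real (lam * (L2_norm \<L> f)\<^sup>2)"
      using L2_inner_add_left[OF L(2,1,1), of "- of_real lam"] by (simp add: L2_inner_self L2_norm_sq)
    \<comment> \<open>The form at \<open>f\<close> equals \<open>lam\<close> times the squared norm,
      while semiboundedness puts it at least half a squared norm higher.\<close>
    then have "(L2_norm \<L> f)\<^sup>2 \<le> 0" using ham_semibounded[OF fh] by simp
    then have f0: "AE x in \<L>. f x = 0" by (intro L2_AE_zero[OF L(1)]) (simp only: L2_norm_sq)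
    obtain u y where u: "sol lam (\<lambda>x. h x - lam * f x) u y" "AE x in \<L>. f x = u x"
      using ham_repr'[OF fh, of lam] by blast
    have "AE x in \<L>. u x = 0" using f0 u(2) by eventually_elim simp
    from sol_single_valued[OF u(1) this] show "AE x in \<L>. w x = 0"
      using hw by eventually_elim simp
  qed
  then show "\<exists>(f, h)\<in>hamiltonian \<nu> q. L2_norm \<L> (\<lambda>x. g x - f x) < e" by force
qed

end

theorem theorem8p17:
  fixes \<nu> :: "real measure" and q :: "real \<Rightarrow> real"
    and \<Delta> :: "nat \<Rightarrow> real set" and d :: "nat \<Rightarrow> real"
  assumes "sets \<nu> = sets (restrict_space borel {0<..})"
    and "mutually_singular lborel_pos \<nu>"
    and "\<And>c. c > 0 \<Longrightarrow> emeasure \<nu> {0<..<c} < \<infinity>"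
    and "\<And>c. c > 0 \<Longrightarrow> set_integrable lborel {0<..<c} q"
    and "\<not> bounded (measure_support \<nu>)"
    and "measure_support \<nu> \<in> null_sets lborel"
    and "bij_betw \<Delta> UNIV (components ({0<..} - measure_support \<nu>))"
    and "\<And>k. d k = measure lborel (\<Delta> k)"
    and "bdd_above (range d)"
    and "bdd_above (range (\<lambda>k. 1 / d k * (LINT x:\<Delta> k|lborel. (\<bar>q x\<bar> - q x) / 2)))"
    and "\<And>\<epsilon>. \<epsilon> > 0 \<Longrightarrow> filterlim (\<lambda>x. LINT t:{x..x + \<epsilon>}|lborel. q t) at_top at_top"
    and "filterlim (\<lambda>k. 1 / d k * (LINT x:\<Delta> k|lborel. q x)) at_top sequentially"
  shows "self_adjoint lborel_pos (hamiltonian \<nu> q) \<and>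
         lower_semibounded lborel_pos (hamiltonian \<nu> q) \<and>
         discrete_spectrum lborel_pos (hamiltonian \<nu> q)"
proof -
  interpret gaps \<nu> q \<Delta>
  proof
    show "sets \<nu> = sets \<L>" using assms(1) by (simp add: sets_lborel_pos)
    show "emeasure \<nu> {0<..<c} < \<infinity>" for c using assms(3)[of c] by (cases "0 < c") auto
    show "set_integrable \<L> {0<..<c} q" for c
      using assms(4)[of c] Leb_set_integrable[of "{0<..<c}" q] by (cases "0 < c") (auto simp: subset_eq)
  qed (use assms(5-7,9-12) in \<open>simp_all add: assms(8)\<close>)
  have "lam * (L2_norm \<L> f)\<^sup>2 \<le> Re (L2_inner \<L> h f)" if "(f, h) \<in> hamiltonian \<nu> q" for f h
    using ham_semibounded[OF that] zero_le_power2[of "L2_norm \<L> f"] by linarith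
  then have "lower_semibounded \<L> (hamiltonian \<nu> q)"
    unfolding lower_semibounded_def by blast
  then show ?thesis
    using ham_dense ham_eq_adjoint ham_discrete by (simp add: self_adjoint_def)
qed

end
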